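(* Let $H$ be a transfer Krull monoid over a finite abelian non-cyclic group $G$, and suppose that $G$ satisfies at least one of the following conditions. (a) $G$ is a $p$-group for some prime $p$, and $\gcd(\exp(G)-2, \mathsf D(G)-2)=1$. (b) $G\cong C_{p^{s_1}}^{r_1}\oplus C_{p^{s_2}}^{r_2}$, where $p$ is a prime and $r_1,r_2,s_1,s_2$ are positive integers such that $s_1$ divides $s_2$, and $G$ is not an elementary $2$-group. (c) $\exp(G)=pq$, where $p,q$ are distinct primes satisfying at least one of the following properties: (i) $\gcd(pq-2,\mathsf D(G)-2)=1$; (ii) $\gcd(pq-2,p+q-3)=1$; (iii) $q=2$ and $p-1$ is a power of $2$; (iv) $q=2$ and $\mathsf r_p(G)=1$. (d) $\exp(G)\in\{3,4,5,6,7,9,10,11\}$. Then $\Delta_\rho(H)=\{1\}$.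
   Context: Groups and sequences. Let $G$ be an additively written finite abelian group. $\mathcal F(G)$ is the (multiplicatively written) free abelian monoid with basis $G$; its elements are called sequences over $G$. For $S=g_1\cdots g_\ell\in\mathcal F(G)$, $|S|=\ell$ is its length and $\sigma(S)=g_1+\cdots+g_\ell$ its sum. $\mathcal B(G)=\{S\in\mathcal F(G):\sigma(S)=0\}$ is the monoid of zero-sum sequences over $G$; its atoms are the minimal zero-sum sequences (non-empty zero-sum sequences with no proper non-empty zero-sum subsequence). The Davenport constant $\mathsf D(G)$ is the maximal length of a minimal zero-sum sequence over $G$. $\exp(G)$ is the exponent, $C_n$ the cyclic group of order $n$, $C_n^r$ the direct sum of $r$ copies of $C_n$, and $\mathsf r_p(G)$ the $p$-rank. An elementary $2$-group is a group isomorphic to $C_2^r$ for some $r$. Convention: $\gcd(0,n)=n$. Monoids. A monoid is a commutative cancellative semigroup with identity. For a monoid $H$, $H^\times$ is its group of units and $\mathcal A(H)$ its set of atoms (irreducible elements); $H$ is atomic if every non-unit is a finite product of atoms. For a non-unit $a\in H$, $\mathsf L(a)$ is the set of all positive integers $k$ such that $a=u_1\cdots u_k$ with $u_1,\ldots,u_k\in\mathcal A(H)$; for a unit $a$, $\mathsf L(a)=\{0\}$. Put $\mathcal L(H)=\{\mathsf L(a):a\in H\}$. For a finite nonempty set $L$ of positive integers, $\rho(L)=\max L/\min L$, and $\rho(\{0\})=1$. The elasticity of $H$ is $\rho(H)=\sup\{\rho(L):L\in\mathcal L(H)\}$. Transfer Krull monoids. A monoid $H$ is a transfer Krull monoid over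 $G$ if there is a transfer homomorphism $\theta:H\to\mathcal B(G)$, i.e. a surjective monoid homomorphism such that $\theta^{-1}(\{1\})=H^\times$ (where $1$ is the empty sequence) and such that whenever $u\in H$ and $\theta(u)=BC$ with $B,C\in\mathcal B(G)$, there are $v,w\in H$ with $u=vw$, $\theta(v)=B$, $\theta(w)=C$. The set $\Delta_\rho(H)$. $\Delta_\rho(H)$ is the set of all positive integers $d$ with the following property: for every positive integer $k$ there is some $L_k\in\mathcal L(H)$ with $\rho(L_k)=\rho(H)$ which has the form $L_k=y+(L'\cup\{0,d,\ldots,\ell d\}\cup L'')\subset y+d\mathbb Z$, where $y\in\mathbb Z$, $\ell\ge k$, and $L',L''$ are finite (possibly empty) sets of integers with all elements of $L'$ negative ($\max L'<0$) and all elements of $L''$ greater than $\ell d$ ($\min L''>\ell d$). *)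

theory Defs
  imports
    "HOL-Algebra.Algebra"
    "HOL-Library.Multiset"
    "HOL-Library.Extended_Real"
    "HOL-Computational_Algebra.Primes"
begin

text \<open>
  The abelian group \<open>G\<close> is a HOL-Algebra \<^const>\<open>comm_group\<close>, hence written multiplicatively:
  \<open>\<one>\<close> plays the role of \<open>0\<close>, and \<open>g [^] n\<close> that of \<open>n g\<close>.
  A sequence over \<open>G\<close> is a finite multiset of elements of \<open>carrier G\<close>; the product of two
  sequences is the multiset sum, and the empty sequence is the empty multiset.
\<close>

subsection \<open>Finite abelian groups\<close>

definition group_exponent :: "('g, 'm) monoid_scheme \<Rightarrow> nat" where
  "group_exponent G = (LEAST n. 0 < n \<and> (\<forall>g\<in>carrier G. g [^]\<^bsub>G\<^esub> n = \<one>\<^bsub>G\<^esub>))"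

definition finite_p_group :: "nat \<Rightarrow> ('g, 'm) monoid_scheme \<Rightarrow> bool" where
  "finite_p_group p G \<longleftrightarrow> group G \<and> (\<exists>n. order G = p ^ n)"

definition cyclic_power :: "nat \<Rightarrow> nat \<Rightarrow> (nat \<Rightarrow> int) monoid" where
  "cyclic_power n r = product_group {..<r} (\<lambda>_. integer_mod_group n)"

definition elementary_2_group :: "('g, 'm) monoid_scheme \<Rightarrow> bool" where
  "elementary_2_group G \<longleftrightarrow> (\<exists>r. G \<cong> cyclic_power 2 r)"

definition independent_in :: "('g, 'm) monoid_scheme \<Rightarrow> 'g set \<Rightarrow> bool" where
  "independent_in G E \<longleftrightarrow>
     finite E \<and> E \<subseteq> carrier G \<and> \<one>\<^bsub>G\<^esub> \<notin> E \<and>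
     (\<forall>m :: 'g \<Rightarrow> int. finprod G (\<lambda>e. e [^]\<^bsub>G\<^esub> m e) E = \<one>\<^bsub>G\<^esub> \<longrightarrow>
        (\<forall>e\<in>E. e [^]\<^bsub>G\<^esub> m e = \<one>\<^bsub>G\<^esub>))"

text \<open>
  The \<open>p\<close>-rank is the maximal cardinality of an independent set of elements of \<open>p\<close>-power order
  (equivalently, the number of cyclic \<open>p\<close>-groups in a decomposition of \<open>G\<close> into cyclic groups of
  prime power order). For finite \<open>G\<close> the maximum is over a finite set containing \<open>0\<close>.
\<close>

definition p_rank :: "nat \<Rightarrow> ('g, 'm) monoid_scheme \<Rightarrow> nat" where
  "p_rank p G = Max {card E | E. independent_in G E \<and> (\<forall>e\<in>E. \<exists>k. group.ord G e = p ^ k)}"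

subsection \<open>Zero-sum sequences\<close>

definition seq_sum :: "('g, 'm) monoid_scheme \<Rightarrow> 'g multiset \<Rightarrow> 'g" where
  "seq_sum G S = finprod G (\<lambda>g. g [^]\<^bsub>G\<^esub> count S g) (set_mset S)"

definition zero_sum_monoid :: "('g, 'm) monoid_scheme \<Rightarrow> 'g multiset monoid" where
  "zero_sum_monoid G =
     \<lparr>carrier = {S. set_mset S \<subseteq> carrier G \<and> seq_sum G S = \<one>\<^bsub>G\<^esub>},
      monoid.mult = (+), one = {#}\<rparr>"

definition minimal_zero_sum :: "('g, 'm) monoid_scheme \<Rightarrow> 'g multiset \<Rightarrow> bool" where
  "minimal_zero_sum G S \<longleftrightarrow>
     S \<in> carrier (zero_sum_monoid G) \<and> S \<noteq> {#} \<and>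
     (\<forall>T. T \<subset># S \<and> T \<noteq> {#} \<longrightarrow> T \<notin> carrier (zero_sum_monoid G))"

definition davenport :: "('g, 'm) monoid_scheme \<Rightarrow> nat" where
  "davenport G = Max {size S | S. minimal_zero_sum G S}"

subsection \<open>Sets of lengths and elasticity\<close>

text \<open>
  A monoid in the sense of factorization theory is a \<^const>\<open>comm_monoid_cancel\<close>; its atoms are the
  elements of the carrier that are \<^const>\<open>Divisibility.irreducible\<close>.
\<close>

definition length_set :: "('h, 'n) monoid_scheme \<Rightarrow> 'h \<Rightarrow> nat set" where
  "length_set H a =
     (if a \<in> Units H then {0}
      else {k. 0 < k \<and> (\<exists>us. set us \<subseteq> carrier H \<and> factors H us a \<and> length us = k)})"

definition length_system :: "('h, 'n) monoid_scheme \<Rightarrow> nat set set" where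
  "length_system H = length_set H ` carrier H"

text \<open>
  The value for infinite sets is the usual \<open>sup L / min L\<close>. Every element of an atomic monoid has
  a non-empty set of lengths, so the value at the empty set does not matter.
\<close>

definition set_elasticity :: "nat set \<Rightarrow> ereal" where
  "set_elasticity L =
     (if L = {0} then 1
      else if finite L then ereal (real (Max L) / real (Min L))
      else \<infinity>)"

definition elasticity :: "('h, 'n) monoid_scheme \<Rightarrow> ereal" where
  "elasticity H = (SUP L\<in>length_system H. set_elasticity L)"

definition Delta_rho :: "('h, 'n) monoid_scheme \<Rightarrow> nat set" where
  "Delta_rho H =
     {d. 0 < d \<and>
        (\<forall>k>0. \<exists>L\<in>length_system H.
           set_elasticity L = elasticity H \<and>
           (\<exists>(y::int) (l::nat) (L'::int set) (L''::int set).
              k \<le> l \<and> finite L' \<and> finite L'' \<and>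
              (\<forall>x\<in>L'. x < 0) \<and> (\<forall>x\<in>L''. int (l * d) < x) \<and>
              int ` L = (\<lambda>x. y + x) ` (L' \<union> {int (i * d) | i. i \<le> l} \<union> L'') \<and>
              int ` L \<subseteq> {y + int d * z | z. z \<in> UNIV}))}"

subsection \<open>Transfer Krull monoids\<close>

definition transfer_hom ::
  "('h, 'n) monoid_scheme \<Rightarrow> ('b, 'm) monoid_scheme \<Rightarrow> ('h \<Rightarrow> 'b) \<Rightarrow> bool" where
  "transfer_hom H B \<theta> \<longleftrightarrow>
     \<theta> \<in> hom H B \<and> \<theta> \<one>\<^bsub>H\<^esub> = \<one>\<^bsub>B\<^esub> \<and> \<theta> ` carrier H = carrier B \<and>
     {u \<in> carrier H. \<theta> u = \<one>\<^bsub>B\<^esub>} = Units H \<and>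
     (\<forall>u\<in>carrier H. \<forall>b\<in>carrier B. \<forall>c\<in>carrier B. \<theta> u = b \<otimes>\<^bsub>B\<^esub> c \<longrightarrow>
        (\<exists>v\<in>carrier H. \<exists>w\<in>carrier H. u = v \<otimes>\<^bsub>H\<^esub> w \<and> \<theta> v = b \<and> \<theta> w = c))"

definition transfer_krull_monoid ::
  "('h, 'n) monoid_scheme \<Rightarrow> ('g, 'm) monoid_scheme \<Rightarrow> bool" where
  "transfer_krull_monoid H G \<longleftrightarrow>
     comm_monoid_cancel H \<and> (\<exists>\<theta>. transfer_hom H (zero_sum_monoid G) \<theta>)"

end

theory Submission
  imports Defs "HOL-Number_Theory.Cong"
begin

text \<open>
  Lengths are preserved by the transfer homomorphism, so one may work with zero-sum sequences.
  An element of maximal elasticity is at the same time a product of atoms of length \<open>2\<close> and of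
  atoms \<open>U\<close> of maximal length \<open>D\<close>; if it has sufficiently many factors, it is therefore divisible by a
  high power of some \<open>U\<close> times its inverse. Hence \<open>\<Delta>\<^sub>\<rho> = {1}\<close> as soon as for every such \<open>U\<close> the only
  \<open>d\<close> dividing all differences of lengths over \<open>supp U \<union> - supp U\<close> is \<open>1\<close>.

  Such a \<open>d\<close> divides \<open>ord g - 2\<close> for all \<open>g\<close> in the support, and replacing \<open>c\<close> copies of \<open>g\<close> in an atom
  by \<open>ord g - c\<close> copies of \<open>-g\<close> shows \<open>c \<equiv> 1\<close> modulo \<open>d\<close> whenever the result is an atom again. Applied
  to an element \<open>g\<close> of the support and an independent subset \<open>E\<close> of it, this leaves, for the least
  \<open>k > 0\<close> with \<open>k g \<in> \<langle>E\<rangle>\<close>, only the possibilities \<open>k g = 0\<close> with \<open>k \<equiv> 2\<close>, or \<open>k g \<noteq> 0\<close> with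
  \<open>k \<equiv> 1\<close>, and then \<open>k g\<close> is a multiple of a single element of \<open>E\<close> or an involution. In each
  of the listed groups this confines the support to a cyclic group \<open>\<langle>e\<rangle>\<close> and a
  complement meeting it in involutions only, which is impossible for an atom of maximal length.
\<close>

section \<open>Zero-sum sequences and their sets of lengths\<close>

text \<open>That \<open>d\<close> divides \<open>ord g - 2\<close> comes from multiplying an atom by
  its negative: two atoms on one side, as many pairs as its length on the other. Involutions are the
  exception because a coefficient equal to half the order disappears when a relation is doubled. The
  hypotheses on \<open>G\<close> enter as arithmetic of the least k with k g in the span (the index
  of g), which divides the exponent. For prime powers, \<open>s1 dvd s2\<close> excludes an index
  \<open>p ^ s1\<close> congruent to 1, since \<open>p ^ s2\<close> would then be congruent to 1 as
  well, while it is congruent to 2. For exponent pq and odd \<open>d\<close>, index p or q forces p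
  + q to be congruent to 3. The obstacle is exponent 2p with even \<open>d\<close>: index p,
  congruent to 1, is arithmetically possible, so basis elements may share an involution.
  Independence is then taken modulo involutions, relations hold only up to an involution, and a
  parity argument on the doubled relation decides.\<close>

lemma int_set_least_divides:
  fixes D :: "int set"
  assumes "x \<in> D" "x \<noteq> 0"
    and diff: "\<And>a b. a \<in> D \<Longrightarrow> b \<in> D \<Longrightarrow> a - b \<in> D"
  obtains d where "d \<in> D" "d > 0" "\<And>z. z \<in> D \<Longrightarrow> d dvd z"
proof -
  have zero: "0 \<in> D" using diff[OF assms(1,1)] by simp
  have neg: "- a \<in> D" if "a \<in> D" for a using diff[OF zero that] by simp
  have add: "a + b \<in> D" if "a \<in> D" "b \<in> D" for a b using diff[OF that(1) neg[OF that(2)]] by simp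
  have mul: "int n * a \<in> D" if "a \<in> D" for a n
    by (induction n) (auto simp: zero algebra_simps intro: add that)
  define P where "P n \<longleftrightarrow> n > 0 \<and> int n \<in> D" for n
  have "P (nat \<bar>x\<bar>)"
    using assms(1,2) neg[OF assms(1)] unfolding P_def by (cases "x \<ge> 0") auto
  hence P: "P (LEAST n. P n)" by (rule LeastI)
  define d where "d = int (LEAST n. P n)"
  have d: "d > 0" "d \<in> D" using P unfolding P_def d_def by auto
  have "d dvd z" if z: "z \<in> D" for z
  proof -
    have "d * k \<in> D" for k
    proof (cases "k \<ge> 0")
      case True
      then show ?thesis using mul[OF d(2), of "nat k"] by (simp add: mult.commute)
    next
      case False
      then show ?thesis using neg[OF mul[OF d(2), of "nat (-k)"]] by (simp add: mult.commute)
    qed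
    from diff[OF z this[of "z div d"]] have m: "z mod d \<in> D" by (simp add: minus_mult_div_eq_mod)
    have "\<not> z mod d > 0"
    proof
      assume h: "z mod d > 0"
      hence "P (nat (z mod d))" using m unfolding P_def by auto
      hence "(LEAST n. P n) \<le> nat (z mod d)" by (rule Least_le)
      moreover have "z mod d < d" using d(1) by simp
      ultimately show False using h unfolding d_def by linarith
    qed
    with d(1) show ?thesis by (metis dvd_eq_mod_eq_0 order_le_less pos_mod_sign)
  qed
  with d that show ?thesis by blast
qed

lemma subseteq_union_split:
  assumes "T \<subseteq># A + B"
  obtains T1 T2 where "T = T1 + T2" "T1 \<subseteq># A" "T2 \<subseteq># B"
proof -
  have "T = (T \<inter># A) + (T - A)"
    by (auto simp: multiset_eq_iff)
  moreover have "T - A \<subseteq># B" using assms by (simp add: subset_eq_diff_conv add.commute)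
  ultimately show ?thesis using that[of "T \<inter># A" "T - A"] by simp
qed

lemma subseteq_replicateD:
  assumes "T \<subseteq># replicate_mset n x"
  obtains j where "j \<le> n" "T = replicate_mset j x"
  using assms by (metis msubseteq_replicate_msetE)

lemma mset_remove_all: "Y = filter_mset (\<lambda>x. x \<noteq> e) Y + replicate_mset (count Y e) e"
  by (simp add: multiset_eq_iff)

locale finite_comm_group = comm_group G for G :: "('g, 'm) monoid_scheme" (structure) +
  assumes fin: "finite (carrier G)"
begin

section \<open>Orders, inverses and sums of sequences\<close>

abbreviation sigma ("\<sigma>") where "\<sigma> \<equiv> seq_sum G"

lemma ord_pos: "x \<in> carrier G \<Longrightarrow> 0 < ord x"
  using ord_ge_1[OF fin] by fastforce

lemma pow_mod_ord: "x \<in> carrier G \<Longrightarrow> x [^] (n mod ord x) = x [^] n"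
  by (metis pow_eq_div2 nat_pow_closed nat_pow_mult nat_pow_pow pow_ord_eq_1 nat_pow_one r_one l_one mult_div_mod_eq)

lemma inv_pow_eq:
  assumes "x \<in> carrier G"
  shows "inv (x [^] (n::nat)) = x [^] ((ord x - 1) * n)"
proof (rule inv_equality)
  have "(ord x - 1) * n + n = ord x * n"
    using ord_pos[OF assms] by (metis Suc_diff_1 add.commute mult_Suc)
  hence "x [^] ((ord x - 1) * n) \<otimes> x [^] n = x [^] (ord x * n)"
    using assms by (simp add: nat_pow_mult)
  thus "x [^] ((ord x - 1) * n) \<otimes> x [^] n = \<one>" using assms by (simp flip: nat_pow_pow)
qed (use assms in auto)

lemma inv_eq_pow:
  assumes "x \<in> carrier G"
  shows "inv x = x [^] (ord x - 1)"
  using inv_pow_eq[OF assms, of 1] assms by simp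

text \<open>The exchange behind every sign change: \<open>c\<close> copies of \<open>x\<close> and
  \<open>ord x - c\<close> copies of \<open>inv x\<close> have the same sum.\<close>

lemma inv_pow_diff:
  assumes "x \<in> carrier G" "c \<le> ord x"
  shows "inv x [^] (ord x - c) = x [^] c"
proof -
  have "inv x [^] (ord x - c) \<otimes> inv x [^] c = \<one>"
    using assms by (simp add: nat_pow_mult) (metis ord_inv pow_ord_eq_1 inv_closed)
  hence "inv x [^] (ord x - c) = inv (inv x [^] c)" using assms inv_equality by auto
  also have "\<dots> = x [^] c" using assms by (simp add: nat_pow_inv)
  finally show ?thesis .
qed

lemma seq_sum_empty [simp]: "\<sigma> {#} = \<one>"
  by (simp add: seq_sum_def)

lemma seq_sum_closed [simp, intro]: "set_mset S \<subseteq> carrier G \<Longrightarrow> \<sigma> S \<in> carrier G"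
  unfolding seq_sum_def by (rule finprod_closed) auto

lemma seq_sum_add_mset [simp]:
  assumes "g \<in> carrier G" "set_mset S \<subseteq> carrier G"
  shows "\<sigma> (add_mset g S) = g \<otimes> \<sigma> S"
proof -
  \<comment> \<open>Splitting \<open>g\<close> off the support lets both products run over the same
    index set, whether or not \<open>g\<close> occurs in \<open>S\<close>.\<close>
  define A where "A = set_mset S - {g}"
  have A: "finite A" "g \<notin> A" "A \<subseteq> carrier G" using assms by (auto simp: A_def)
  define P where "P = finprod G (\<lambda>h. h [^] count S h) A"
  have P: "P \<in> carrier G" unfolding P_def using A by (intro finprod_closed) auto
  have S: "\<sigma> S = g [^] count S g \<otimes> P"
  proof (cases "g \<in># S")
    case True
    hence "set_mset S = insert g A" by (auto simp: A_def)
    then show ?thesis unfolding seq_sum_def P_def using A assms(1)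
      by (simp) (subst finprod_insert, auto)
  next
    case False
    hence "set_mset S = A" "count S g = 0" by (auto simp: A_def not_in_iff)
    then show ?thesis unfolding seq_sum_def P_def using P P_def by simp
  qed
  have "\<sigma> (add_mset g S) = finprod G (\<lambda>h. h [^] count (add_mset g S) h) (insert g A)"
    unfolding seq_sum_def by (rule arg_cong[of _ _ "finprod G _"]) (auto simp: A_def)
  also have "\<dots> = g [^] Suc (count S g) \<otimes> finprod G (\<lambda>h. h [^] count (add_mset g S) h) A"
    using A assms(1) by (subst finprod_insert) auto
  also have "finprod G (\<lambda>h. h [^] count (add_mset g S) h) A = P"
    unfolding P_def using A by (intro finprod_cong') auto
  finally show ?thesis using S P assms(1) by (simp add: m_ac)
qed

lemma seq_sum_union [simp]:
  assumes "set_mset S \<subseteq> carrier G" "set_mset T \<subseteq> carrier G"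
  shows "\<sigma> (S + T) = \<sigma> S \<otimes> \<sigma> T"
  using assms(1) by (induction S) (auto simp: assms(2) m_assoc)

lemma seq_sum_replicate [simp]: "g \<in> carrier G \<Longrightarrow> \<sigma> (replicate_mset n g) = g [^] n"
proof (induction n)
  case (Suc n)
  have "set_mset (replicate_mset n g) \<subseteq> carrier G" using Suc.prems by auto
  then show ?case using Suc by (simp add: m_comm)
qed simp

lemma seq_sum_repeat [simp]: "set_mset S \<subseteq> carrier G \<Longrightarrow> \<sigma> (repeat_mset n S) = \<sigma> S [^] n"
proof (induction n)
  case (Suc n)
  have "set_mset (repeat_mset n S) \<subseteq> carrier G" using Suc.prems
    by (auto simp: repeat_mset.rep_eq simp flip: count_greater_zero_iff)
  then show ?case using Suc by (simp add: m_comm)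
qed simp

lemma seq_sum_diff:
  assumes "set_mset S \<subseteq> carrier G" "T \<subseteq># S"
  shows "\<sigma> S = \<sigma> T \<otimes> \<sigma> (S - T)"
proof -
  have "S = T + (S - T)" using assms(2) by simp
  moreover have "set_mset T \<subseteq> carrier G" "set_mset (S - T) \<subseteq> carrier G"
    using assms by (auto dest: mset_subset_eqD in_diffD)
  ultimately show ?thesis by (metis seq_sum_union)
qed

lemma seq_sum_inv_image:
  assumes "set_mset S \<subseteq> carrier G"
  shows "\<sigma> (image_mset (m_inv G) S) = inv (\<sigma> S)"
  using assms
proof (induction S)
  case (add x S)
  have "set_mset (image_mset (m_inv G) S) \<subseteq> carrier G" using add.prems by auto
  then show ?case using add by (simp add: inv_mult)
qed simp

section \<open>Zero-sum sequences, atoms and factorizations\<close>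

lemma zs_iff: "S \<in> carrier (zero_sum_monoid G) \<longleftrightarrow> set_mset S \<subseteq> carrier G \<and> \<sigma> S = \<one>"
  by (simp add: zero_sum_monoid_def)

abbreviation "zs S \<equiv> set_mset S \<subseteq> carrier G \<and> \<sigma> S = \<one>"
abbreviation "atom \<equiv> minimal_zero_sum G"

lemma atomI:
  assumes "set_mset S \<subseteq> carrier G" "\<sigma> S = \<one>" "S \<noteq> {#}"
    and "\<And>T. T \<subseteq># S \<Longrightarrow> \<sigma> T = \<one> \<Longrightarrow> T = {#} \<or> T = S"
  shows "atom S"
  unfolding minimal_zero_sum_def zs_iff using assms
  by (metis subset_mset.less_le)

lemma atomD:
  assumes "atom S"
  shows "set_mset S \<subseteq> carrier G" "\<sigma> S = \<one>" "S \<noteq> {#}"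
    and "\<And>T. T \<subseteq># S \<Longrightarrow> \<sigma> T = \<one> \<Longrightarrow> T = {#} \<or> T = S"
proof -
  show a: "set_mset S \<subseteq> carrier G" "\<sigma> S = \<one>" "S \<noteq> {#}"
    using assms by (auto simp: minimal_zero_sum_def zs_iff)
  fix T assume "T \<subseteq># S" "\<sigma> T = \<one>"
  moreover from this a have "set_mset T \<subseteq> carrier G" by (meson set_mset_mono subset_trans)
  ultimately show "T = {#} \<or> T = S" using assms
    by (auto simp: minimal_zero_sum_def zs_iff subset_mset.less_le)
qed

text \<open>A factorization is a multiset of atoms, since the zero-sum monoid is commutative and its
  only unit is the empty sequence. The empty factorization gives that unit the length 0.\<close>

definition lengths :: "'g multiset \<Rightarrow> nat set" where
  "lengths S = {size F | F. (\<forall>U\<in>#F. atom U) \<and> \<Sum>\<^sub># F = S}"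

lemma lengthsI: "(\<And>U. U \<in># F \<Longrightarrow> atom U) \<Longrightarrow> \<Sum>\<^sub># F = S \<Longrightarrow> size F = k \<Longrightarrow> k \<in> lengths S"
  unfolding lengths_def by auto

lemma lengths_add: "k \<in> lengths S \<Longrightarrow> l \<in> lengths T \<Longrightarrow> k + l \<in> lengths (S + T)"
  unfolding lengths_def
proof safe
  fix F F' assume "\<forall>U\<in>#F. atom U" "\<forall>U\<in>#F'. atom U"
  thus "\<exists>Fa. size F + size F' = size Fa \<and> (\<forall>U\<in>#Fa. atom U) \<and> \<Sum>\<^sub># Fa = \<Sum>\<^sub># F + \<Sum>\<^sub># F'"
    by (intro exI[of _ "F + F'"]) auto
qed

lemma lengths_repeat: "k \<in> lengths S \<Longrightarrow> n * k \<in> lengths (repeat_mset n S)"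
proof (induction n)
  case 0
  then show ?case by (auto intro: lengthsI[of "{#}"])
qed (simp add: lengths_add)

lemma lengths_atom: "atom U \<Longrightarrow> 1 \<in> lengths U"
  by (rule lengthsI[of "{#U#}"]) auto

lemma sum_mset_zs: "(\<forall>U\<in>#F. zs U) \<Longrightarrow> zs (\<Sum>\<^sub># F)"
  by (induction F) auto

lemma lengths_zs: "k \<in> lengths S \<Longrightarrow> zs S"
  unfolding lengths_def using sum_mset_zs atomD(1,2) by blast

lemma lengths_exist: "set_mset S \<subseteq> carrier G \<Longrightarrow> \<sigma> S = \<one> \<Longrightarrow> \<exists>k. k \<in> lengths S"
proof (induction "size S" arbitrary: S rule: less_induct)
  case less
  show ?case
  proof (cases "S = {#} \<or> atom S")
    case True
    then show ?thesis using lengths_atom lengthsI[of "{#}" "{#}" 0] by auto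
  next
    case False
    then obtain T where T: "T \<subset># S" "T \<noteq> {#}" "zs T"
      using less.prems unfolding minimal_zero_sum_def zs_iff by auto
    hence sub: "T \<subseteq># S" by (simp add: subset_mset.less_imp_le)
    have c: "set_mset (S - T) \<subseteq> carrier G" using less.prems by (auto dest: in_diffD)
    have "\<sigma> (S - T) = \<one>" using seq_sum_diff[OF less.prems(1) sub] T(3) less.prems c by simp
    moreover have "size (S - T) < size S" "size T < size S"
      using T(1) size_mset_mono[OF sub] nonempty_has_size[of T] T(2)
      by (auto simp: size_Diff_submset[OF sub] mset_subset_size intro!: diff_less)
    ultimately obtain k l where "k \<in> lengths (S - T)" "l \<in> lengths T" using less.hyps c T(3) by metis
    hence "k + l \<in> lengths ((S - T) + T)" by (rule lengths_add)
    thus ?thesis using sub by auto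
  qed
qed

lemma lengths_empty: "lengths {#} = {0}"
proof
  show "lengths {#} \<subseteq> {0}"
  proof
    fix k assume "k \<in> lengths {#}"
    then obtain F where F: "size F = k" "\<forall>U\<in>#F. atom U" "\<Sum>\<^sub># F = {#}" unfolding lengths_def by auto
    have "F = {#}"
    proof (rule ccontr)
      assume "F \<noteq> {#}"
      then obtain U where "U \<in># F" by blast
      thus False using F atomD(3) by (metis sum_mset.remove union_eq_empty)
    qed
    thus "k \<in> {0}" using F by simp
  qed
qed (auto intro: lengthsI[of "{#}"])

section \<open>Finiteness of the Davenport constant\<close>

lemma prefix_sums_inj:
  assumes "set xs \<subseteq> carrier G" "\<And>T. T \<subset># mset xs \<Longrightarrow> T \<noteq> {#} \<Longrightarrow> \<sigma> T \<noteq> \<one>"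
    and "i < j" "j \<le> length xs" "i \<noteq> 0 \<or> j \<noteq> length xs"
  shows "\<sigma> (mset (take i xs)) \<noteq> \<sigma> (mset (take j xs))"
proof
  assume eq: "\<sigma> (mset (take i xs)) = \<sigma> (mset (take j xs))"
  define T where "T = mset (take (j - i) (drop i xs))"
  have tj: "mset (take j xs) = mset (take i xs) + T"
    using assms(3) unfolding T_def by (metis le_add_diff_inverse less_imp_le mset_append take_add)
  have sz: "size T = j - i" using assms(3,4) by (simp add: T_def)
  have sub: "T \<subseteq># mset xs"
    by (metis T_def append_take_drop_id mset_append mset_subset_eq_add_left mset_subset_eq_add_right subset_mset.order_trans)
  have "T \<noteq> mset xs" using sz assms(3,4,5) by auto
  hence "T \<subset># mset xs" using sub by (simp add: subset_mset.le_neq_trans)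
  moreover have "T \<noteq> {#}" using sz assms(3) by auto
  ultimately have "\<sigma> T \<noteq> \<one>" using assms(2) by blast
  moreover have c: "set_mset (mset (take i xs)) \<subseteq> carrier G" "set_mset T \<subseteq> carrier G"
    using assms(1) set_mset_mono[OF sub] set_take_subset[of i xs] by auto
  moreover have "\<sigma> (mset (take i xs)) = \<sigma> (mset (take i xs)) \<otimes> \<sigma> T" using eq tj c by simp
  ultimately show False
    by (metis r_cancel_one' seq_sum_closed m_comm)
qed

text \<open>The classical bound of the Davenport constant by the group order: two equal partial sums
  would enclose a proper zero-sum block.\<close>

lemma atom_size_le:
  assumes "atom S"
  shows "size S \<le> card (carrier G)"
proof -
  obtain xs where xs: "S = mset xs" using ex_mset by metis
  have c: "set xs \<subseteq> carrier G" using atomD(1)[OF assms] xs by simp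
  have n: "\<sigma> T \<noteq> \<one>" if "T \<subset># mset xs" "T \<noteq> {#}" for T
    using atomD(4)[OF assms, of T] that xs by (auto simp: subset_mset.less_le)
  define f where "f i = \<sigma> (mset (take i xs))" for i
  \<comment> \<open>The index \<open>length xs\<close> is left out, since the full sum equals the
    empty one.\<close>
  have "inj_on f {..<length xs}"
  proof (rule linorder_inj_onI)
    fix i j assume "i < j" "j \<in> {..<length xs}"
    then show "f i \<noteq> f j" unfolding f_def by (intro prefix_sums_inj[OF c n]) auto
  qed auto
  moreover have "f ` {..<length xs} \<subseteq> carrier G"
  proof safe
    fix i
    have "set (take i xs) \<subseteq> carrier G" using c set_take_subset by fastforce
    thus "f i \<in> carrier G" unfolding f_def by (intro seq_sum_closed) simp
  qed
  ultimately have "card {..<length xs} \<le> card (carrier G)" using card_inj_on_le fin by blast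
  thus ?thesis using xs by simp
qed

lemma finite_atoms: "finite {S. atom S}"
proof (rule finite_subset)
  let ?n = "card (carrier G)"
  show "{S. atom S} \<subseteq> (\<Union>k\<le>?n. {S. set_mset S \<subseteq> carrier G \<and> size S = k})"
    using atom_size_le atomD(1) by auto
  have "finite {S. set_mset S \<subseteq> carrier G \<and> size S = k}" for k
    using finite_multisets_of_size[OF fin] by (simp add: multisets_of_size_def)
  thus "finite (\<Union>k\<le>?n. {S. set_mset S \<subseteq> carrier G \<and> size S = k})" by auto
qed

lemma finite_atom_sizes: "finite {size S | S. atom S}"
  using finite_imageI[OF finite_atoms, of size] by (simp add: setcompr_eq_image)

lemma atom_le_davenport: "atom S \<Longrightarrow> size S \<le> davenport G"
  unfolding davenport_def using finite_atom_sizes by (intro Max_ge) auto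

lemma atom_one: "atom {#\<one>#}"
proof (rule atomI)
  fix T assume "T \<subseteq># {#\<one>#}"
  then obtain j where "j \<le> 1" "T = replicate_mset j \<one>"
    using subseteq_replicateD[of T 1 \<one>] by auto
  thus "T = {#} \<or> T = {#\<one>#}" by (cases j) auto
qed auto

lemma davenport_attained: obtains U where "atom U" "size U = davenport G"
proof -
  have "davenport G \<in> {size S | S. atom S}"
    unfolding davenport_def by (rule Max_in) (use finite_atom_sizes atom_one in auto)
  thus ?thesis using that by auto
qed

lemma atom_contains_one: "atom S \<Longrightarrow> \<one> \<in># S \<Longrightarrow> S = {#\<one>#}"
  using atomD(4)[of S "{#\<one>#}"] by auto

lemma atom_pair:
  assumes "x \<in> carrier G" "x \<noteq> \<one>"
  shows "atom {#x, inv x#}"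
proof (rule atomI)
  fix T assume T: "T \<subseteq># {#x, inv x#}" "\<sigma> T = \<one>"
  have "size T \<le> 2" using size_mset_mono[OF T(1)] by simp
  consider "size T = 0" | "size T = 1" | "size T = 2" using \<open>size T \<le> 2\<close> by linarith
  then show "T = {#} \<or> T = {#x, inv x#}"
  proof cases
    case 2
    then obtain y where y: "T = {#y#}" by (metis size_1_singleton_mset)
    hence "y = x \<or> y = inv x" using T(1) by auto
    hence "\<sigma> T \<noteq> \<one>" using y assms by (auto simp: inv_eq_1_iff)
    then show ?thesis using T by simp
  next
    case 3
    then show ?thesis using T(1) by (metis mset_subset_size nat_less_le size_add_mset size_empty subset_mset.less_le numeral_2_eq_2)
  qed auto
qed (use assms in auto)

lemma atom_ord:
  assumes "x \<in> carrier G"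
  shows "atom (replicate_mset (ord x) x)"
proof (rule atomI)
  fix T assume T: "T \<subseteq># replicate_mset (ord x) x" "\<sigma> T = \<one>"
  then obtain j where j: "j \<le> ord x" "T = replicate_mset j x" by (metis subseteq_replicateD)
  hence "ord x dvd j" using T assms by (simp add: pow_eq_id)
  hence "j = 0 \<or> j = ord x" using j(1) by (metis dvd_imp_le le_antisym neq0_conv)
  thus "T = {#} \<or> T = replicate_mset (ord x) x" using j(2) by auto
qed (use assms ord_pos in \<open>auto simp: replicate_mset_eq_empty_iff\<close>)

text \<open>Distinctness matters: for an involution a single occurrence would satisfy both
  membership assumptions.\<close>

lemma atom_pair_eq:
  assumes "atom U" "x \<in># U" "inv x \<in># U" "x \<noteq> inv x"
  shows "U = {#x, inv x#}"
proof -
  have x: "x \<in> carrier G" using assms(1,2) atomD(1) by blast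
  have "{#x, inv x#} \<subseteq># U" using assms(2-4) by (simp add: insert_subset_eq_iff in_diff_count)
  moreover have "\<sigma> {#x, inv x#} = \<one>" using x by simp
  ultimately show ?thesis using atomD(4)[OF assms(1)] by (metis add_mset_not_empty)
qed

end

section \<open>Independent sets\<close>

context finite_comm_group
begin

section \<open>Generated subgroups and normal forms over independent sets\<close>

lemma pow_inj:
  assumes "x \<in> carrier G" "x [^] a = x [^] b" "a < ord x" "b < ord x"
  shows "a = b"
proof -
  have "inj_on (\<lambda>n. x [^] n) {0..ord x - 1}" by (rule ord_inj) (use fin assms in auto)
  thus ?thesis using assms(2-4) by (auto dest!: inj_onD)
qed

text \<open>In a finite group the non-negative combinations already form a subgroup, so this is the
  subgroup generated by \<open>E\<close>, presented by multisets of coefficients.\<close>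

definition spn :: "'g set \<Rightarrow> 'g set" where
  "spn E = {\<sigma> Y | Y. set_mset Y \<subseteq> E}"

lemma spnI: "set_mset Y \<subseteq> E \<Longrightarrow> \<sigma> Y \<in> spn E"
  by (auto simp: spn_def)

lemma spn_closed: "E \<subseteq> carrier G \<Longrightarrow> spn E \<subseteq> carrier G"
  unfolding spn_def by auto

lemma spn_one: "\<one> \<in> spn E"
  using spnI[of "{#}" E] by simp

lemma spn_mult:
  assumes "E \<subseteq> carrier G" "x \<in> spn E" "y \<in> spn E"
  shows "x \<otimes> y \<in> spn E"
proof -
  obtain Y Z where "x = \<sigma> Y" "y = \<sigma> Z" "set_mset Y \<subseteq> E" "set_mset Z \<subseteq> E"
    using assms unfolding spn_def by auto
  thus ?thesis using spnI[of "Y + Z" E] assms(1) by (simp add: subset_trans[of _ E])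
qed

lemma spn_pow: "E \<subseteq> carrier G \<Longrightarrow> x \<in> spn E \<Longrightarrow> x [^] (n::nat) \<in> spn E"
  by (induction n) (auto intro: spn_one spn_mult)

lemma spn_inv: "E \<subseteq> carrier G \<Longrightarrow> x \<in> spn E \<Longrightarrow> inv x \<in> spn E"
  using inv_eq_pow spn_pow spn_closed by (metis subsetD)

lemma spn_mono: "E \<subseteq> F \<Longrightarrow> spn E \<subseteq> spn F"
  unfolding spn_def by auto

lemma spn_incl: "e \<in> E \<Longrightarrow> E \<subseteq> carrier G \<Longrightarrow> e \<in> spn E"
  using spnI[of "{#e#}" E] by auto

lemma spn_minimal:
  assumes "F \<subseteq> spn E" "E \<subseteq> carrier G"
  shows "spn F \<subseteq> spn E"
proof
  fix x assume "x \<in> spn F"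
  then obtain Y where Y: "set_mset Y \<subseteq> F" "x = \<sigma> Y" unfolding spn_def by auto
  have "F \<subseteq> carrier G" using assms spn_closed by blast
  hence "\<sigma> Y \<in> spn E" using Y(1)
  proof (induction Y)
    case (add y Y)
    moreover from this have "set_mset Y \<subseteq> carrier G" "y \<in> carrier G" by auto
    ultimately show ?case using assms by (auto intro!: spn_mult)
  qed (simp add: spn_one)
  thus "x \<in> spn E" using Y by simp
qed

lemma spn_single: "e \<in> carrier G \<Longrightarrow> x \<in> spn {e} \<longleftrightarrow> (\<exists>n::nat. x = e [^] n)"
proof safe
  assume e: "e \<in> carrier G" and "x \<in> spn {e}"
  then obtain Y where Y: "set_mset Y \<subseteq> {e}" "x = \<sigma> Y" unfolding spn_def by auto
  hence "Y = replicate_mset (size Y) e" by (metis set_mset_subset_singletonD)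
  thus "\<exists>n::nat. x = e [^] n" using Y e by (metis seq_sum_replicate)
next
  fix n :: nat assume e: "e \<in> carrier G"
  have "set_mset (replicate_mset n e) \<subseteq> {e}" by auto
  from spnI[OF this] show "e [^] n \<in> spn {e}" using e by simp
qed

text \<open>
  \<open>indep r E\<close> is independence of the \<open>r\<close>-th powers of the elements of \<open>E\<close>. The case \<open>r = 1\<close> is
  independence of \<open>E\<close>; the case \<open>r = 2\<close> ignores involutions.
\<close>

definition indep :: "nat \<Rightarrow> 'g set \<Rightarrow> bool" where
  "indep r E \<longleftrightarrow> E \<subseteq> carrier G \<and>
     (\<forall>Y. set_mset Y \<subseteq> E \<longrightarrow> \<sigma> Y [^] r = \<one> \<longrightarrow> (\<forall>e\<in>E. e [^] (r * count Y e) = \<one>))"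

text \<open>When sums are compared after raising to the power \<open>r\<close>, coefficients matter
  only modulo \<open>ord (e [^] r)\<close>; reduced multisets are the normal forms.\<close>

definition reduced :: "nat \<Rightarrow> 'g multiset \<Rightarrow> bool" where
  "reduced r Y \<longleftrightarrow> (\<forall>e\<in>#Y. count Y e < ord (e [^] r))"

lemma indep_carrier: "indep r E \<Longrightarrow> E \<subseteq> carrier G"
  by (simp add: indep_def)

lemma indepD: "indep r E \<Longrightarrow> set_mset Y \<subseteq> E \<Longrightarrow> \<sigma> Y [^] r = \<one> \<Longrightarrow> e \<in> E \<Longrightarrow> e [^] (r * count Y e) = \<one>"
  by (simp add: indep_def)

lemma reduced_subset: "reduced r Y \<Longrightarrow> T \<subseteq># Y \<Longrightarrow> reduced r T"
  unfolding reduced_def by (meson le_less_trans mset_subset_eqD mset_subset_eq_count)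

text \<open>A block of \<open>ord (e [^] r)\<close> copies of \<open>e\<close> is invisible to the
  \<open>r\<close>-th power of the sum, so such blocks are deleted until none is left.\<close>

lemma reduce_exists:
  assumes "set_mset Y \<subseteq> carrier G"
  shows "\<exists>Z. Z \<subseteq># Y \<and> \<sigma> Z [^] r = \<sigma> Y [^] r \<and> reduced r Z"
  using assms
proof (induction "size Y" arbitrary: Y rule: less_induct)
  case less
  show ?case
  proof (cases "reduced r Y")
    case False
    then obtain e where e: "e \<in># Y" "ord (e [^] r) \<le> count Y e" unfolding reduced_def by force
    define R where "R = replicate_mset (ord (e [^] r)) e"
    have ec: "e \<in> carrier G" using e less.prems by auto
    have R: "R \<subseteq># Y" using e unfolding R_def by (simp add: count_le_replicate_mset_subset_eq)
    have "R \<noteq> {#}" using ord_pos[of "e [^] r"] ec unfolding R_def by (simp add: replicate_mset_eq_empty_iff)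
    hence "size (Y - R) < size Y" using R
      by (metis add_diff_cancel_right' diff_less e(1) empty_iff gr0I nonempty_has_size set_mset_empty size_Diff_submset size_eq_0_iff_empty)
    moreover have c: "set_mset (Y - R) \<subseteq> carrier G" using less.prems by (auto dest: in_diffD)
    ultimately obtain Z where Z: "Z \<subseteq># Y - R" "\<sigma> Z [^] r = \<sigma> (Y - R) [^] r" "reduced r Z"
      using less.hyps by blast
    have "\<sigma> R [^] r = \<one>"
      unfolding R_def using ec by (simp add: nat_pow_pow) (metis mult.commute nat_pow_closed nat_pow_pow pow_ord_eq_1)
    hence "\<sigma> Y [^] r = \<sigma> (Y - R) [^] r"
      using seq_sum_diff[OF less.prems R] c R less.prems
      by (simp add: nat_pow_distrib R_def ec)
    thus ?thesis using Z by (metis diff_subset_eq_self subset_mset.order_trans)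
  qed auto
qed

lemma spn_reduced:
  assumes "E \<subseteq> carrier G" "x \<in> spn E"
  obtains Y where "set_mset Y \<subseteq> E" "\<sigma> Y [^] r = x [^] r" "reduced r Y"
proof -
  obtain Z where Z: "set_mset Z \<subseteq> E" "x = \<sigma> Z" using assms unfolding spn_def by auto
  then obtain Y where "Y \<subseteq># Z" "\<sigma> Y [^] r = \<sigma> Z [^] r" "reduced r Y"
    using reduce_exists[of Z r] assms(1) by auto
  thus ?thesis using that Z by (metis set_mset_mono subset_trans)
qed

lemma indep_eq:
  assumes "indep r E" "set_mset Y \<subseteq> E" "set_mset Z \<subseteq> E" "\<sigma> Y [^] r = \<sigma> Z [^] r" "e \<in> E"
  shows "(e [^] r) [^] count Y e = (e [^] r) [^] count Z e"
proof -
  \<comment> \<open>Multiplication by \<open>n\<close> is negation, so the multiset \<open>W\<close>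
    below stands for the difference of \<open>Y\<close> and \<open>Z\<close>.\<close>
  define n where "n = order G - 1"
  have n: "Suc n = order G" unfolding n_def using order_gt_0_iff_finite fin by simp
  note c = indep_carrier[OF assms(1)]
  have YZ: "set_mset Y \<subseteq> carrier G" "set_mset Z \<subseteq> carrier G" "e \<in> carrier G" using c assms by auto
  define W where "W = Y + repeat_mset n Z"
  have W: "set_mset W \<subseteq> E" unfolding W_def using assms(2,3)
    by (auto simp: repeat_mset.rep_eq simp flip: count_greater_zero_iff)
  have rc: "set_mset (repeat_mset n Z) \<subseteq> carrier G" using YZ(2)
    by (auto simp: repeat_mset.rep_eq simp flip: count_greater_zero_iff)
  have "\<sigma> W [^] r = (\<sigma> Z [^] r) \<otimes> (\<sigma> Z [^] r) [^] n"
    unfolding W_def using YZ rc assms(4) by (simp add: nat_pow_distrib nat_pow_pow mult.commute)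
  also have "\<dots> = (\<sigma> Z [^] r) [^] order G" using YZ by (simp flip: n add: m_comm)
  also have "\<dots> = \<one>" using YZ by (simp add: pow_order_eq_1)
  finally have "e [^] (r * count W e) = \<one>" using indepD[OF assms(1) W _ assms(5)] by simp
  hence "(e [^] r) [^] count Y e \<otimes> (e [^] r) [^] (n * count Z e) = \<one>"
    unfolding W_def using YZ by (simp add: nat_pow_pow nat_pow_mult algebra_simps)
  moreover have "(e [^] r) [^] count Z e \<otimes> (e [^] r) [^] (n * count Z e) = \<one>"
  proof -
    have "count Z e + n * count Z e = order G * count Z e" by (simp flip: n)
    hence "(e [^] r) [^] count Z e \<otimes> (e [^] r) [^] (n * count Z e) = (e [^] r) [^] (order G * count Z e)"
      using YZ by (simp add: nat_pow_mult)
    also have "\<dots> = \<one>" using YZ by (metis nat_pow_closed nat_pow_one nat_pow_pow pow_order_eq_1)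
    finally show ?thesis .
  qed
  ultimately show ?thesis using YZ
    by (metis inv_equality inv_inv nat_pow_closed)
qed

lemma indep_unique:
  assumes "indep r E" "set_mset Y \<subseteq> E" "set_mset Z \<subseteq> E" "\<sigma> Y [^] r = \<sigma> Z [^] r" "reduced r Y" "reduced r Z"
  shows "Y = Z"
proof (rule multiset_eqI)
  fix e
  show "count Y e = count Z e"
  proof (cases "e \<in> E")
    case True
    hence ec: "e [^] r \<in> carrier G" using indep_carrier[OF assms(1)] by auto
    have "count Y e < ord (e [^] r)" "count Z e < ord (e [^] r)"
      using assms(5,6) ord_pos[OF ec] unfolding reduced_def by (metis not_in_iff)+
    thus ?thesis using indep_eq[OF assms(1-4) True] pow_inj[OF ec] by blast
  next
    case False
    then show ?thesis using assms(2,3) by (metis not_in_iff subsetD)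
  qed
qed

lemma indep_zero:
  assumes "indep r E" "set_mset Y \<subseteq> E" "\<sigma> Y [^] r = \<one>" "reduced r Y"
  shows "Y = {#}"
  by (rule indep_unique[OF assms(1,2) _ _ assms(4)]) (use assms(3) in \<open>auto simp: reduced_def\<close>)

lemma indep_double:
  assumes "indep 1 E"
  shows "indep 2 E"
  unfolding indep_def
proof (intro conjI allI impI ballI)
  fix Y e assume Y: "set_mset Y \<subseteq> E" "\<sigma> Y [^] (2::nat) = \<one>" "e \<in> E"
  have "set_mset Y \<subseteq> carrier G" using Y indep_carrier[OF assms] by auto
  hence "\<sigma> (Y + Y) [^] (1::nat) = \<one>" using Y by (simp add: numeral_2_eq_2)
  from indepD[OF assms _ this Y(3)] Y show "e [^] (2 * count Y e) = \<one>" by (simp add: mult_2)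
qed (rule indep_carrier[OF assms])

lemma indep_empty: "indep r {}"
  by (simp add: indep_def)

text \<open>The coefficient of \<open>g\<close> in a relation may be reduced modulo
  \<open>ord (g [^] r)\<close>; the last assumption makes the remainder 0, and what is left is a
  relation over \<open>E\<close>.\<close>

lemma indep_insert:
  assumes "indep r E" "g \<in> carrier G"
    and "\<And>j y. 0 < j \<Longrightarrow> j < ord (g [^] r) \<Longrightarrow> y \<in> spn E \<Longrightarrow> (g [^] r) [^] j \<noteq> y [^] r"
  shows "indep r (insert g E)"
  unfolding indep_def
proof (intro conjI allI impI ballI)
  note c = indep_carrier[OF assms(1)]
  show "insert g E \<subseteq> carrier G" using c assms(2) by auto
  fix Y e assume Y: "set_mset Y \<subseteq> insert g E" "\<sigma> Y [^] r = \<one>" "e \<in> insert g E"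
  define A where "A = filter_mset (\<lambda>x. x \<noteq> g) Y"
  define j where "j = count Y g"
  have YA: "Y = A + replicate_mset j g" unfolding A_def j_def by (rule mset_remove_all)
  have A: "set_mset A \<subseteq> E" "set_mset A \<subseteq> carrier G" using Y(1) c by (auto simp: A_def)
  have gr: "g [^] r \<in> carrier G" using assms(2) by simp
  have eq: "\<sigma> A [^] r \<otimes> (g [^] r) [^] j = \<one>"
    using Y(2) A assms(2) unfolding YA by (simp add: nat_pow_distrib nat_pow_pow mult.commute)
  have "(g [^] r) [^] (j mod ord (g [^] r)) = inv (\<sigma> A) [^] r"
    using eq A gr pow_mod_ord[OF gr, of j] by (metis comm_inv_char nat_pow_closed nat_pow_inv seq_sum_closed)
  moreover have "inv (\<sigma> A) \<in> spn E" using A c by (intro spn_inv spnI)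
  ultimately have "j mod ord (g [^] r) = 0"
    using assms(3)[of "j mod ord (g [^] r)" "inv (\<sigma> A)"] ord_pos[OF gr] by auto
  hence gj: "(g [^] r) [^] j = \<one>" using gr pow_eq_id[OF gr] by auto
  hence "\<sigma> A [^] r = \<one>" using eq A by simp
  hence A1: "e [^] (r * count A e) = \<one>" if "e \<in> E" using indepD[OF assms(1) A(1)] that by blast
  show "e [^] (r * count Y e) = \<one>"
  proof (cases "e = g")
    case True
    then show ?thesis using gj assms(2) by (simp add: j_def nat_pow_pow)
  next
    case False
    then show ?thesis using A1 Y(3) by (auto simp: A_def)
  qed
qed

text \<open>A copy of \<open>inv e\<close> equals \<open>ord e - 1\<close> copies of
  \<open>e\<close>, so a relation over the changed set translates into one over
  \<open>E\<close>.\<close>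

lemma indep_flip:
  assumes "indep r E" "e \<in> E"
  shows "indep r (insert (inv e) (E - {e}))"
  unfolding indep_def
proof (intro conjI allI impI ballI)
  note c = indep_carrier[OF assms(1)]
  have ec: "e \<in> carrier G" using assms(2) c by auto
  show "insert (inv e) (E - {e}) \<subseteq> carrier G" using c ec by auto
  fix Y x assume Y: "set_mset Y \<subseteq> insert (inv e) (E - {e})" "\<sigma> Y [^] r = \<one>" "x \<in> insert (inv e) (E - {e})"
  define A where "A = filter_mset (\<lambda>x. x \<noteq> inv e) Y"
  define j where "j = count Y (inv e)"
  have YA: "Y = A + replicate_mset j (inv e)" unfolding A_def j_def by (rule mset_remove_all)
  have A: "set_mset A \<subseteq> E - {e}" "set_mset A \<subseteq> carrier G" using Y(1) c by (auto simp: A_def)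
  define Z where "Z = A + replicate_mset ((ord e - 1) * j) e"
  have p: "e [^] ((ord e - 1) * j) = inv e [^] j"
    using ec inv_eq_pow[OF ec] by (simp add: nat_pow_pow)
  have "set_mset (replicate_mset ((ord e - 1) * j) e) \<subseteq> carrier G" using ec by auto
  moreover have "set_mset (replicate_mset j (inv e)) \<subseteq> carrier G" using ec by auto
  ultimately have "\<sigma> Z = \<sigma> Y" unfolding Z_def YA using A ec p by simp
  moreover have "set_mset Z \<subseteq> E" unfolding Z_def using A assms(2) by auto
  ultimately have Z: "y [^] (r * count Z y) = \<one>" if "y \<in> E" for y
    using indepD[OF assms(1)] Y(2) that by metis
  show "x [^] (r * count Y x) = \<one>"
  proof (cases "x = inv e")
    case True
    have "e \<notin># A" using A by auto
    hence "count Z e = (ord e - 1) * j" unfolding Z_def by (simp add: not_in_iff)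
    hence "(inv e [^] j) [^] r = \<one>" using Z[OF assms(2)] p ec
      by (metis mult.commute nat_pow_pow)
    then show ?thesis using True ec by (simp add: nat_pow_pow j_def mult.commute)
  next
    case False
    hence "x \<in> E" "x \<noteq> e" using Y(3) by auto
    moreover from this False have "count Z x = count Y x" unfolding Z_def A_def by simp
    ultimately show ?thesis using Z by metis
  qed
qed

section \<open>The index of an element over an independent set and the atoms it yields\<close>

lemma maximal_subset_exists:
  assumes "finite S" "P {}"
  obtains E where "E \<subseteq> S" "P E" "\<And>x. x \<in> S \<Longrightarrow> P (insert x E) \<Longrightarrow> x \<in> E"
proof -
  have "finite {E. E \<subseteq> S \<and> P E}" using assms(1) by simp
  moreover have "{E. E \<subseteq> S \<and> P E} \<noteq> {}" using assms(2) by auto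
  ultimately obtain E where E: "E \<in> {E. E \<subseteq> S \<and> P E}"
    "\<And>F. F \<in> {E. E \<subseteq> S \<and> P E} \<Longrightarrow> E \<subseteq> F \<Longrightarrow> E = F"
    using finite_has_maximal by metis
  show ?thesis
  proof (rule that[of E])
    fix x assume "x \<in> S" "P (insert x E)"
    thus "x \<in> E" using E(2)[of "insert x E"] E(1) by auto
  qed (use E in auto)
qed

lemma min_index:
  assumes "g \<in> carrier G"
  obtains k where "0 < k" "g [^] k \<in> spn E" "\<And>j. 0 < j \<Longrightarrow> j < k \<Longrightarrow> g [^] (j::nat) \<notin> spn E"
proof -
  define P where "P k \<longleftrightarrow> 0 < k \<and> g [^] (k::nat) \<in> spn E" for k
  have "P (ord g)" unfolding P_def using assms ord_pos spn_one by simp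
  hence "P (LEAST k. P k)" by (rule LeastI)
  moreover have "\<not> P j" if "j < (LEAST k. P k)" for j using that by (rule not_less_Least)
  ultimately show ?thesis using that[of "LEAST k. P k"] unfolding P_def by blast
qed

text \<open>Division with remainder. Applied to an exponent that kills the group, it leaves only few
  candidates for the index \<open>k\<close>.\<close>

lemma min_index_dvd:
  assumes "g \<in> carrier G" "E \<subseteq> carrier G" "0 < k" "g [^] k \<in> spn E"
    "\<And>j. 0 < j \<Longrightarrow> j < k \<Longrightarrow> g [^] (j::nat) \<notin> spn E" "g [^] n \<in> spn E"
  shows "k dvd n"
proof (rule ccontr)
  assume "\<not> k dvd n"
  hence m: "0 < n mod k" "n mod k < k" using assms(3) by (auto simp: mod_greater_zero_iff_not_dvd)
  have "g [^] n = (g [^] k) [^] (n div k) \<otimes> g [^] (n mod k)"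
    using assms(1) by (simp add: nat_pow_pow nat_pow_mult)
  hence "g [^] (n mod k) = inv ((g [^] k) [^] (n div k)) \<otimes> g [^] n"
    using assms(1) by (simp add: inv_solve_left)
  also have "\<dots> \<in> spn E"
    by (rule spn_mult[OF assms(2) spn_inv[OF assms(2) spn_pow[OF assms(2,4)]] assms(6)])
  finally show False using assms(5) m by blast
qed

text \<open>By minimality of \<open>k\<close>, a zero-sum subsequence contains none or all of the
  copies of \<open>g\<close>; uniqueness of reduced coefficients then fixes its part over
  \<open>E\<close>.\<close>

lemma atom_index:
  assumes "indep 1 E" "set_mset Y \<subseteq> E" "reduced 1 Y" "g \<in> carrier G" "0 < k" "\<sigma> Y \<otimes> g [^] k = \<one>"
    and min: "\<And>j. 0 < j \<Longrightarrow> j < k \<Longrightarrow> g [^] (j::nat) \<notin> spn E"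
  shows "atom (Y + replicate_mset k g)"
proof (rule atomI)
  note c = indep_carrier[OF assms(1)]
  have Yc: "set_mset Y \<subseteq> carrier G" "set_mset (replicate_mset j g) \<subseteq> carrier G" for j
    using c assms(2,4) by auto
  show "set_mset (Y + replicate_mset k g) \<subseteq> carrier G" using Yc(1) Yc(2)[of k] by simp
  show "\<sigma> (Y + replicate_mset k g) = \<one>" using Yc assms by simp
  show "Y + replicate_mset k g \<noteq> {#}" using assms(5) by (simp add: replicate_mset_eq_empty_iff)
  fix T assume T: "T \<subseteq># Y + replicate_mset k g" "\<sigma> T = \<one>"
  then obtain A B where AB: "T = A + B" "A \<subseteq># Y" "B \<subseteq># replicate_mset k g" by (metis subseteq_union_split)
  then obtain j where j: "j \<le> k" "B = replicate_mset j g" by (metis subseteq_replicateD)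
  have A: "set_mset A \<subseteq> E" "set_mset A \<subseteq> carrier G" using AB(2) assms(2) c by (auto dest: mset_subset_eqD)
  have eq: "\<sigma> A \<otimes> g [^] j = \<one>" using T(2) AB j A Yc(2) assms(4) by simp
  hence "g [^] j = inv (\<sigma> A)" using A assms(4) by (metis comm_inv_char nat_pow_closed seq_sum_closed)
  also have "\<dots> \<in> spn E" using A c by (intro spn_inv spnI)
  finally have "j = 0 \<or> j = k" using min[of j] j(1) by force
  thus "T = {#} \<or> T = Y + replicate_mset k g"
  proof
    assume "j = 0"
    hence "A = {#}" using eq A indep_zero[OF assms(1) A(1) _ reduced_subset[OF assms(3) AB(2)]] by simp
    thus ?thesis using AB j \<open>j = 0\<close> by simp
  next
    assume "j = k"
    hence "\<sigma> A = \<sigma> Y" using eq assms(4,6) A Yc by (metis inv_equality inv_inv nat_pow_closed seq_sum_closed)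
    hence "A = Y" using indep_unique[OF assms(1) A(1) assms(2) _ reduced_subset[OF assms(3) AB(2)] assms(3)] by simp
    thus ?thesis using AB j \<open>j = k\<close> by simp
  qed
qed

text \<open>A zero-sum subsequence could now also contain exactly \<open>k\<close> copies of
  \<open>g\<close>. Its part over \<open>E\<close> would then be all of \<open>Y\<close>, which the
  coordinate \<open>e\<close>, rarer in \<open>Z\<close> than in \<open>Y\<close>, forbids.\<close>

lemma atom_double_index:
  assumes "indep 1 E" "set_mset Y \<subseteq> E" "reduced 1 Y" "g \<in> carrier G" "0 < k" "\<sigma> Y \<otimes> g [^] k = \<one>"
    and min: "\<And>j. 0 < j \<Longrightarrow> j < k \<Longrightarrow> g [^] (j::nat) \<notin> spn E"
    and Z: "set_mset Z \<subseteq> E" "reduced 1 Z" "\<sigma> Z \<otimes> g [^] (2 * k) = \<one>" "count Z e < count Y e"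
  shows "atom (Z + replicate_mset (2 * k) g)"
proof (rule atomI)
  note c = indep_carrier[OF assms(1)]
  have gk: "g [^] k \<in> spn E"
  proof -
    have "g [^] k = inv (\<sigma> Y)" using assms(2,4,6) c by (metis comm_inv_char nat_pow_closed seq_sum_closed subset_trans)
    thus ?thesis using assms(2) c by (auto intro!: spn_inv spnI)
  qed
  have Zc: "set_mset Z \<subseteq> carrier G" "set_mset (replicate_mset j g) \<subseteq> carrier G" for j
    using c Z(1) assms(4) by auto
  have Yc: "set_mset Y \<subseteq> carrier G" using c assms(2) by auto
  show "set_mset (Z + replicate_mset (2 * k) g) \<subseteq> carrier G" using Zc(1) Zc(2)[of "2 * k"] by simp
  show "\<sigma> (Z + replicate_mset (2 * k) g) = \<one>" using Zc Z assms(4) by simp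
  show "Z + replicate_mset (2 * k) g \<noteq> {#}" using assms(5) by (simp add: replicate_mset_eq_empty_iff)
  fix T assume T: "T \<subseteq># Z + replicate_mset (2 * k) g" "\<sigma> T = \<one>"
  then obtain A B where AB: "T = A + B" "A \<subseteq># Z" "B \<subseteq># replicate_mset (2 * k) g" by (metis subseteq_union_split)
  then obtain j where j: "j \<le> 2 * k" "B = replicate_mset j g" by (metis subseteq_replicateD)
  have A: "set_mset A \<subseteq> E" "set_mset A \<subseteq> carrier G" using AB(2) Z(1) c by (auto dest: mset_subset_eqD)
  have eq: "\<sigma> A \<otimes> g [^] j = \<one>" using T(2) AB j A Zc(2) assms(4) by simp
  hence "g [^] j = inv (\<sigma> A)" using A assms(4) by (metis comm_inv_char nat_pow_closed seq_sum_closed)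
  also have "\<dots> \<in> spn E" using A c by (intro spn_inv spnI)
  finally have "k dvd j" using min_index_dvd[OF assms(4) c assms(5) gk min] by blast
  then obtain q where q: "j = k * q" by blast
  hence "q \<le> 2" using j(1) assms(5) by simp
  hence "j = 0 \<or> j = k \<or> j = 2 * k" using q by (auto simp: le_Suc_eq numeral_2_eq_2)
  thus "T = {#} \<or> T = Z + replicate_mset (2 * k) g"
  proof (elim disjE)
    assume "j = 0"
    hence "A = {#}" using eq A indep_zero[OF assms(1) A(1) _ reduced_subset[OF Z(2) AB(2)]] by simp
    thus ?thesis using AB j \<open>j = 0\<close> by simp
  next
    assume "j = k"
    hence "\<sigma> A = \<sigma> Y" using eq assms(4,6) A Yc by (metis inv_equality inv_inv nat_pow_closed seq_sum_closed)
    hence "A = Y" using indep_unique[OF assms(1) A(1) assms(2) _ reduced_subset[OF Z(2) AB(2)] assms(3)] by simp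
    thus ?thesis using mset_subset_eq_count[OF AB(2), of e] Z(4) by simp
  next
    assume "j = 2 * k"
    hence "\<sigma> A = \<sigma> Z" using eq assms(4) Z(3) A Zc by (metis inv_equality inv_inv nat_pow_closed seq_sum_closed)
    hence "A = Z" using indep_unique[OF assms(1) A(1) Z(1) _ reduced_subset[OF Z(2) AB(2)] Z(2)] by simp
    thus ?thesis using AB j \<open>j = 2 * k\<close> by simp
  qed
qed

lemma image_inv_inv:
  assumes "set_mset S \<subseteq> carrier G"
  shows "image_mset (m_inv G) (image_mset (m_inv G) S) = S"
  using assms by (induction S) auto

lemma atom_inv_image:
  assumes "atom S"
  shows "atom (image_mset (m_inv G) S)"
proof (rule atomI)
  note S = atomD[OF assms]
  show "set_mset (image_mset (m_inv G) S) \<subseteq> carrier G" using S(1) by auto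
  show "\<sigma> (image_mset (m_inv G) S) = \<one>" using seq_sum_inv_image[OF S(1)] S(2) by simp
  show "image_mset (m_inv G) S \<noteq> {#}" using S(3) by simp
  fix T assume T: "T \<subseteq># image_mset (m_inv G) S" "\<sigma> T = \<one>"
  have Tc: "set_mset T \<subseteq> carrier G" using set_mset_mono[OF T(1)] S(1) by auto
  have "image_mset (m_inv G) T \<subseteq># S"
    using image_mset_subseteq_mono[OF T(1), of "m_inv G"] image_inv_inv[OF S(1)] by simp
  moreover have "\<sigma> (image_mset (m_inv G) T) = \<one>" using seq_sum_inv_image[OF Tc] T(2) by simp
  ultimately have "image_mset (m_inv G) T = {#} \<or> image_mset (m_inv G) T = S" by (rule S(4))
  thus "T = {#} \<or> T = image_mset (m_inv G) S" using image_inv_inv[OF Tc] by auto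
qed

lemma sum_mset_pairs:
  "\<Sum>\<^sub># (image_mset (\<lambda>x. {#x, inv x#}) S) = S + image_mset (m_inv G) S"
  by (induction S) auto

end

section \<open>Consequences of a congruence between lengths\<close>

lemma subseteq_singletonD:
  assumes "T \<subseteq># {#x#}"
  shows "T = {#} \<or> T = {#x#}"
proof -
  have "T \<subseteq># replicate_mset 1 x" using assms by simp
  then obtain j where "j \<le> 1" "T = replicate_mset j x" by (rule subseteq_replicateD)
  thus ?thesis by (cases j) auto
qed

text \<open>\<open>Supp\<close> stands for the support of a long atom together with its negatives:
  pairing an atom with its negative and changing signs lead out of the support itself, but not out
  of this set.\<close>

locale length_congruence = finite_comm_group G for G :: "('g, 'm) monoid_scheme" (structure) +
  fixes Supp :: "'g set" and d :: int
  assumes Supp_carrier: "Supp \<subseteq> carrier G" and Supp_one: "\<one> \<notin> Supp"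
    and Supp_inv: "x \<in> Supp \<Longrightarrow> inv x \<in> Supp"
    and lengths_cong: "set_mset C \<subseteq> Supp \<Longrightarrow> k \<in> lengths C \<Longrightarrow> l \<in> lengths C \<Longrightarrow> d dvd int k - int l"
begin

section \<open>Congruences from comparing two factorizations\<close>

lemma cong_factorizations:
  assumes "\<And>U. U \<in># F \<Longrightarrow> atom U" "\<And>U. U \<in># F' \<Longrightarrow> atom U" "\<Sum>\<^sub># F = \<Sum>\<^sub># F'" "set_mset (\<Sum>\<^sub># F) \<subseteq> Supp"
  shows "d dvd int (size F) - int (size F')"
  using assms by (intro lengths_cong[of "\<Sum>\<^sub># F"] lengthsI[of F] lengthsI[of F']) auto

text \<open>\<open>W\<close> times its negative has two factors, and the same sequence splits into
  \<open>size W\<close> pairs.\<close>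

lemma cong_size:
  assumes "atom W" "set_mset W \<subseteq> Supp"
  shows "d dvd int (size W) - 2"
proof -
  have "d dvd int (size (image_mset (\<lambda>x. {#x, inv x#}) W)) - int (size {#W, image_mset (m_inv G) W#})"
  proof (rule cong_factorizations)
    fix U assume "U \<in># image_mset (\<lambda>x. {#x, inv x#}) W"
    thus "atom U" using assms(2) Supp_carrier Supp_one by (auto intro!: atom_pair)
  next
    fix U assume "U \<in># {#W, image_mset (m_inv G) W#}"
    thus "atom U" using assms(1) atom_inv_image by auto
  next
    show "set_mset (\<Sum>\<^sub># (image_mset (\<lambda>x. {#x, inv x#}) W)) \<subseteq> Supp"
      unfolding sum_mset_pairs using assms(2) Supp_inv by auto
  qed (simp add: sum_mset_pairs)
  thus ?thesis by simp
qed

lemma cong_ord: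
  assumes "x \<in> Supp"
  shows "d dvd int (ord x) - 2"
  using cong_size[OF atom_ord, of x] assms Supp_carrier by auto

text \<open>The flipped atom times \<open>c\<close> pairs equals the original atom times
  \<open>ord x\<close> copies of \<open>inv x\<close>: lengths \<open>c + 1\<close> and 2.\<close>

lemma cong_flip:
  assumes "atom (A + replicate_mset c x)" "atom (A + replicate_mset (ord x - c) (inv x))"
    and "c \<le> ord x" "x \<in> Supp" "set_mset A \<subseteq> Supp"
  shows "d dvd int c - 1"
proof -
  have xc: "x \<in> carrier G" "x \<noteq> \<one>" using assms(4) Supp_carrier Supp_one by auto
  have ord_inv_x: "ord (inv x) = ord x" using xc by simp
  let ?F = "add_mset (A + replicate_mset (ord x - c) (inv x)) (replicate_mset c {#x, inv x#})"
  let ?F' = "{#A + replicate_mset c x, replicate_mset (ord x) (inv x)#}"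
  have 1: "\<Sum>\<^sub># (replicate_mset c {#x, inv x#}) = replicate_mset c x + replicate_mset c (inv x)"
    by (induction c) auto
  have "replicate_mset (ord x) (inv x) = replicate_mset (ord x - c) (inv x) + replicate_mset c (inv x)"
    using assms(3) by (auto simp: multiset_eq_iff)
  with 1 have eq: "\<Sum>\<^sub># ?F = \<Sum>\<^sub># ?F'" by simp
  have "d dvd int (size ?F) - int (size ?F')"
  proof (rule cong_factorizations)
    fix U assume "U \<in># ?F"
    thus "atom U" using assms(2) atom_pair[OF xc] by (auto split: if_splits)
  next
    fix U assume "U \<in># ?F'"
    thus "atom U" using assms(1) atom_ord[of "inv x"] xc ord_inv_x by auto
  next
    show "set_mset (\<Sum>\<^sub># ?F) \<subseteq> Supp" unfolding eq using assms(4,5) Supp_inv by auto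
  qed (rule eq)
  thus ?thesis by simp
qed

lemma indep_no_inverse:
  assumes "indep 1 E" "E \<subseteq> Supp" "e \<in> E" "inv e \<in> E"
  shows "inv e = e"
proof (rule ccontr)
  assume ne: "inv e \<noteq> e"
  have e: "e \<in> carrier G" "e \<noteq> \<one>" using assms Supp_carrier Supp_one by auto
  have "e [^] (1 * count {#e, inv e#} e) = \<one>"
    by (rule indepD[OF assms(1) _ _ assms(3)]) (use assms e in auto)
  thus False using e ne by auto
qed

text \<open>Changing the sign of one basis element keeps the sum and replaces its coefficient by the
  complement to \<open>ord e\<close>. The span does not grow, so an index that was minimal stays
  minimal and the atom constructions can be repeated over \<open>E'\<close>.\<close>

lemma flip_obtains:
  assumes "indep 1 E" "E \<subseteq> Supp" "set_mset Y \<subseteq> E" "reduced 1 Y" "e \<in># Y"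
  defines "E' \<equiv> insert (inv e) (E - {e})"
    and "Y' \<equiv> filter_mset (\<lambda>x. x \<noteq> e) Y + replicate_mset (ord e - count Y e) (inv e)"
  shows "indep 1 E'" "E' \<subseteq> Supp" "set_mset Y' \<subseteq> E'" "reduced 1 Y'" "\<sigma> Y' = \<sigma> Y" "spn E' \<subseteq> spn E"
    "count Y' (inv e) = ord e - count Y e"
    "\<And>x. x \<in># Y \<Longrightarrow> x \<noteq> e \<Longrightarrow> count Y' x = count Y x"
proof -
  define A where "A = filter_mset (\<lambda>x. x \<noteq> e) Y"
  have Y: "Y = A + replicate_mset (count Y e) e" unfolding A_def by (rule mset_remove_all)
  have eE: "e \<in> E" using assms(3,5) by auto
  have e: "e \<in> carrier G" "e \<in> Supp" "e \<noteq> \<one>" using eE assms(2) Supp_carrier Supp_one by auto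
  have A: "set_mset A \<subseteq> E - {e}" "set_mset A \<subseteq> carrier G" using assms(2,3) Supp_carrier by (auto simp: A_def)
  have invA: "inv e \<notin># A" using indep_no_inverse[OF assms(1,2) eE] A(1) by force
  have c: "count Y e < ord e" "0 < count Y e" using assms(4,5) e unfolding reduced_def by auto
  show "indep 1 E'" unfolding E'_def by (rule indep_flip[OF assms(1) eE])
  show "E' \<subseteq> Supp" unfolding E'_def using assms(2) Supp_inv eE by auto
  show "set_mset Y' \<subseteq> E'" unfolding Y'_def E'_def using A(1) by (auto simp: A_def)
  show cinv: "count Y' (inv e) = ord e - count Y e"
    using invA unfolding Y'_def A_def[symmetric] by (simp add: not_in_iff)
  show "reduced 1 Y'" unfolding reduced_def
  proof
    fix x assume x: "x \<in># Y'"
    show "count Y' x < ord (x [^] (1::nat))"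
    proof (cases "x = inv e")
      case True
      then show ?thesis using cinv c e by simp
    next
      case False
      hence "x \<in># Y" "count Y' x = count Y x" using x unfolding Y'_def by (auto split: if_splits)
      then show ?thesis using assms(4) unfolding reduced_def by simp
    qed
  qed
  have r: "set_mset (replicate_mset j e) \<subseteq> carrier G" "set_mset (replicate_mset j (inv e)) \<subseteq> carrier G" for j
    using e by auto
  have "\<sigma> Y' = \<sigma> A \<otimes> inv e [^] (ord e - count Y e)"
    unfolding Y'_def A_def[symmetric] using A(2) r e by simp
  also have "\<dots> = \<sigma> Y" using inv_pow_diff[OF e(1), of "count Y e"] c A(2) r e by (subst Y) simp
  finally show "\<sigma> Y' = \<sigma> Y" .
  have Ec: "E \<subseteq> carrier G" using assms(2) Supp_carrier by auto
  show "spn E' \<subseteq> spn E"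
    by (rule spn_minimal[OF _ Ec]) (use Ec eE in \<open>auto simp: E'_def intro!: spn_inv intro: spn_incl\<close>)
  fix x assume "x \<in># Y" "x \<noteq> e"
  moreover from this have "x \<noteq> inv e" using invA unfolding A_def by auto
  ultimately show "count Y' x = count Y x" unfolding Y'_def by simp
qed

text \<open>The atom belonging to the index of \<open>g\<close> exists before and after the sign
  change at \<open>e\<close>, so \<open>cong_flip\<close> compares the two.\<close>

lemma cong_coefficient:
  assumes "indep 1 E" "E \<subseteq> Supp" "set_mset Y \<subseteq> E" "reduced 1 Y" "g \<in> Supp" "0 < k" "\<sigma> Y \<otimes> g [^] k = \<one>"
    and min: "\<And>j. 0 < j \<Longrightarrow> j < k \<Longrightarrow> g [^] (j::nat) \<notin> spn E" and e: "e \<in># Y"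
  shows "d dvd int (count Y e) - 1"
proof -
  note f = flip_obtains[OF assms(1-4) e]
  have g: "g \<in> carrier G" using assms(5) Supp_carrier by auto
  have eX: "e \<in> Supp" "e \<in> carrier G" using e assms(2,3) Supp_carrier by auto
  define A where "A = filter_mset (\<lambda>x. x \<noteq> e) Y"
  have Y: "Y = A + replicate_mset (count Y e) e" unfolding A_def by (rule mset_remove_all)
  have c: "count Y e \<le> ord e" using assms(4) e eX unfolding reduced_def by fastforce
  have "atom (Y + replicate_mset k g)" by (rule atom_index[OF assms(1,3,4) g assms(6,7) min])
  hence 1: "atom ((A + replicate_mset k g) + replicate_mset (count Y e) e)" using Y by (metis add.assoc add.commute)
  have "atom ((A + replicate_mset (ord e - count Y e) (inv e)) + replicate_mset k g)"
    unfolding A_def by (rule atom_index[OF f(1,3,4) g assms(6)]) (use f(5,6) assms(7) min in auto)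
  hence 2: "atom ((A + replicate_mset k g) + replicate_mset (ord e - count Y e) (inv e))"
    by (metis add.assoc add.commute)
  show ?thesis by (rule cong_flip[OF 1 2 c eX(1)]) (use assms(2,3,5) in \<open>auto simp: A_def\<close>)
qed

lemma double_reduced:
  assumes "indep 1 E" "set_mset Y \<subseteq> E"
  obtains Z where "set_mset Z \<subseteq> E" "reduced 1 Z" "\<sigma> Z = \<sigma> Y \<otimes> \<sigma> Y"
    "\<And>e. e \<in> E \<Longrightarrow> count Z e = (2 * count Y e) mod ord e"
proof -
  have Yc: "set_mset Y \<subseteq> carrier G" using assms indep_carrier by blast
  then obtain Z where Z: "Z \<subseteq># Y + Y" "\<sigma> Z [^] (1::nat) = \<sigma> (Y + Y) [^] (1::nat)" "reduced 1 Z"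
    using reduce_exists[of "Y + Y" 1] by auto
  have ZE: "set_mset Z \<subseteq> E" using set_mset_mono[OF Z(1)] assms(2) by auto
  show ?thesis
  proof (rule that[OF ZE Z(3)])
    have "set_mset Z \<subseteq> carrier G" using ZE assms(1) indep_carrier by blast
    thus "\<sigma> Z = \<sigma> Y \<otimes> \<sigma> Y" using Z(2) Yc by simp
    fix e assume e: "e \<in> E"
    hence ec: "e \<in> carrier G" using assms(1) indep_carrier by blast
    have "(e [^] (1::nat)) [^] count Z e = (e [^] (1::nat)) [^] count (Y + Y) e"
      by (rule indep_eq[OF assms(1) ZE _ Z(2) e]) (use assms(2) in auto)
    hence "e [^] count Z e = e [^] ((2 * count Y e) mod ord e)"
      using ec pow_mod_ord[OF ec] by (simp add: mult_2)
    moreover have "count Z e < ord e"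
      using Z(3) ord_pos[OF ec] ec unfolding reduced_def by (cases "e \<in># Z") (auto simp: not_in_iff)
    ultimately show "count Z e = (2 * count Y e) mod ord e"
      using pow_inj[OF ec] ord_pos[OF ec] by simp
  qed
qed

text \<open>
  Double the relation between \<open>g\<close> and \<open>E\<close>. As the coefficient of \<open>e'\<close> wraps around, the doubled
  relation is again an atom, whichever sign \<open>e\<close> carries; its coefficient at \<open>e\<close> is therefore \<open>1\<close>
  modulo \<open>d\<close>, just like the undoubled one.
\<close>

lemma two_coefficients_aux:
  assumes "indep 1 E" "E \<subseteq> Supp" "set_mset Y \<subseteq> E" "reduced 1 Y" "g \<in> Supp" "0 < k" "\<sigma> Y \<otimes> g [^] k = \<one>"
    and min: "\<And>j. 0 < j \<Longrightarrow> j < k \<Longrightarrow> g [^] (j::nat) \<notin> spn E"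
    and e: "e \<in># Y" "e' \<in># Y" "e \<noteq> e'" "2 * count Y e \<noteq> ord e" "ord e' \<le> 2 * count Y e'"
  shows "d dvd 1"
proof -
  note f = flip_obtains[OF assms(1-4) e(1)]
  have g: "g \<in> carrier G" using assms(5) Supp_carrier by auto
  have eX: "e \<in> Supp" "e \<in> carrier G" "e \<in> E" "e' \<in> E" "e' \<in> carrier G" using e assms(2,3) Supp_carrier by auto
  have c: "0 < count Y e" "count Y e < ord e" "count Y e' < ord e'" using assms(4) e(1,2) eX unfolding reduced_def by fastforce+
  obtain Z where Z: "set_mset Z \<subseteq> E" "reduced 1 Z" "\<sigma> Z = \<sigma> Y \<otimes> \<sigma> Y"
    "\<And>e. e \<in> E \<Longrightarrow> count Z e = (2 * count Y e) mod ord e"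
    using double_reduced[OF assms(1,3)] by blast
  have Yc: "set_mset Y \<subseteq> carrier G" using assms(2,3) Supp_carrier by auto
  have sZ: "\<sigma> Z \<otimes> g [^] (2 * k) = \<one>"
  proof -
    have "\<sigma> Z \<otimes> g [^] (2 * k) = (\<sigma> Y \<otimes> g [^] k) \<otimes> (\<sigma> Y \<otimes> g [^] k)"
      using Z(3) Yc g by (simp add: mult_2 nat_pow_mult[symmetric] m_ac)
    thus ?thesis using assms(7) by simp
  qed
  \<comment> \<open>After wrapping around, the doubled coefficient
    \<open>2 * count Y e' - ord e'\<close> lies below the old one. This is the coordinate that keeps
    the doubled relation an atom.\<close>
  have Ze': "count Z e' < count Y e'"
  proof -
    have "2 * count Y e' - ord e' < ord e'" "2 * count Y e' - ord e' < count Y e'"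
      using e(5) c(3) by linarith+
    thus ?thesis using Z(4)[OF eX(4)] e(5) by (simp add: mod_if)
  qed
  have Ze: "count Z e = (if 2 * count Y e < ord e then 2 * count Y e else 2 * count Y e - ord e)" "0 < count Z e"
    using Z(4)[OF eX(3)] e(4) c(1,2) by (auto simp: mod_if)
  have eZ: "e \<in># Z" using Ze(2) by simp
  note h = flip_obtains[OF assms(1,2) Z(1,2) eZ]
  define A where "A = filter_mset (\<lambda>x. x \<noteq> e) Z"
  have ZA: "Z = A + replicate_mset (count Z e) e" unfolding A_def by (rule mset_remove_all)
  have "atom (Z + replicate_mset (2 * k) g)"
    by (rule atom_double_index[OF assms(1,3,4) g assms(6,7) min Z(1,2) sZ Ze'])
  hence 1: "atom ((A + replicate_mset (2 * k) g) + replicate_mset (count Z e) e)" using ZA by (metis add.assoc add.commute)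
  let ?Y = "filter_mset (\<lambda>x. x \<noteq> e) Y + replicate_mset (ord e - count Y e) (inv e)"
  let ?Z = "A + replicate_mset (ord e - count Z e) (inv e)"
  \<comment> \<open>The sign change happens at \<open>e\<close>, so the coordinate \<open>e'\<close>
    is untouched and serves as witness again.\<close>
  have "count ?Z e' < count ?Y e'"
  proof -
    have "count ?Y e' = count Y e'" using f(8)[OF e(2)] e(3) by auto
    moreover have "e' \<noteq> inv e" using indep_no_inverse[OF assms(1,2) eX(3)] eX(4) e(3) by metis
    hence "count ?Z e' = count Z e'" using e(3) unfolding A_def by simp
    ultimately show ?thesis using Ze' by simp
  qed
  hence "atom (?Z + replicate_mset (2 * k) g)"
    unfolding A_def by (intro atom_double_index[OF f(1,3,4) g assms(6) _ _ h(3,4)])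
      (use f(5,6) h(5) assms(7) min sZ in auto)
  hence 2: "atom ((A + replicate_mset (2 * k) g) + replicate_mset (ord e - count Z e) (inv e))"
    by (metis add.assoc add.commute)
  have "count Z e < ord e" using Z(4)[OF eX(3)] ord_pos[OF eX(2)] by simp
  hence "d dvd int (count Z e) - 1"
    by (intro cong_flip[OF 1 2 _ eX(1)]) (use Z(1) assms(2,5) in \<open>auto simp: A_def\<close>)
  moreover have "d dvd int (count Y e) - 1" by (rule cong_coefficient[OF assms(1-7) min e(1)])
  moreover have "d dvd int (ord e) - 2" by (rule cong_ord[OF eX(1)])
  \<comment> \<open>As \<open>count Y e\<close> is 1 and \<open>ord e\<close> is 2 modulo
    \<open>d\<close>, the doubled coefficient is 2 or 0, depending on whether it wraps around. It is
    also 1, so \<open>d\<close> divides 1.\<close>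
  ultimately show "d dvd 1"
  proof (cases "2 * count Y e < ord e")
    case True
    have "1 = (int (count Z e) - 1) - 2 * (int (count Y e) - 1)" using Ze(1) True by simp
    then show ?thesis using \<open>d dvd int (count Z e) - 1\<close> \<open>d dvd int (count Y e) - 1\<close>
      by (metis dvd_diff dvd_mult)
  next
    case False
    have "1 = 2 * (int (count Y e) - 1) - (int (ord e) - 2) - (int (count Z e) - 1)"
      using Ze(1) False by simp
    then show ?thesis using \<open>d dvd int (count Z e) - 1\<close> \<open>d dvd int (count Y e) - 1\<close> \<open>d dvd int (ord e) - 2\<close>
      by (metis dvd_diff dvd_mult)
  qed
qed

text \<open>If the coefficient of \<open>e'\<close> does not wrap around on doubling, it does so
  after a sign change at \<open>e'\<close>. The assumption on \<open>e\<close> keeps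
  \<open>e\<close> present in the doubled relation.\<close>

lemma two_coefficients:
  assumes "indep 1 E" "E \<subseteq> Supp" "set_mset Y \<subseteq> E" "reduced 1 Y" "g \<in> Supp" "0 < k" "\<sigma> Y \<otimes> g [^] k = \<one>"
    and min: "\<And>j. 0 < j \<Longrightarrow> j < k \<Longrightarrow> g [^] (j::nat) \<notin> spn E"
    and e: "e \<in># Y" "e' \<in># Y" "e \<noteq> e'" "2 * count Y e \<noteq> ord e"
  shows "d dvd 1"
proof (cases "ord e' \<le> 2 * count Y e'")
  case True
  show ?thesis by (rule two_coefficients_aux[OF assms(1-7) min e True])
next
  case False
  note f = flip_obtains[OF assms(1-4) e(2)]
  have e': "e' \<in> carrier G" "e' \<in> E" "e \<in> E" using e(1,2) assms(2,3) Supp_carrier by auto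
  let ?Y = "filter_mset (\<lambda>x. x \<noteq> e') Y + replicate_mset (ord e' - count Y e') (inv e')"
  have ce: "count ?Y e = count Y e" by (rule f(8)[OF e(1,3)])
  have "inv e' \<in># ?Y" using f(7) False by (simp add: count_greater_zero_iff[symmetric] del: count_greater_zero_iff)
  moreover have "e \<in># ?Y" using ce e(1) by (metis count_greater_zero_iff)
  moreover have "e \<noteq> inv e'" using indep_no_inverse[OF assms(1,2) e'(2)] e'(3) e(3) by metis
  moreover have "ord (inv e') \<le> 2 * count ?Y (inv e')" using f(7) False e' by simp
  ultimately show ?thesis
    by (intro two_coefficients_aux[OF f(1-4) assms(5,6), of e "inv e'"]) (use f(5,6) assms(7) min ce e(4) in auto)
qed

text \<open>Let \<open>Y\<close> be the reduced expression of the inverse of \<open>g [^] k\<close>.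
  All its coefficients are 1 modulo \<open>d\<close>, so \<open>size Y\<close> is congruent to the
  number of elements involved, and the atom formed with \<open>k\<close> copies of \<open>g\<close>
  has length congruent to 2; this determines \<open>k\<close> modulo \<open>d\<close>. If
  \<open>Y\<close> is non-empty and \<open>d\<close> does not divide 1, then \<open>Y\<close>
  involves a single element or every coefficient is half the order, and in the latter case
  \<open>g [^] k\<close> is an involution.\<close>

lemma index_cases:
  assumes "indep 1 E" "E \<subseteq> Supp" "g \<in> Supp" "0 < k" "g [^] k \<in> spn E"
    and min: "\<And>j. 0 < j \<Longrightarrow> j < k \<Longrightarrow> g [^] (j::nat) \<notin> spn E"
  shows "d dvd 1 \<or> (g [^] k = \<one> \<and> d dvd int k - 2) \<or>
    (g [^] k \<noteq> \<one> \<and> d dvd int k - 1 \<and> ((\<exists>e\<in>E. g [^] k \<in> spn {e}) \<or> g [^] (2 * k) = \<one>))"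
proof -
  have g: "g \<in> carrier G" using assms(3) Supp_carrier by auto
  note Ec = indep_carrier[OF assms(1)]
  obtain Y where Y: "set_mset Y \<subseteq> E" "\<sigma> Y [^] (1::nat) = (inv (g [^] k)) [^] (1::nat)" "reduced 1 Y"
    using spn_reduced[OF Ec spn_inv[OF Ec assms(5)]] by blast
  have Yc: "set_mset Y \<subseteq> carrier G" using Y(1) Ec by auto
  have sY: "\<sigma> Y = inv (g [^] k)" using Y(2) Yc g by simp
  have zero: "\<sigma> Y \<otimes> g [^] k = \<one>" using sY g by simp
  have coeff: "d dvd int (count Y e) - 1" if "e \<in># Y" for e
    by (rule cong_coefficient[OF assms(1,2) Y(1,3) assms(3,4) zero min that])
  have sizeY: "d dvd int (size Y) - int (card (set_mset Y))"
  proof -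
    have "int (size Y) - int (card (set_mset Y)) = (\<Sum>e\<in>set_mset Y. int (count Y e) - 1)"
      by (simp add: size_multiset_overloaded_eq sum_subtractf)
    thus ?thesis using coeff by (auto intro: dvd_sum)
  qed
  have W: "atom (Y + replicate_mset k g)" by (rule atom_index[OF assms(1) Y(1,3) g assms(4) zero min])
  have sizeW: "d dvd int (size Y) + int k - 2"
  proof -
    have "set_mset (Y + replicate_mset k g) \<subseteq> Supp" using Y(1) assms(2,3) by auto
    from cong_size[OF W this] show ?thesis by simp
  qed
  show ?thesis
  proof (cases "Y = {#}")
    case True
    hence "g [^] k = \<one>" using sY g by (metis inv_eq_1_iff nat_pow_closed seq_sum_empty)
    thus ?thesis using sizeW True by simp
  next
    case False
    have gk: "g [^] k \<noteq> \<one>" using indep_zero[OF assms(1) Y(1) _ Y(3)] False sY by auto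
    have key: "d dvd int k - 1" if "d dvd int (card (set_mset Y)) - 1"
    proof -
      have "int k - 1 = (int (size Y) + int k - 2) - (int (size Y) - int (card (set_mset Y)))
          - (int (card (set_mset Y)) - 1)" by simp
      thus ?thesis using sizeW sizeY that by (metis dvd_diff)
    qed
    show ?thesis
    proof (cases "\<forall>e\<in>#Y. 2 * count Y e = ord e")
      case True
      have YY: "Y + Y = (\<Sum>e\<in>set_mset Y. replicate_mset (ord e) e)"
      proof (rule multiset_eqI)
        fix x
        have "count (\<Sum>e\<in>set_mset Y. replicate_mset (ord e) e) x = (if x \<in># Y then ord x else 0)"
          by (simp add: count_sum if_distrib eq_commute cong: if_cong)
        thus "count (Y + Y) x = count (\<Sum>e\<in>set_mset Y. replicate_mset (ord e) e) x"
          using True by (auto simp: not_in_iff)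
      qed
      have g2k: "g [^] (2 * k) = \<one>"
      proof -
        have "\<sigma> (\<Sum>e\<in>A. replicate_mset (ord e) e) = \<one>" if "finite A" "A \<subseteq> carrier G" for A
          using that
        proof (induction A rule: finite_induct)
          case (insert a A)
          have "set_mset (\<Sum>e\<in>A. replicate_mset (ord e) e) \<subseteq> carrier G"
            using insert by (auto simp: set_mset_sum)
          moreover have "set_mset (replicate_mset (ord a) a) \<subseteq> carrier G" using insert by auto
          ultimately show ?case using insert by simp
        qed simp
        from this[of "set_mset Y"] have "\<sigma> (Y + Y) = \<one>" unfolding YY using Yc by simp
        hence "inv (g [^] k) \<otimes> inv (g [^] k) = \<one>" using Yc sY by simp
        hence "inv (g [^] (2 * k)) = \<one>" using g by (simp add: mult_2 inv_mult flip: nat_pow_mult)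
        thus ?thesis using g by (simp add: inv_eq_1_iff)
      qed
      \<comment> \<open>The order divides \<open>2 * k\<close>, is a multiple of \<open>k\<close>,
        and differs from \<open>k\<close>.\<close>
      have ordg: "ord g = 2 * k"
      proof -
        have "ord g dvd 2 * k" using g2k g by (simp add: pow_eq_id)
        moreover have "k dvd ord g"
          by (rule min_index_dvd[OF g Ec assms(4,5) min]) (use g spn_one in auto)
        ultimately obtain q where q: "ord g = k * q" "k * q dvd k * 2" by (metis dvdE mult.commute)
        hence "q dvd 2" using assms(4) by simp
        moreover have "q \<noteq> 1" using q(1) gk g by (metis mult_1_right pow_ord_eq_1)
        ultimately have "q = 2" using prime_nat_iff two_is_prime_nat by blast
        thus ?thesis using q by simp
      qed
      let ?F = "{#Y + replicate_mset k g, Y + replicate_mset k g#}"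
      let ?F' = "add_mset (replicate_mset (2 * k) g) (image_mset (\<lambda>e. replicate_mset (ord e) e) (mset_set (set_mset Y)))"
      \<comment> \<open>Two atoms against one for \<open>g\<close> and one for each element of
        \<open>Y\<close>: the number of elements is 1 modulo \<open>d\<close>.\<close>
      have "d dvd int (size ?F') - int (size ?F)"
      proof (rule cong_factorizations)
        fix U assume "U \<in># ?F"
        thus "atom U" using W by auto
      next
        fix U assume "U \<in># ?F'"
        thus "atom U" using atom_ord[OF g] ordg Yc by (auto intro!: atom_ord)
      next
        show eq: "\<Sum>\<^sub># ?F' = \<Sum>\<^sub># ?F"
          using YY by (simp add: sum_unfold_sum_mset) (auto simp: multiset_eq_iff)
        show "set_mset (\<Sum>\<^sub># ?F') \<subseteq> Supp" unfolding eq using Y(1) assms(2,3) by auto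
      qed
      hence "d dvd int (card (set_mset Y)) - 1" by simp
      thus ?thesis using key gk g2k by blast
    next
      case F: False
      then obtain e where e: "e \<in># Y" "2 * count Y e \<noteq> ord e" by blast
      show ?thesis
      proof (cases "set_mset Y = {e}")
        case True
        hence "g [^] k \<in> spn {e}"
        proof -
          have ec: "{e} \<subseteq> carrier G" using e(1) Yc by auto
          have "g [^] k = inv (\<sigma> Y)" using sY g by simp
          also have "\<dots> \<in> spn {e}" using True by (intro spn_inv[OF ec] spnI) auto
          finally show ?thesis .
        qed
        moreover have "d dvd int (card (set_mset Y)) - 1" using True by simp
        ultimately show ?thesis using key gk e(1) Y(1) by blast
      next
        case False
        then obtain e' where "e' \<in># Y" "e \<noteq> e'" using e(1) by blast
        thus ?thesis using two_coefficients[OF assms(1,2) Y(1,3) assms(3,4) zero min e(1)] e(2) by blast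
      qed
    qed
  qed
qed

end

section \<open>The structure of atoms of maximal length\<close>

context finite_comm_group
begin

text \<open>If the support generates a proper subgroup, a term \<open>u\<close> can be split into
  two elements outside it. A subsum using only one of them stays outside the subgroup, so the
  sequence remains an atom and has become longer.\<close>

lemma long_atom_generates:
  assumes "atom U" "size U = davenport G"
  shows "spn (set_mset U) = carrier G"
proof (rule ccontr)
  note U = atomD[OF assms(1)]
  assume "spn (set_mset U) \<noteq> carrier G"
  then obtain g where g: "g \<in> carrier G" "g \<notin> spn (set_mset U)" using spn_closed[OF U(1)] by blast
  let ?K = "spn (set_mset U)"
  obtain u V where UV: "U = add_mset u V" using U(3) by (metis multiset_cases)
  have uc: "u \<in> carrier G" "set_mset V \<subseteq> carrier G" using U(1) UV by auto
  have uK: "u \<in> ?K" using UV uc by (auto intro!: spn_incl)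
  \<comment> \<open>The second half of the splitting of \<open>u\<close>; it is outside the subgroup
    because \<open>u\<close> is inside and \<open>g\<close> is not.\<close>
  define h where "h = u \<otimes> inv g"
  have hc: "h \<in> carrier G" unfolding h_def using uc g by simp
  have gh: "g \<otimes> h = u" unfolding h_def using uc g by (metis m_lcomm r_inv r_one inv_closed)
  have hK: "h \<notin> ?K"
  proof
    assume "h \<in> ?K"
    hence "inv h \<otimes> u \<in> ?K" using U(1) uK by (intro spn_mult spn_inv) auto
    moreover have "inv h \<otimes> u = g" using gh uc g hc by (metis m_comm m_assoc l_inv l_one inv_closed)
    ultimately show False using g by simp
  qed
  have notK: "x \<otimes> \<sigma> T \<noteq> \<one>" if "x \<in> carrier G" "x \<notin> ?K" "T \<subseteq># V" for x T
  proof
    assume "x \<otimes> \<sigma> T = \<one>"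
    moreover have T: "set_mset T \<subseteq> set_mset U" using set_mset_mono[OF that(3)] UV by auto
    ultimately have "x = inv (\<sigma> T)" using U(1) that(1) by (metis inv_equality seq_sum_closed subset_trans)
    moreover have "inv (\<sigma> T) \<in> ?K" using T U(1) by (intro spn_inv spnI)
    ultimately show False using that by simp
  qed
  have "atom (V + {#g, h#})"
  proof (rule atomI)
    show "set_mset (V + {#g, h#}) \<subseteq> carrier G" using uc hc g by auto
    have "\<sigma> (V + {#g, h#}) = \<sigma> V \<otimes> (g \<otimes> h)" using uc hc g by (simp add: m_ac)
    also have "\<dots> = \<sigma> U" unfolding gh UV using uc by (simp add: m_comm)
    finally show "\<sigma> (V + {#g, h#}) = \<one>" using U(2) by simp
    fix T assume T: "T \<subseteq># V + {#g, h#}" "\<sigma> T = \<one>"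
    then obtain A B where AB: "T = A + B" "A \<subseteq># V" "B \<subseteq># {#g, h#}" by (metis subseteq_union_split)
    have A: "set_mset A \<subseteq> carrier G" using set_mset_mono[OF AB(2)] uc by auto
    have AU: "A \<subseteq># U" using AB(2) UV by (metis mset_subset_eq_add_mset_cancel mset_subset_eq_multiset_union_diff_commute subset_mset.order_trans mset_subset_eq_add_right add_mset_add_single union_commute)
    have AV: "A \<noteq> U" using size_mset_mono[OF AB(2)] UV by auto
    have "B = {#} \<or> B = {#g#} \<or> B = {#h#} \<or> B = {#g, h#}"
    proof -
      obtain B1 B2 where B: "B = B1 + B2" "B1 \<subseteq># {#g#}" "B2 \<subseteq># {#h#}"
      proof (rule subseteq_union_split)
        show "B \<subseteq># {#g#} + {#h#}" using AB(3) by (simp add: add_mset_commute)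
      qed
      show ?thesis using subseteq_singletonD[OF B(2)] subseteq_singletonD[OF B(3)] B(1)
        by (elim disjE) simp_all
    qed
    thus "T = {#} \<or> T = V + {#g, h#}"
    proof (elim disjE)
      assume "B = {#}"
      thus ?thesis using U(4)[OF AU] AB(1) T(2) AV by auto
    next
      assume "B = {#g#}"
      thus ?thesis using notK[OF g AB(2)] T(2) AB(1) g A by (simp add: m_comm)
    next
      assume "B = {#h#}"
      thus ?thesis using notK[OF hc hK AB(2)] T(2) AB(1) hc A by (simp add: m_comm)
    next
      assume B: "B = {#g, h#}"
      have "\<sigma> (add_mset u A) = \<sigma> T" unfolding AB(1) B using A g hc uc
        by (simp add: m_assoc flip: gh)
      moreover have "add_mset u A \<subseteq># U" using AB(2) UV by simp
      ultimately have "add_mset u A = U" using U(4) T(2) by (metis add_mset_not_empty)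
      thus ?thesis using UV AB(1) B by simp
    qed
  qed simp
  hence "size (V + {#g, h#}) \<le> davenport G" by (rule atom_le_davenport)
  thus False using assms(2) UV by simp
qed

lemma cyclic_if_spn:
  assumes "e \<in> carrier G" "spn {e} = carrier G"
  shows "cyclic_group G"
  unfolding cyclic_group
proof (rule bexI[OF _ assms(1)])
  show "carrier G = range (\<lambda>n::int. e [^] n)"
  proof
    show "carrier G \<subseteq> range (\<lambda>n::int. e [^] n)"
      using assms spn_single by (metis int_pow_int rangeI subsetI)
  qed (use assms(1) in auto)
qed

text \<open>
  The partial sums of \<open>S\<close>, together with their translates by the sum of \<open>S\<close>, are pairwise distinct.
\<close>

lemma zero_sum_free_involution:
  assumes "e \<in> carrier G" "set_mset S \<subseteq> spn {e}" "\<sigma> S \<otimes> \<sigma> S = \<one>" "\<sigma> S \<noteq> \<one>"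
    and free: "\<And>T. T \<subseteq># S \<Longrightarrow> \<sigma> T = \<one> \<Longrightarrow> T = {#}"
  shows "2 * size S \<le> ord e"
proof -
  obtain xs where xs: "S = mset xs" using ex_mset by metis
  have ec: "{e} \<subseteq> carrier G" using assms(1) by simp
  have Sc: "set_mset S \<subseteq> carrier G" using assms(2) spn_closed[OF ec] by auto
  define h where "h = \<sigma> S"
  have h: "h \<in> carrier G" "h \<otimes> h = \<one>" "h \<noteq> \<one>" using assms(3,4) Sc by (auto simp: h_def)
  define f where "f i = \<sigma> (mset (take i xs))" for i
  \<comment> \<open>The index 0 is left out: the translate of the empty sum by \<open>h\<close> is
    the full sum.\<close>
  define L where "L = {1..length xs}"
  have sub: "set_mset (mset (take i xs)) \<subseteq> set_mset S" for i
    unfolding xs using set_take_subset by fastforce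
  have fc: "f i \<in> spn {e}" for i
  proof -
    have "f i \<in> spn (set_mset S)" unfolding f_def using sub by (intro spnI)
    thus ?thesis using spn_minimal[OF assms(2) ec] by auto
  qed
  hence fcc: "f i \<in> carrier G" for i using spn_closed[OF ec] by auto
  have step: "f i \<noteq> f j \<and> f j \<noteq> f i \<otimes> h" if ij: "1 \<le> i" "i < j" "j \<le> length xs" for i j
  proof -
    define T where "T = mset (take (j - i) (drop i xs))"
    have tj: "mset (take j xs) = mset (take i xs) + T"
      using ij unfolding T_def by (metis le_add_diff_inverse less_imp_le mset_append take_add)
    have sz: "size T = j - i" using ij by (simp add: T_def)
    have TS: "T \<subseteq># S" unfolding xs
      by (metis T_def append_take_drop_id mset_append mset_subset_eq_add_left mset_subset_eq_add_right subset_mset.order_trans)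
    have c: "set_mset T \<subseteq> carrier G" using set_mset_mono[OF TS] Sc by auto
    have fj: "f j = f i \<otimes> \<sigma> T" unfolding f_def tj using sub Sc c by (simp add: subset_trans[of _ "set_mset S"])
    have "\<sigma> T \<noteq> \<one>" using free[OF TS] sz ij by auto
    \<comment> \<open>A block with the full sum has a zero-sum complement, which must be empty; but
      the block misses the first \<open>i\<close> terms.\<close>
    moreover have "\<sigma> T \<noteq> h"
    proof
      assume "\<sigma> T = h"
      hence "h = h \<otimes> \<sigma> (S - T)" using seq_sum_diff[OF Sc TS] by (simp add: h_def)
      moreover have "set_mset (S - T) \<subseteq> carrier G" using Sc by (auto dest: in_diffD)
      ultimately have "\<sigma> (S - T) = \<one>" using h(1) by (metis l_cancel_one' seq_sum_closed)
      hence "S - T = {#}" using free[of "S - T"] by simp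
      hence "size S \<le> size T" by (metis Diff_eq_empty_iff_mset size_mset_mono)
      thus False using sz ij xs by simp
    qed
    ultimately show ?thesis using fj fcc[of i] c h(1) by (metis l_cancel l_cancel_one seq_sum_closed)
  qed
  have inj: "inj_on f L" unfolding L_def
    by (rule linorder_inj_onI) (use step in auto)
  have inj2: "inj_on (\<lambda>i. f i \<otimes> h) L"
    by (rule inj_onI) (use inj fcc h(1) in \<open>auto dest: inj_onD\<close>)
  have disj: "f ` L \<inter> (\<lambda>i. f i \<otimes> h) ` L = {}"
  proof (rule ccontr)
    assume "f ` L \<inter> (\<lambda>i. f i \<otimes> h) ` L \<noteq> {}"
    then obtain i j where ij: "i \<in> L" "j \<in> L" "f j = f i \<otimes> h" by auto
    have "f i = f j \<otimes> h" using ij(3) fcc h(1,2) by (simp add: m_assoc)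
    moreover have "i \<noteq> j" using ij(3) fcc[of i] h by auto
    ultimately show False using step[of i j] step[of j i] ij unfolding L_def by (cases "i < j") auto
  qed
  have hs: "h \<in> spn {e}"
    using spn_minimal[OF assms(2) ec] spnI[of S "set_mset S"] by (auto simp: h_def)
  have "f ` L \<union> (\<lambda>i. f i \<otimes> h) ` L \<subseteq> spn {e}" using fc hs spn_mult[OF ec] by auto
  moreover have "spn {e} \<subseteq> (\<lambda>n. e [^] n) ` {..<ord e}"
  proof
    fix x assume "x \<in> spn {e}"
    then obtain n :: nat where "x = e [^] n" using spn_single[OF assms(1)] by auto
    hence "x = e [^] (n mod ord e)" using pow_mod_ord[OF assms(1)] by simp
    thus "x \<in> (\<lambda>n. e [^] n) ` {..<ord e}" using ord_pos[OF assms(1)] by auto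
  qed
  ultimately have "f ` L \<union> (\<lambda>i. f i \<otimes> h) ` L \<subseteq> (\<lambda>n. e [^] n) ` {..<ord e}" by blast
  from card_mono[OF _ this] have "card (f ` L \<union> (\<lambda>i. f i \<otimes> h) ` L) \<le> ord e"
    using card_image_le[of "{..<ord e}" "\<lambda>n. e [^] n"] by simp
  moreover have "card (f ` L \<union> (\<lambda>i. f i \<otimes> h) ` L) = 2 * length xs"
    using disj inj inj2 by (subst card_Un_disjoint) (auto simp: card_image L_def)
  ultimately show ?thesis using xs by simp
qed

text \<open>
  If \<open>U\<close> is not contained in the cyclic group generated by \<open>e\<close>, let \<open>S\<close> be its part inside that
  group and \<open>V\<close> the remaining part. The sum of \<open>S\<close> is an
  involution, so \<open>S\<close> is short, whereas a longer atom arises when \<open>S\<close> is traded for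
  \<open>ord e - 1\<close> copies of \<open>e\<close> and one element of \<open>V\<close> absorbs the difference.
\<close>

lemma long_atom_no_involution_gluing:
  assumes "atom U" "size U = davenport G" "e \<in># U" "3 \<le> ord e"
    and A: "A \<subseteq> carrier G"
    and cov: "\<And>x. x \<in># U \<Longrightarrow> x \<in> spn {e} \<or> (\<exists>y\<in>spn A. x [^] (2::nat) = y [^] (2::nat))"
    and meet: "\<And>(n::nat) y. y \<in> spn A \<Longrightarrow> (e [^] n) [^] (2::nat) = y [^] (2::nat) \<Longrightarrow> (e [^] n) [^] (2::nat) = \<one>"
  shows "cyclic_group G"
proof -
  note U = atomD[OF assms(1)]
  have ec: "e \<in> carrier G" "{e} \<subseteq> carrier G" using assms(3) U(1) by auto
  define S where "S = filter_mset (\<lambda>x. x \<in> spn {e}) U"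
  define V where "V = filter_mset (\<lambda>x. x \<notin> spn {e}) U"
  have SV: "U = S + V" unfolding S_def V_def by simp
  have Sc: "set_mset S \<subseteq> spn {e}" "set_mset S \<subseteq> carrier G" and Vc: "set_mset V \<subseteq> carrier G"
    using U(1) by (auto simp: S_def V_def)
  show ?thesis
  proof (cases "V = {#}")
    case True
    hence "set_mset U \<subseteq> spn {e}" using SV Sc by simp
    hence "carrier G \<subseteq> spn {e}" using long_atom_generates[OF assms(1,2)] spn_minimal[OF _ ec(2)] by blast
    thus ?thesis using cyclic_if_spn[OF ec(1)] spn_closed[OF ec(2)] by blast
  next
    case False
    have "e \<in># S" using assms(3) ec by (auto simp: S_def intro: spn_incl)
    hence S0: "S \<noteq> {#}" by auto
    have sSe: "\<sigma> S \<in> spn {e}" using spn_minimal[OF Sc(1) ec(2)] spnI[of S "set_mset S"] by auto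
    then obtain c :: nat where c: "\<sigma> S = e [^] c" using spn_single[OF ec(1)] by auto
    have sSV: "\<sigma> S \<otimes> \<sigma> V = \<one>" using U(2) Sc Vc unfolding SV by simp
    \<comment> \<open>Up to involutions all sums over \<open>V\<close> lie in the span of
      \<open>A\<close>. By \<open>meet\<close>, such a sum inside the group generated by
      \<open>e\<close> is trivial or an involution.\<close>
    have K: "\<exists>y\<in>spn A. \<sigma> T [^] (2::nat) = y [^] (2::nat)" if "set_mset T \<subseteq> set_mset V" for T
      using that
    proof (induction T)
      case empty
      show ?case by (rule bexI[OF _ spn_one]) simp
    next
      case (add x T)
      obtain y where y: "y \<in> spn A" "\<sigma> T [^] (2::nat) = y [^] (2::nat)" using add by auto
      have "x \<in># U" "x \<notin> spn {e}" using add.prems by (auto simp: V_def)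
      then obtain z where z: "z \<in> spn A" "x [^] (2::nat) = z [^] (2::nat)" using cov by blast
      have "set_mset T \<subseteq> carrier G" "x \<in> carrier G" using add.prems Vc by auto
      moreover have "y \<in> carrier G" "z \<in> carrier G" using y z spn_closed[OF A] by auto
      ultimately have "\<sigma> (add_mset x T) [^] (2::nat) = (z \<otimes> y) [^] (2::nat)"
        using y z by (simp add: nat_pow_distrib)
      thus ?case using spn_mult[OF A z(1) y(1)] by blast
    qed
    have inv_sub: "\<sigma> T [^] (2::nat) = \<one>" if T: "set_mset T \<subseteq> set_mset V" "\<sigma> T \<in> spn {e}" for T
    proof -
      obtain n :: nat where "\<sigma> T = e [^] n" using T(2) spn_single[OF ec(1)] by auto
      thus ?thesis using K[OF T(1)] meet by metis
    qed
    have sV: "\<sigma> V = inv (\<sigma> S)" using sSV Sc Vc by (metis inv_equality m_comm seq_sum_closed)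
    have "\<sigma> V \<in> spn {e}" unfolding sV by (rule spn_inv[OF ec(2) sSe])
    hence V2: "\<sigma> V [^] (2::nat) = \<one>" by (rule inv_sub[OF subset_refl])
    hence S2: "\<sigma> S \<otimes> \<sigma> S = \<one>" using sV Sc
      by (simp add: numeral_2_eq_2 inv_eq_1_iff flip: inv_mult)
    have Sne: "\<sigma> S \<noteq> \<one>" using U(4)[of S] S0 False SV by auto
    have free: "T = {#}" if "T \<subseteq># S" "\<sigma> T = \<one>" for T
    proof -
      have "T \<subseteq># U" using that(1) SV by (simp add: subset_mset.add_increasing2)
      moreover have "T \<noteq> U" using size_mset_mono[OF that(1)] SV False by (auto simp: nonempty_has_size)
      ultimately show ?thesis using U(4) that(2) by blast
    qed
    have short: "2 * size S \<le> ord e"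
      by (rule zero_sum_free_involution[OF ec(1) Sc(1) S2 Sne free])
    \<comment> \<open>A cyclic group has at most one involution, so the sum of \<open>T\<close> is
      trivial or equals that of \<open>S\<close>. Hence \<open>T\<close> or \<open>S + T\<close> is
      a zero-sum subsequence of \<open>U\<close>.\<close>
    have triv: "T = {#} \<or> T = V" if T: "T \<subseteq># V" "\<sigma> T \<in> spn {e}" for T
    proof -
      have Tc: "set_mset T \<subseteq> carrier G" using set_mset_mono[OF T(1)] Vc by auto
      have T2: "\<sigma> T \<otimes> \<sigma> T = \<one>" using inv_sub[OF set_mset_mono[OF T(1)] T(2)] Tc by (simp add: numeral_2_eq_2)
      obtain n m :: nat where nm: "\<sigma> T = e [^] n" "\<sigma> S = e [^] m" using T(2) sSe spn_single[OF ec(1)] by auto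
      show ?thesis
      proof (cases "\<sigma> T = \<one>")
        case True
        have "T \<subseteq># U" using T(1) SV by (simp add: subset_mset.add_increasing)
        moreover have "T \<noteq> U" using size_mset_mono[OF T(1)] SV S0 by (auto simp: nonempty_has_size)
        ultimately show ?thesis using U(4) True by blast
      next
        case False
        have "ord e dvd 2 * n" "ord e dvd 2 * m" "\<not> ord e dvd n" "\<not> ord e dvd m"
          using T2 S2 nm ec False Sne by (auto simp: nat_pow_mult pow_eq_id mult_2)
        \<comment> \<open>Uniqueness of the involution in exponents: \<open>n\<close> and
          \<open>m\<close> are both odd multiples of half the order of \<open>e\<close>.\<close>
        have "ord e dvd n + m"
        proof -
          obtain a b where ab: "2 * n = ord e * a" "2 * m = ord e * b"
            using \<open>ord e dvd 2 * n\<close> \<open>ord e dvd 2 * m\<close> by (auto elim!: dvdE)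
          have "odd a" "odd b" using ab \<open>\<not> ord e dvd n\<close> \<open>\<not> ord e dvd m\<close> by (auto elim!: evenE)
          hence "even (a + b)" by simp
          then obtain q where "a + b = 2 * q" by blast
          hence "2 * (n + m) = 2 * (ord e * q)" using ab by (metis distrib_left mult.left_commute)
          hence "n + m = ord e * q" by (metis nat_mult_eq_cancel_disj zero_neq_numeral)
          thus ?thesis by simp
        qed
        hence "\<sigma> S \<otimes> \<sigma> T = \<one>" using nm ec by (simp add: nat_pow_mult pow_eq_id add.commute)
        hence "\<sigma> (S + T) = \<one>" using Sc Tc by simp
        moreover have "S + T \<subseteq># U" using T(1) SV by simp
        ultimately have "S + T = U" using U(4) S0 by (metis subset_mset.add_eq_0_iff_both_eq_0)
        thus ?thesis using SV by simp
      qed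
    qed
    obtain y W where VW: "V = add_mset y W" using False by (metis multiset_cases)
    have yW: "y \<in> carrier G" "set_mset W \<subseteq> carrier G" using Vc VW by auto
    \<comment> \<open>The sum \<open>e [^] c\<close> of \<open>S\<close> is traded for that of
      \<open>ord e - 1\<close> copies of \<open>e\<close>, which is \<open>inv e\<close>; the factor
      \<open>e [^] (c + 1)\<close> makes up for it.\<close>
    define y' where "y' = y \<otimes> e [^] (c + 1)"
    define m where "m = ord e - 1"
    have ordm: "ord e = m + 1" using assms(4) by (simp add: m_def)
    have y'c: "y' \<in> carrier G" using yW ec by (simp add: y'_def)
    have rc: "set_mset (replicate_mset j e) \<subseteq> carrier G" for j using ec by auto
    have "atom ((W + {#y'#}) + replicate_mset m e)"
    proof (rule atomI)
      show "set_mset ((W + {#y'#}) + replicate_mset m e) \<subseteq> carrier G" using yW y'c rc[of m] by simp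
      have "\<sigma> ((W + {#y'#}) + replicate_mset m e) = \<sigma> W \<otimes> (y \<otimes> e [^] (c + 1)) \<otimes> e [^] m"
        using yW y'c rc[of m] ec by (simp add: y'_def m_ac)
      also have "\<dots> = (y \<otimes> \<sigma> W) \<otimes> (e [^] (c + 1) \<otimes> e [^] m)" using yW ec by (simp add: m_ac del: nat_pow_Suc)
      also have "e [^] (c + 1) \<otimes> e [^] m = e [^] c \<otimes> e [^] ord e"
        by (simp only: nat_pow_mult[OF ec(1)] ordm add.assoc add.commute[of 1 m])
      also have "(y \<otimes> \<sigma> W) \<otimes> (e [^] c \<otimes> e [^] ord e) = \<sigma> V \<otimes> \<sigma> S" using ec yW VW c by simp
      finally show "\<sigma> ((W + {#y'#}) + replicate_mset m e) = \<one>" using sSV Sc Vc by (simp add: m_comm)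
      fix T assume T: "T \<subseteq># (W + {#y'#}) + replicate_mset m e" "\<sigma> T = \<one>"
      then obtain A B where AB: "T = A + B" "A \<subseteq># W + {#y'#}" "B \<subseteq># replicate_mset m e" by (metis subseteq_union_split)
      then obtain j where j: "j \<le> m" "B = replicate_mset j e" by (metis subseteq_replicateD)
      obtain A1 A2 where A12: "A = A1 + A2" "A1 \<subseteq># W" "A2 \<subseteq># {#y'#}" using AB(2) by (metis subseteq_union_split)
      have A1: "set_mset A1 \<subseteq> carrier G" using set_mset_mono[OF A12(2)] yW by auto
      have A1V: "A1 \<subseteq># V" "A1 \<noteq> V" using A12(2) VW size_mset_mono[OF A12(2)]
        by (auto intro: subset_mset.order_trans)
      have "A2 = {#} \<or> A2 = {#y'#}" using A12(3) by (rule subseteq_singletonD)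
      thus "T = {#} \<or> T = (W + {#y'#}) + replicate_mset m e"
      proof
        assume A2: "A2 = {#}"
        hence eq: "\<sigma> A1 \<otimes> e [^] j = \<one>" using T(2) AB(1) A12(1) j A1 rc ec by simp
        hence "\<sigma> A1 = inv (e [^] j)" using A1 ec by (metis inv_equality nat_pow_closed seq_sum_closed)
        moreover have "inv (e [^] j) \<in> spn {e}" using ec by (intro spn_inv spn_pow spn_incl) auto
        ultimately have "\<sigma> A1 \<in> spn {e}" by simp
        hence A10: "A1 = {#}" using triv A1V by blast
        hence "ord e dvd j" using eq ec by (simp add: pow_eq_id)
        hence "j = 0" using j(1) ordm by (metis Suc_eq_plus1 dvd_imp_le le_SucI not_less_eq_eq neq0_conv)
        thus ?thesis using A10 A2 AB(1) A12(1) j by simp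
      next
        \<comment> \<open>Putting \<open>y\<close> back for \<open>y'\<close> gives a subsequence of
          \<open>V\<close> with sum in the group generated by \<open>e\<close>, hence all of
          \<open>V\<close>; then all copies of \<open>e\<close> are forced as well.\<close>
        assume A2: "A2 = {#y'#}"
        have y'e: "\<sigma> A1 \<otimes> y' \<otimes> e [^] j = \<one>" using T(2) AB(1) A12(1) j A1 rc ec A2 y'c by (simp add: m_ac)
        hence eq: "\<sigma> (add_mset y A1) \<otimes> e [^] (c + 1 + j) = \<one>"
          using A1 yW ec unfolding y'_def nat_pow_mult[OF ec(1), symmetric] by (simp add: m_ac del: nat_pow_Suc)
        hence "\<sigma> (add_mset y A1) = inv (e [^] (c + 1 + j))" using A1 yW ec
          by (metis inv_equality nat_pow_closed seq_sum_closed insert_subset set_mset_add_mset_insert)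
        also have "\<dots> \<in> spn {e}" using ec by (intro spn_inv spn_pow spn_incl) auto
        finally have "add_mset y A1 = V" using triv[of "add_mset y A1"] A12(2) VW by auto
        hence A1W: "A1 = W" using VW by simp
        have "e [^] c \<otimes> e [^] (1 + j) = e [^] (c + 1 + j)"
          by (simp only: nat_pow_mult[OF ec(1)] add.assoc)
        hence "\<sigma> V \<otimes> e [^] c \<otimes> e [^] (1 + j) = \<one>" using eq A1W VW ec Vc
          by (metis m_assoc nat_pow_closed seq_sum_closed)
        hence "e [^] (1 + j) = \<one>" using sSV c Vc ec Sc by (metis l_one m_comm nat_pow_closed seq_sum_closed)
        hence "ord e dvd 1 + j" by (simp only: pow_eq_id[OF ec(1)])
        hence "j = m" using j(1) ordm by (metis Suc_eq_plus1 add.commute dvd_imp_le le_antisym not_less_eq_eq zero_less_Suc plus_1_eq_Suc Suc_le_mono)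
        thus ?thesis using A1W A2 AB(1) A12(1) j by simp
      qed
    qed simp
    hence "size ((W + {#y'#}) + replicate_mset m e) \<le> davenport G" by (rule atom_le_davenport)
    \<comment> \<open>So \<open>ord e - 1\<close> is at most \<open>size S\<close>, which is at most
      half of \<open>ord e\<close>; this contradicts \<open>3 \<le> ord e\<close>.\<close>
    hence "m \<le> size S" using assms(2) SV VW by simp
    thus ?thesis using short ordm assms(4) by simp
  qed
qed

end

section \<open>Groups of prime power exponent and of exponent a product of two primes\<close>

lemma prime_power_index:
  fixes p :: nat
  assumes "Factorial_Ring.prime p" "k dvd p ^ s" "\<not> k dvd p ^ (s - 1)"
  shows "k = p ^ s"
proof -
  obtain i where i: "i \<le> s" "k = p ^ i" using assms(1,2) divides_primepow_nat by blast
  have "\<not> i \<le> s - 1" using assms(3) i(2) le_imp_power_dvd by blast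
  hence "i = s" using i(1) by linarith
  thus ?thesis using i by simp
qed

context finite_comm_group
begin

lemma pow_in_spn:
  assumes "S \<subseteq> carrier G" "E \<subseteq> carrier G" "\<And>x. x \<in> S \<Longrightarrow> x [^] (n::nat) \<in> spn E" "x \<in> spn S"
  shows "x [^] n \<in> spn E"
proof -
  obtain Y where Y: "set_mset Y \<subseteq> S" "x = \<sigma> Y" using assms(4) unfolding spn_def by auto
  have "\<sigma> Y [^] n \<in> spn E" using Y(1)
  proof (induction Y)
    case (add y Y)
    moreover from this have "y \<in> carrier G" "set_mset Y \<subseteq> carrier G" using assms(1) by auto
    ultimately show ?case using assms(2,3) by (simp add: nat_pow_distrib spn_mult)
  qed (simp add: spn_one)
  thus ?thesis using Y by simp
qed

lemma spn_empty: "spn {} = {\<one>}"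
  by (auto simp: spn_def)

lemma ord_prime_power:
  assumes "Factorial_Ring.prime p" "g \<in> carrier G" "g [^] (p ^ s) = \<one>" "g [^] (p ^ (s - 1)) \<noteq> \<one>"
  shows "ord g = p ^ s"
  using prime_power_index[OF assms(1), of "ord g" s] assms(2-4) by (simp add: pow_eq_id)

text \<open>The index divides \<open>p ^ s\<close> but not \<open>p ^ (s - 1)\<close>, so one
  exponent tests all smaller ones.\<close>

lemma prime_power_min_index:
  assumes "Factorial_Ring.prime p" "g \<in> carrier G" "E \<subseteq> carrier G"
    "g [^] (p ^ s) \<in> spn E" "g [^] (p ^ (s - 1)) \<notin> spn E" "0 < j" "j < p ^ s"
  shows "g [^] (j::nat) \<notin> spn E"
proof -
  obtain k where k: "0 < k" "g [^] k \<in> spn E" "\<And>j. 0 < j \<Longrightarrow> j < k \<Longrightarrow> g [^] (j::nat) \<notin> spn E"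
    using min_index[OF assms(2)] by blast
  have dvd: "k dvd n" if "g [^] n \<in> spn E" for n using min_index_dvd[OF assms(2,3) k(1,2)] k(3) that by blast
  have "\<not> k dvd p ^ (s - 1)"
  proof
    assume "k dvd p ^ (s - 1)"
    then obtain q where "p ^ (s - 1) = k * q" by blast
    hence "g [^] (p ^ (s - 1)) = (g [^] k) [^] q" using assms(2) by (simp add: nat_pow_pow)
    thus False using spn_pow[OF assms(3) k(2)] assms(5) by metis
  qed
  hence "k = p ^ s" using prime_power_index[OF assms(1)] dvd assms(4) by blast
  thus ?thesis using k(3) assms(6,7) by blast
qed

lemma indep_insert_full:
  assumes "indep 1 E" "g \<in> carrier G" "\<And>j. 0 < j \<Longrightarrow> j < ord g \<Longrightarrow> g [^] (j::nat) \<notin> spn E"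
  shows "indep 1 (insert g E)"
proof (rule indep_insert[OF assms(1,2)])
  fix j :: nat and y assume "0 < j" "j < ord (g [^] (1::nat))" "y \<in> spn E"
  moreover from this have "y \<in> carrier G" using spn_closed[OF indep_carrier[OF assms(1)]] by blast
  ultimately show "(g [^] (1::nat)) [^] j \<noteq> y [^] (1::nat)"
    using assms(2,3) by (metis nat_pow_eone)
qed

lemma indep_single: "g \<in> carrier G \<Longrightarrow> indep 1 {g}"
  by (rule indep_insert_full[OF indep_empty]) (auto simp: spn_empty pow_eq_id dvd_imp_le leD)

text \<open>As \<open>p\<close> kills \<open>y\<close>, independence makes \<open>ord e\<close>
  divide \<open>p\<close> times each coefficient of \<open>y\<close>; hence every coefficient is a
  multiple of \<open>p ^ (s - 1)\<close> and can be divided by it.\<close>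

lemma spn_root:
  assumes "Factorial_Ring.prime p" "indep 1 E" "\<And>e. e \<in> E \<Longrightarrow> p ^ s dvd ord e" "0 < s" "y \<in> spn E" "y [^] p = \<one>"
  obtains z where "z \<in> spn E" "y = z [^] (p ^ (s - 1))"
proof -
  obtain Y where Y: "set_mset Y \<subseteq> E" "y = \<sigma> Y" using assms(5) unfolding spn_def by auto
  note Ec = indep_carrier[OF assms(2)]
  have Yc: "set_mset Y \<subseteq> carrier G" using Y(1) Ec by auto
  let ?n = "p ^ (s - 1)"
  have div: "?n dvd count Y e" if e: "e \<in> E" for e
  proof -
    have rp: "set_mset (repeat_mset p Y) \<subseteq> E" using Y(1)
      by (auto simp: repeat_mset.rep_eq simp flip: count_greater_zero_iff)
    have "e [^] (1 * count (repeat_mset p Y) e) = \<one>"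
      by (rule indepD[OF assms(2) rp _ e]) (use Y Yc assms(6) in simp)
    hence "ord e dvd p * count Y e" using e Ec by (simp add: pow_eq_id subset_iff)
    hence "p * ?n dvd p * count Y e" using assms(3)[OF e] assms(4)
      by (metis dvd_trans power_eq_if less_not_refl)
    thus ?thesis using assms(1) by (simp add: prime_gt_0_nat)
  qed
  define Z where "Z = (\<Sum>e\<in>set_mset Y. replicate_mset (count Y e div ?n) e)"
  have cZ: "count Z x = (if x \<in># Y then count Y x div ?n else 0)" for x
    unfolding Z_def by (simp add: count_sum if_distrib eq_commute cong: if_cong)
  have "repeat_mset ?n Z = Y"
    by (rule multiset_eqI) (use div Y(1) in \<open>auto simp: cZ not_in_iff\<close>)
  moreover have ZE: "set_mset Z \<subseteq> E" using Y(1) cZ by (metis count_greater_zero_iff less_irrefl subset_iff)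
  ultimately have "\<sigma> Y = \<sigma> Z [^] ?n" using Ec by (metis seq_sum_repeat subset_trans)
  thus ?thesis using that[of "\<sigma> Z"] ZE Y(2) spnI by blast
qed

text \<open>Elements that are \<open>p\<close>-th powers are redundant for generation: substituting
  the covering into itself replaces \<open>p\<close> by \<open>p ^ n\<close>, and for n = s the
  power is trivial.\<close>

lemma Frattini_argument:
  assumes "M \<subseteq> carrier G" "\<And>x y. x \<in> M \<Longrightarrow> y \<in> M \<Longrightarrow> x \<otimes> y \<in> M" "\<one> \<in> M"
    and "\<And>x. x \<in> carrier G \<Longrightarrow> \<exists>m\<in>M. \<exists>c\<in>carrier G. x = m \<otimes> c [^] (p::nat)"
    and "\<And>x. x \<in> carrier G \<Longrightarrow> x [^] (p ^ s) = \<one>" and "x \<in> carrier G"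
  shows "x \<in> M"
proof -
  have pw: "m [^] (n::nat) \<in> M" if "m \<in> M" for m n by (induction n) (auto intro: assms(2,3) that)
  have "\<exists>m\<in>M. \<exists>c\<in>carrier G. x = m \<otimes> c [^] (p ^ n)" for n
  proof (induction n)
    case 0
    show ?case using assms(3,6) by (intro bexI[of _ "\<one>"] bexI[of _ x]) auto
  next
    case (Suc n)
    then obtain m c where mc: "m \<in> M" "c \<in> carrier G" "x = m \<otimes> c [^] (p ^ n)" by blast
    obtain m' c' where mc': "m' \<in> M" "c' \<in> carrier G" "c = m' \<otimes> c' [^] p" using assms(4)[OF mc(2)] by blast
    have "x = (m \<otimes> m' [^] (p ^ n)) \<otimes> c' [^] (p ^ Suc n)"
      using mc mc' assms(1) by (simp add: nat_pow_distrib nat_pow_pow m_assoc subset_iff)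
    thus ?case using mc(1) mc'(1,2) pw assms(2) by blast
  qed
  from this[of s] obtain m c where "m \<in> M" "c \<in> carrier G" "x = m \<otimes> c [^] (p ^ s)" by blast
  thus ?thesis using assms(1,5) by auto
qed

end

section \<open>Contradictions for an atom of maximal length, one kind of exponent at a time\<close>

locale long_atom = length_congruence +
  fixes U
  assumes U_atom: "atom U" and U_size: "size U = davenport G" and U_supp: "set_mset U \<subseteq> Supp"
    and non_cyclic: "\<not> cyclic_group G"
begin

lemma U_carrier: "set_mset U \<subseteq> carrier G"
  using U_supp Supp_carrier by auto

text \<open>The contradiction in which most cases end. Independence of the squares makes the group
  generated by \<open>e\<close> meet the span of the other elements of \<open>A\<close> in
  involutions only, so the previous section forces \<open>G\<close> to be cyclic.\<close>

lemma cover_impossible: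
  assumes "indep 2 A" "e \<in> A" "e \<in># U" "3 \<le> ord e"
    and cov: "\<And>x. x \<in># U \<Longrightarrow> (\<exists>a\<in>A. x \<in> spn {a}) \<or> x [^] (2::nat) = \<one>"
  shows False
proof -
  note Ac = indep_carrier[OF assms(1)]
  have ec: "e \<in> carrier G" using assms(2) Ac by auto
  have "cyclic_group G"
  proof (rule long_atom_no_involution_gluing[OF U_atom U_size assms(3,4)])
    show "A - {e} \<subseteq> carrier G" using Ac by auto
    fix x assume "x \<in># U"
    thus "x \<in> spn {e} \<or> (\<exists>y\<in>spn (A - {e}). x [^] (2::nat) = y [^] (2::nat))"
    proof (elim disjE[OF cov])
      assume "\<exists>a\<in>A. x \<in> spn {a}"
      then obtain a where a: "a \<in> A" "x \<in> spn {a}" by blast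
      thus ?thesis using spn_mono[of "{a}" "A - {e}"] by (cases "a = e") auto
    next
      assume "x [^] (2::nat) = \<one>"
      thus ?thesis by (intro disjI2 bexI[OF _ spn_one]) simp
    qed
  next
    fix n :: nat and y assume "y \<in> spn (A - {e})" and eq: "(e [^] n) [^] (2::nat) = y [^] (2::nat)"
    then obtain Y where Y: "set_mset Y \<subseteq> A - {e}" "y = \<sigma> Y" unfolding spn_def by auto
    have "(e [^] (2::nat)) [^] count Y e = (e [^] (2::nat)) [^] count (replicate_mset n e) e"
      by (rule indep_eq[OF assms(1) _ _ _ assms(2)]) (use Y eq ec assms(2) in auto)
    moreover have "count Y e = 0" using Y(1) by (meson Diff_iff insertI1 not_in_iff subsetD)
    ultimately show "(e [^] n) [^] (2::nat) = \<one>" using ec by (simp add: nat_pow_pow mult.commute)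
  qed
  thus False using non_cyclic by simp
qed

text \<open>As \<open>U\<close> generates \<open>G\<close>, a condition on powers has to be checked
  on the support of \<open>U\<close> only.\<close>

lemma long_atom_pow:
  assumes "E \<subseteq> carrier G" "\<And>x. x \<in># U \<Longrightarrow> x [^] (n::nat) \<in> spn E" "x \<in> carrier G"
  shows "x [^] n \<in> spn E"
  using pow_in_spn[OF U_carrier assms(1,2)] assms(3) long_atom_generates[OF U_atom U_size] by auto

lemma long_atom_pow_one:
  assumes "\<And>x. x \<in># U \<Longrightarrow> x [^] (n::nat) = \<one>" "x \<in> carrier G"
  shows "x [^] n = \<one>"
  using long_atom_pow[of "{}" n x] assms by (simp add: spn_empty)

lemma U_cong: "d dvd int (davenport G) - 2"
  using cong_size[OF U_atom U_supp] U_size by simp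

text \<open>\<open>upper\<close> and \<open>lower\<close> isolate what is used of a group with
  cyclic summands of two orders: below the top layer everything is, up to \<open>p\<close>-th
  powers, killed by \<open>p ^ s1\<close>, and what is killed by \<open>p ^ (s1 - 1)\<close> is a
  \<open>p\<close>-th power. A basis is then picked from \<open>U\<close> layer by layer.\<close>

lemma prime_power_case:
  fixes p s1 s2 :: nat
  assumes p: "Factorial_Ring.prime p" and s: "0 < s1" "s1 dvd s2" "0 < s2" "3 \<le> p ^ s2"
    and exp: "\<And>g. g \<in> carrier G \<Longrightarrow> g [^] (p ^ s2) = \<one>"
    and exact: "g0 \<in> carrier G" "g0 [^] (p ^ (s2 - 1)) \<noteq> \<one>"
    and upper: "\<And>g. g \<in> carrier G \<Longrightarrow> g [^] (p ^ (s2 - 1)) = \<one> \<Longrightarrow>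
      \<exists>b\<in>carrier G. \<exists>c\<in>carrier G. g = b \<otimes> c [^] p \<and> b [^] (p ^ s1) = \<one>"
    and lower: "\<And>g. g \<in> carrier G \<Longrightarrow> g [^] (p ^ (s1 - 1)) = \<one> \<Longrightarrow> \<exists>c\<in>carrier G. g = c [^] p"
  shows "d dvd 1"
proof (rule ccontr)
  assume nd: "\<not> d dvd 1"
  note Uc = U_carrier
  obtain e0 where e0: "e0 \<in># U" "e0 [^] (p ^ (s2 - 1)) \<noteq> \<one>"
    using long_atom_pow_one exact by blast
  have d2: "d dvd int (p ^ s2) - 2"
  proof -
    have "ord e0 = p ^ s2" using ord_prime_power[OF p] e0 Uc exp by auto
    thus ?thesis using cong_ord[of e0] U_supp e0(1) by auto
  qed
  \<comment> \<open>Since \<open>s1\<close> divides \<open>s2\<close>, the geometric sum would make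
    \<open>p ^ s2\<close> congruent to 1, but it is congruent to 2.\<close>
  have nd1: "\<not> d dvd int (p ^ s1) - 1"
  proof
    assume a: "d dvd int (p ^ s1) - 1"
    obtain t where t: "s2 = s1 * t" using s(2) by blast
    have "int (p ^ s2) - 1 = (int (p ^ s1) - 1) * (\<Sum>i<t. int (p ^ s1) ^ i)"
      unfolding t by (simp add: power_mult power_diff_1_eq)
    hence "d dvd int (p ^ s2) - 1" using a by simp
    hence "d dvd (int (p ^ s2) - 1) - (int (p ^ s2) - 2)" using d2 by (rule dvd_diff)
    thus False using nd by simp
  qed
  \<comment> \<open>A maximal independent set among the elements of full order; it captures the
    \<open>p ^ (s2 - 1)\<close>-th powers of all elements of \<open>U\<close>.\<close>
  obtain E where E: "E \<subseteq> set_mset U" "indep 1 E \<and> (\<forall>e\<in>E. ord e = p ^ s2)"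
    and E_max: "\<And>x. x \<in># U \<Longrightarrow> indep 1 (insert x E) \<and> (\<forall>e\<in>insert x E. ord e = p ^ s2) \<Longrightarrow> x \<in> E"
    using maximal_subset_exists[of "set_mset U" "\<lambda>E. indep 1 E \<and> (\<forall>e\<in>E. ord e = p ^ s2)"] indep_empty by auto
  have Ei: "indep 1 E" and Eo: "\<And>e. e \<in> E \<Longrightarrow> ord e = p ^ s2" using E(2) by auto
  note Ec = indep_carrier[OF Ei]
  have top: "x [^] (p ^ (s2 - 1)) \<in> spn E" if x: "x \<in># U" for x
  proof (rule ccontr)
    assume n: "x [^] (p ^ (s2 - 1)) \<notin> spn E"
    have xc: "x \<in> carrier G" using x Uc by auto
    have ox: "ord x = p ^ s2" using ord_prime_power[OF p xc exp[OF xc]] n spn_one by metis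
    have "indep 1 (insert x E)"
      by (rule indep_insert_full[OF Ei xc], rule prime_power_min_index[OF p xc Ec _ n]) (use exp xc spn_one ox in auto)
    hence "x \<in> E" using E_max[OF x] ox Eo by auto
    thus False using n spn_pow[OF Ec spn_incl] Ec by blast
  qed
  have E0: "E \<noteq> {}" using top[OF e0(1)] e0(2) by (auto simp: spn_empty)
  have decomp: "\<exists>a\<in>spn E. \<exists>b\<in>carrier G. \<exists>c\<in>carrier G. x = a \<otimes> b \<otimes> c [^] p \<and> b [^] (p ^ s1) = \<one>"
    if x: "x \<in> carrier G" for x
  proof -
    have y: "x [^] (p ^ (s2 - 1)) \<in> spn E" using long_atom_pow[OF Ec top x] .
    have "(x [^] (p ^ (s2 - 1))) [^] p = x [^] (p ^ s2)"
      using x s(3) by (simp add: nat_pow_pow power_eq_if mult.commute)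
    hence "(x [^] (p ^ (s2 - 1))) [^] p = \<one>" using exp[OF x] by simp
    then obtain z where z: "z \<in> spn E" "x [^] (p ^ (s2 - 1)) = z [^] (p ^ (s2 - 1))"
      using spn_root[OF p Ei _ s(3) y] Eo by auto
    have zc: "z \<in> carrier G" using z(1) spn_closed[OF Ec] by auto
    have "(x \<otimes> inv z) [^] (p ^ (s2 - 1)) = \<one>" using x zc z(2) by (simp add: nat_pow_distrib nat_pow_inv)
    then obtain b c where bc: "b \<in> carrier G" "c \<in> carrier G" "x \<otimes> inv z = b \<otimes> c [^] p" "b [^] (p ^ s1) = \<one>"
      using upper[of "x \<otimes> inv z"] x zc by auto
    have "x = z \<otimes> (x \<otimes> inv z)" using x zc by (metis m_lcomm r_inv r_one inv_closed)
    hence "x = z \<otimes> b \<otimes> c [^] p" using bc zc by (simp add: m_assoc)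
    thus ?thesis using z(1) bc by blast
  qed
  \<comment> \<open>The elements sent into the span by \<open>p ^ s1\<close> are closed under
    products and cover \<open>G\<close> up to \<open>p\<close>-th powers, hence are
    everything.\<close>
  have mid: "x [^] (p ^ s1) \<in> spn E" if "x \<in> carrier G" for x
  proof -
    let ?M = "{x \<in> carrier G. x [^] (p ^ s1) \<in> spn E}"
    have "x \<in> ?M"
    proof (rule Frattini_argument[of ?M p s2])
      fix y assume "y \<in> carrier G"
      then obtain a b c where abc: "a \<in> spn E" "b \<in> carrier G" "c \<in> carrier G" "y = a \<otimes> b \<otimes> c [^] p" "b [^] (p ^ s1) = \<one>"
        using decomp by blast
      have "a \<in> carrier G" using abc(1) spn_closed[OF Ec] by auto
      hence "a \<otimes> b \<in> ?M" using abc spn_pow[OF Ec] by (simp add: nat_pow_distrib)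
      thus "\<exists>m\<in>?M. \<exists>c\<in>carrier G. y = m \<otimes> c [^] p" using abc by blast
    qed (use that exp spn_one spn_mult[OF Ec] in \<open>auto simp: nat_pow_distrib\<close>)
    thus ?thesis by simp
  qed
  \<comment> \<open>If the first alternative fails, the index of \<open>x\<close> over
    \<open>E\<close> is exactly \<open>p ^ s1\<close>. As this is not 1 modulo \<open>d\<close>, the
    power is trivial.\<close>
  have low: "x [^] (p ^ (s1 - 1)) \<in> spn E \<or> x [^] (p ^ s1) = \<one>" if x: "x \<in># U" for x
  proof (cases "x [^] (p ^ (s1 - 1)) \<in> spn E")
    case False
    have xc: "x \<in> carrier G" "x \<in> Supp" using x Uc U_supp by auto
    have "d dvd 1 \<or> (x [^] (p ^ s1) = \<one> \<and> d dvd int (p ^ s1) - 2) \<or>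
      (x [^] (p ^ s1) \<noteq> \<one> \<and> d dvd int (p ^ s1) - 1 \<and> ((\<exists>e\<in>E. x [^] (p ^ s1) \<in> spn {e}) \<or> x [^] (2 * p ^ s1) = \<one>))"
      by (rule index_cases[OF Ei _ xc(2)])
        (use E(1) U_supp p mid[OF xc(1)] prime_power_min_index[OF p xc(1) Ec mid[OF xc(1)] False] in
          \<open>auto simp: prime_gt_0_nat\<close>)
    thus ?thesis using nd nd1 by blast
  qed simp
  obtain F where F: "F \<subseteq> set_mset U" "indep 1 (E \<union> F) \<and> (\<forall>e\<in>F. ord e = p ^ s1)"
    and F_max: "\<And>x. x \<in># U \<Longrightarrow> indep 1 (E \<union> insert x F) \<and> (\<forall>e\<in>insert x F. ord e = p ^ s1) \<Longrightarrow> x \<in> F"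
    using maximal_subset_exists[of "set_mset U" "\<lambda>F. indep 1 (E \<union> F) \<and> (\<forall>e\<in>F. ord e = p ^ s1)"] Ei by auto
  define A where "A = E \<union> F"
  have Ai: "indep 1 A" using F(2) by (simp add: A_def)
  note Ac = indep_carrier[OF Ai]
  have AU: "A \<subseteq> set_mset U" using E(1) F(1) by (simp add: A_def)
  have EA: "spn E \<subseteq> spn A" by (rule spn_mono) (simp add: A_def)
  have "p ^ s1 dvd p ^ s2" using s(2,3) by (intro le_imp_power_dvd dvd_imp_le)
  hence Ao: "p ^ s1 dvd ord e" if "e \<in> A" for e
    using that Eo F(2) unfolding A_def by auto
  have bot: "x [^] (p ^ (s1 - 1)) \<in> spn A" if x: "x \<in># U" for x
  proof (rule ccontr)
    assume n: "x [^] (p ^ (s1 - 1)) \<notin> spn A"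
    have xc: "x \<in> carrier G" using x Uc by auto
    have one: "x [^] (p ^ s1) = \<one>" using low[OF x] n EA by auto
    have ox: "ord x = p ^ s1" using ord_prime_power[OF p xc one] n spn_one by metis
    have "indep 1 (insert x A)"
      by (rule indep_insert_full[OF Ai xc], rule prime_power_min_index[OF p xc Ac _ n]) (use one spn_one ox in auto)
    hence "x \<in> F" using F_max[OF x] ox F(2) by (auto simp: A_def)
    hence "x \<in> A" by (simp add: A_def)
    thus False using n spn_pow[OF Ac spn_incl] Ac by blast
  qed
  \<comment> \<open>With the lower layer added, the part \<open>b\<close> of the decomposition can
    also be expressed up to \<open>p\<close>-th powers, so \<open>A\<close> generates
    \<open>G\<close>.\<close>
  have all: "x \<in> spn A" if "x \<in> carrier G" for x
  proof (rule Frattini_argument[of "spn A" p s2])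
    fix y assume "y \<in> carrier G"
    then obtain a b c where abc: "a \<in> spn E" "b \<in> carrier G" "c \<in> carrier G" "y = a \<otimes> b \<otimes> c [^] p" "b [^] (p ^ s1) = \<one>"
      using decomp by blast
    have ac: "a \<in> carrier G" using abc(1) spn_closed[OF Ec] by auto
    have w: "b [^] (p ^ (s1 - 1)) \<in> spn A" using long_atom_pow[OF Ac bot abc(2)] .
    have "(b [^] (p ^ (s1 - 1))) [^] p = b [^] (p ^ s1)"
      using abc s(1) by (simp add: nat_pow_pow power_eq_if mult.commute)
    then obtain z where z: "z \<in> spn A" "b [^] (p ^ (s1 - 1)) = z [^] (p ^ (s1 - 1))"
      using spn_root[OF p Ai Ao s(1) w] abc(5) by auto
    have zc: "z \<in> carrier G" using z(1) spn_closed[OF Ac] by auto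
    have "(b \<otimes> inv z) [^] (p ^ (s1 - 1)) = \<one>" using abc zc z(2) by (simp add: nat_pow_distrib nat_pow_inv)
    then obtain c' where c': "c' \<in> carrier G" "b \<otimes> inv z = c' [^] p" using lower[of "b \<otimes> inv z"] abc zc by auto
    have "b = z \<otimes> (b \<otimes> inv z)" using abc zc by (metis m_lcomm r_inv r_one inv_closed)
    hence "y = a \<otimes> (z \<otimes> c' [^] p) \<otimes> c [^] p" using c' abc by simp
    also have "\<dots> = (a \<otimes> z) \<otimes> (c' \<otimes> c) [^] p" using ac zc c' abc by (simp add: m_assoc nat_pow_distrib)
    finally show "\<exists>m\<in>spn A. \<exists>c\<in>carrier G. y = m \<otimes> c [^] p"
      using spn_mult[OF Ac _ z(1)] abc(1,3) EA c'(1) by blast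
  qed (use that exp spn_one spn_mult[OF Ac] spn_closed[OF Ac] in auto)
  obtain e where e: "e \<in> E" using E0 by blast
  show False
  proof (rule cover_impossible[OF indep_double[OF Ai]])
    show "e \<in> A" "e \<in># U" "3 \<le> ord e" using e E(1) Eo s(4) by (auto simp: A_def)
    fix x assume x: "x \<in># U"
    have xc: "x \<in> carrier G" "x \<in> Supp" "x \<noteq> \<one>" using x Uc U_supp Supp_one by auto
    \<comment> \<open>Over a generating set every index is 1, which leaves a multiple of one basis
      element or an involution.\<close>
    have "d dvd 1 \<or> (x [^] (1::nat) = \<one> \<and> d dvd int 1 - 2) \<or>
      (x [^] (1::nat) \<noteq> \<one> \<and> d dvd int 1 - 1 \<and> ((\<exists>e\<in>A. x [^] (1::nat) \<in> spn {e}) \<or> x [^] (2 * 1 :: nat) = \<one>))"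
      by (rule index_cases[OF Ai _ xc(2)]) (use AU U_supp all xc in auto)
    thus "(\<exists>a\<in>A. x \<in> spn {a}) \<or> x [^] (2::nat) = \<one>" using nd xc by auto
  qed
qed

text \<open>Otherwise \<open>U\<close> splits into a part killed by \<open>p\<close> and a part
  killed by \<open>q\<close>. Their sums are negatives of each other, so they are killed by both
  primes and vanish; one part is then all of \<open>U\<close>, which cannot generate
  \<open>G\<close>.\<close>

lemma full_order_exists:
  fixes p q :: nat
  assumes pq: "Factorial_Ring.prime p" "Factorial_Ring.prime q" "p \<noteq> q"
    and exp: "\<And>g. g \<in> carrier G \<Longrightarrow> g [^] (p * q) = \<one>"
    and ex: "\<exists>g\<in>carrier G. g [^] p \<noteq> \<one>" "\<exists>g\<in>carrier G. g [^] q \<noteq> \<one>"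
  obtains x where "x \<in># U" "ord x = p * q"
proof (rule ccontr)
  assume "\<not> thesis"
  hence no: "\<And>x. x \<in># U \<Longrightarrow> ord x \<noteq> p * q" using that by blast
  have cop: "coprime p q" using pq by (simp add: primes_coprime)
  have or: "x [^] p = \<one> \<or> x [^] q = \<one>" if x: "x \<in># U" for x
  proof -
    have xc: "x \<in> carrier G" using x U_carrier by auto
    hence "ord x dvd p * q" using exp by (simp add: pow_eq_id)
    then obtain a b where ab: "ord x = a * b" "a dvd p" "b dvd q" using division_decomp by blast
    hence "(a = 1 \<or> a = p) \<and> (b = 1 \<or> b = q)" using pq by (auto simp: prime_nat_iff)
    thus ?thesis using ab(1) no[OF x] xc by (auto simp: pow_eq_id)
  qed
  define V where "V = filter_mset (\<lambda>x. x [^] p = \<one>) U"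
  define W where "W = filter_mset (\<lambda>x. x [^] p \<noteq> \<one>) U"
  have VW: "U = V + W" unfolding V_def W_def by simp
  have c: "set_mset V \<subseteq> carrier G" "set_mset W \<subseteq> carrier G" using U_carrier by (auto simp: V_def W_def)
  have pw: "\<sigma> Y [^] n = \<one>" if "set_mset Y \<subseteq> carrier G" "\<And>x. x \<in># Y \<Longrightarrow> x [^] (n::nat) = \<one>" for Y n
    using that by (induction Y) (auto simp: nat_pow_distrib)
  have "\<sigma> V [^] p = \<one>" by (rule pw[OF c(1)]) (auto simp: V_def)
  moreover have "\<sigma> V [^] q = \<one>"
  proof -
    have "\<sigma> W [^] q = \<one>" by (rule pw[OF c(2)]) (use or in \<open>auto simp: W_def\<close>)
    moreover have "\<sigma> V \<otimes> \<sigma> W = \<one>" using atomD(2)[OF U_atom] c unfolding VW by simp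
    hence "\<sigma> V = inv (\<sigma> W)" using c by (metis inv_equality seq_sum_closed)
    ultimately show ?thesis using c by (simp add: nat_pow_inv)
  qed
  ultimately have "ord (\<sigma> V) dvd p" "ord (\<sigma> V) dvd q" using c by (auto simp: pow_eq_id)
  hence "ord (\<sigma> V) = 1" using cop by (metis coprime_common_divisor_nat)
  hence "\<sigma> V = \<one>" using c ord_eq_1[of "\<sigma> V"] by simp
  hence "V = {#} \<or> V = U" using atomD(4)[OF U_atom, of V] VW by auto
  thus False
  proof
    assume "V = {#}"
    hence "x \<notin># V" for x by simp
    hence "x [^] q = \<one>" if "x \<in># U" for x using or[OF that] that by (auto simp: V_def)
    thus False using long_atom_pow_one ex by blast
  next
    assume "V = U"
    hence "x \<in># V" if "x \<in># U" for x using that by simp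
    hence "x [^] p = \<one>" if "x \<in># U" for x using that by (simp add: V_def)
    thus False using long_atom_pow_one ex by blast
  qed
qed

text \<open>An index equal to one of the primes is 1 or 2 modulo \<open>d\<close>; since
  \<open>p * q\<close> is congruent to 2, the other prime is then 2 or 1, and \<open>d\<close>
  divides both arguments of the gcd. Cancelling a factor 2 on the way needs \<open>d\<close>
  odd.\<close>

lemma coprime_two_prime_case:
  fixes p q :: nat
  assumes pq: "Factorial_Ring.prime p" "Factorial_Ring.prime q" "p \<noteq> q"
    and exp: "\<And>g. g \<in> carrier G \<Longrightarrow> g [^] (p * q) = \<one>"
    and e0: "e0 \<in># U" "ord e0 = p * q"
    and gcd: "gcd (int (p * q) - 2) (int p + int q - 3) = 1"
  shows "d dvd 1"
proof (rule ccontr)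
  assume nd: "\<not> d dvd 1"
  have d2: "d dvd int (p * q) - 2" using cong_ord[of e0] e0 U_supp by auto
  have no: "\<not> d dvd int p + int q - 3" using nd gcd d2 by (metis gcd_greatest)
  \<comment> \<open>If one prime were 2, both arguments of the gcd would be even.\<close>
  have "odd p \<and> odd q"
  proof (rule ccontr)
    assume "\<not> (odd p \<and> odd q)"
    hence "(p = 2 \<and> odd q) \<or> (q = 2 \<and> odd p)"
      using pq by (metis primes_dvd_imp_eq two_is_prime_nat)
    hence "2 dvd int (p * q) - 2" "2 dvd int p + int q - 3" by auto
    hence "2 dvd gcd (int (p * q) - 2) (int p + int q - 3)" by (rule gcd_greatest)
    thus False unfolding gcd by simp
  qed
  hence "odd (int (p * q) - 2)" by simp
  hence dodd: "coprime d 2" using d2 by (metis coprime_commute coprime_left_2_iff_odd dvd_trans even_iff_mod_2_eq_zero)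
  have key: "\<not> d dvd int a - 2 \<and> \<not> d dvd int a - 1" if "a * b = p * q" "a + b = p + q" for a b
  proof (intro conjI notI)
    have ab: "int a * int b = int (p * q)" "int a + int b = int p + int q" using that by (metis of_nat_mult, metis of_nat_add)
    assume a: "d dvd int a - 2"
    have "(int (p * q) - 2) - int b * (int a - 2) = (int b - 1) * 2" using ab by (simp add: algebra_simps)
    hence "d dvd (int b - 1) * 2" using a d2 by (metis dvd_diff dvd_mult)
    hence "d dvd int b - 1" using dodd by (metis coprime_dvd_mult_left_iff)
    with a have "d dvd (int a - 2) + (int b - 1)" by (rule dvd_add)
    thus False using no ab(2) by (simp add: algebra_simps)
  next
    have ab: "int a * int b = int (p * q)" "int a + int b = int p + int q" using that by (metis of_nat_mult, metis of_nat_add)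
    assume a: "d dvd int a - 1"
    have "(int (p * q) - 2) - int b * (int a - 1) = int b - 2" using ab by (simp add: algebra_simps)
    hence "d dvd int b - 2" using a d2 by (metis dvd_diff dvd_mult)
    with a have "d dvd (int a - 1) + (int b - 2)" by (rule dvd_add)
    thus False using no ab(2) by (simp add: algebra_simps)
  qed
  obtain E where E: "E \<subseteq> set_mset U" "indep 1 E \<and> (\<forall>e\<in>E. ord e = p * q)"
    and E_max: "\<And>x. x \<in># U \<Longrightarrow> indep 1 (insert x E) \<and> (\<forall>e\<in>insert x E. ord e = p * q) \<Longrightarrow> x \<in> E"
    using maximal_subset_exists[of "set_mset U" "\<lambda>E. indep 1 E \<and> (\<forall>e\<in>E. ord e = p * q)"] indep_empty by auto
  have Ei: "indep 1 E" using E(2) by simp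
  note Ec = indep_carrier[OF Ei]
  have "\<exists>e. e \<in> E"
  proof (rule ccontr)
    assume "\<nexists>e. e \<in> E"
    hence "E = {}" by auto
    thus False using E_max[OF e0(1)] e0 indep_single U_carrier by auto
  qed
  then obtain e where e: "e \<in> E" by blast
  show False
  proof (rule cover_impossible[OF indep_double[OF Ei] e])
    show "e \<in># U" using e E(1) by auto
    have "2 \<le> p" "2 \<le> q" using pq(1,2) prime_ge_2_nat by auto
    hence "2 * 2 \<le> p * q" by (rule mult_le_mono)
    thus "3 \<le> ord e" using e E(2) by simp
    fix x assume x: "x \<in># U"
    have xc: "x \<in> carrier G" "x \<in> Supp" "x \<noteq> \<one>" using x U_carrier U_supp Supp_one by auto
    obtain k where k: "0 < k" "x [^] k \<in> spn E" "\<And>j. 0 < j \<Longrightarrow> j < k \<Longrightarrow> x [^] (j::nat) \<notin> spn E"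
      using min_index[OF xc(1)] by blast
    have dvd: "k dvd n" if "x [^] n \<in> spn E" for n using min_index_dvd[OF xc(1) Ec k(1,2)] k(3) that by blast
    have cases: "d dvd 1 \<or> (x [^] k = \<one> \<and> d dvd int k - 2) \<or>
      (x [^] k \<noteq> \<one> \<and> d dvd int k - 1 \<and> ((\<exists>e\<in>E. x [^] k \<in> spn {e}) \<or> x [^] (2 * k) = \<one>))"
      by (rule index_cases[OF Ei _ xc(2) k]) (use E(1) U_supp in auto)
    have "k dvd p * q" using dvd exp[OF xc(1)] spn_one by simp
    then obtain a b where ab: "k = a * b" "a dvd p" "b dvd q" using division_decomp by blast
    hence "(a = 1 \<or> a = p) \<and> (b = 1 \<or> b = q)" using pq by (auto simp: prime_nat_iff)
    hence "k = 1 \<or> k = p \<or> k = q \<or> k = p * q" using ab(1) by auto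
    hence "k = 1"
    proof (elim disjE)
      \<comment> \<open>Full index means full order and independence of \<open>E\<close>, so
        maximality puts \<open>x\<close> into \<open>E\<close>, where the index is 1.\<close>
      assume "k = p * q"
      moreover have "k dvd ord x" using dvd spn_one xc by simp
      moreover have "ord x dvd p * q" using exp xc by (simp add: pow_eq_id)
      ultimately have ox: "ord x = p * q" "ord x = k" by auto
      hence "indep 1 (insert x E)" using indep_insert_full[OF Ei xc(1)] k(3) by blast
      hence "x \<in> E" using E_max[OF x] ox E(2) by auto
      hence "x [^] (1::nat) \<in> spn E" using xc Ec by (simp add: spn_incl)
      thus "k = 1" using dvd[of 1] by simp
    qed (use cases key[of p q] key[of q p] nd in \<open>auto simp: mult.commute add.commute\<close>)
    thus "(\<exists>a\<in>E. x \<in> spn {a}) \<or> x [^] (2::nat) = \<one>" using cases nd xc by auto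
  qed
qed

text \<open>Twice an element of order \<open>2 * p\<close> has order \<open>p\<close> and lies in
  the group generated by \<open>e\<close>, so its index over \<open>e\<close> is 1 or 2; index 2
  would require 2 to be congruent to 1. Elements of order \<open>p\<close> do not occur, and those
  of order 2 are harmless.\<close>

lemma rank_one_case:
  fixes p :: nat
  assumes p: "Factorial_Ring.prime p" "p \<noteq> 2"
    and exp: "\<And>g. g \<in> carrier G \<Longrightarrow> g [^] (2 * p) = \<one>"
    and e: "e \<in># U" "ord e = 2 * p"
    and rank: "\<And>x y. x \<in> carrier G \<Longrightarrow> y \<in> carrier G \<Longrightarrow> ord x = p \<Longrightarrow> ord y = p \<Longrightarrow> y \<in> spn {x}"
  shows "d dvd 1"
proof (rule ccontr)
  assume nd: "\<not> d dvd 1"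
  have podd: "odd p" using p by (metis primes_dvd_imp_eq two_is_prime_nat)
  have ec: "e \<in> carrier G" "e \<in> Supp" "{e} \<subseteq> carrier G" using e U_carrier U_supp by auto
  have d2: "d dvd int (2 * p) - 2" using cong_ord[OF ec(2)] e(2) by simp
  have sq: "ord (x [^] (2::nat)) = p" if "x \<in> carrier G" "ord x = 2 * p" for x
    using ord_pow[of x 2] that by auto
  show False
  proof (rule cover_impossible[OF indep_double[OF indep_single[OF ec(1)]] _ e(1)])
    show "3 \<le> ord e" using e(2) prime_ge_2_nat[OF p(1)] by simp
    fix x assume x: "x \<in># U"
    have xc: "x \<in> carrier G" "x \<in> Supp" "x \<noteq> \<one>" using x U_carrier U_supp Supp_one by auto
    hence "ord x dvd 2 * p" using exp by (simp add: pow_eq_id)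
    then obtain a b where ab: "ord x = a * b" "a dvd 2" "b dvd p" using division_decomp by blast
    hence "(a = 1 \<or> a = 2) \<and> (b = 1 \<or> b = p)" using p two_is_prime_nat by (auto simp: prime_nat_iff)
    hence "ord x = 1 \<or> ord x = 2 \<or> ord x = p \<or> ord x = 2 * p" using ab(1) by auto
    thus "(\<exists>a\<in>{e}. x \<in> spn {a}) \<or> x [^] (2::nat) = \<one>"
    proof (elim disjE)
      assume "ord x = 1" thus ?thesis using xc ord_eq_1[of x] by simp
    next
      assume "ord x = 2" thus ?thesis using xc by (simp add: pow_eq_id)
    next
      assume "ord x = p"
      hence a: "d dvd int p - 2" using cong_ord[OF xc(2)] by simp
      hence "d dvd (int (2 * p) - 2) - 2 * (int p - 2)" using d2 by (metis dvd_diff dvd_mult)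
      hence b: "d dvd 2" by simp
      \<comment> \<open>\<open>d\<close> divides 2 and the odd number \<open>p - 2\<close>, hence
        1.\<close>
      obtain m where "p = 2 * m + 1" using podd by (rule oddE)
      hence "(int p - 2) - 2 * (int m - 1) = 1" by simp
      thus ?thesis using nd a b by (metis dvd_diff dvd_mult2)
    next
      assume ox: "ord x = 2 * p"
      have "x [^] (2::nat) \<in> spn {e [^] (2::nat)}" using rank sq ox e(2) xc(1) ec(1) by simp
      hence x2: "x [^] (2::nat) \<in> spn {e}"
        using spn_minimal[of "{e [^] (2::nat)}" "{e}"] ec spn_pow[OF ec(3) spn_incl[of e "{e}"]] by auto
      show ?thesis
      proof (cases "x \<in> spn {e}")
        case False
        have min: "x [^] j \<notin> spn {e}" if "0 < j" "j < 2" for j :: nat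
        proof -
          have "j = 1" using that by simp
          thus ?thesis using False xc by simp
        qed
        have x21: "x [^] (2::nat) \<noteq> \<one>" using ox prime_ge_2_nat[OF p(1)] xc by (auto simp: pow_eq_id dest: dvd_imp_le)
        have "d dvd 1 \<or> (x [^] (2::nat) = \<one> \<and> d dvd int 2 - 2) \<or>
          (x [^] (2::nat) \<noteq> \<one> \<and> d dvd int 2 - 1 \<and> ((\<exists>e\<in>{e}. x [^] (2::nat) \<in> spn {e}) \<or> x [^] (2 * 2 :: nat) = \<one>))"
          by (rule index_cases[OF indep_single[OF ec(1)] _ xc(2) _ x2 min]) (use ec in auto)
        thus ?thesis using nd x21 by simp
      qed simp
    qed
  qed simp
qed

end

section \<open>Even differences over groups of exponent twice a prime\<close>

text \<open>\<open>g\<close> will be the inverse of an element of \<open>U\<close> that is compared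
  with basis elements of order \<open>2 * p\<close>.\<close>

locale even_length_congruence = length_congruence +
  fixes p :: nat and g
  assumes p_prime: "Factorial_Ring.prime p" and p_odd: "odd p" and d_even: "2 dvd d"
    and g_supp: "g \<in> Supp"
begin

text \<open>\<open>R\<close> holds coefficients of the squares of basis elements. These have order
  \<open>p\<close>, whence the bound, and \<open>R\<close> represents an element only up to an
  involution.\<close>

definition config :: "'a set \<Rightarrow> 'a multiset \<Rightarrow> bool" where
  "config B R \<longleftrightarrow> indep 2 B \<and> B \<subseteq> Supp \<and> (\<forall>b\<in>B. ord b = 2 * p) \<and> set_mset R \<subseteq> B \<and> (\<forall>b. count R b < p)"

text \<open>The sign change on the level of squares: the complement is taken to \<open>p\<close>,
  not to the order \<open>2 * p\<close>, so the sum changes by the involution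
  \<open>b [^] p\<close>.\<close>

definition flip_half :: "'a \<Rightarrow> 'a multiset \<Rightarrow> 'a multiset" where
  "flip_half b R = filter_mset (\<lambda>x. x \<noteq> b) R + replicate_mset (p - count R b) (inv b)"

lemma p_pos: "0 < p"
  using p_prime by (simp add: prime_gt_0_nat)

lemma g_carrier: "g \<in> carrier G"
  using g_supp Supp_carrier by auto

lemma configD:
  assumes "config B R"
  shows "indep 2 B" "B \<subseteq> Supp" "B \<subseteq> carrier G" "set_mset R \<subseteq> B" "set_mset R \<subseteq> carrier G"
    "\<And>b. b \<in> B \<Longrightarrow> ord b = 2 * p" "\<And>b. count R b < p"
  using assms Supp_carrier unfolding config_def by auto

lemma half_order:
  assumes "b \<in> carrier G" "ord b = 2 * p"
  shows "b [^] p \<noteq> \<one>" "b [^] p \<otimes> b [^] p = \<one>" "inv b [^] p = b [^] p"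
proof -
  show "b [^] p \<noteq> \<one>" using assms p_pos by (auto simp: pow_eq_id dest: dvd_imp_le)
  have "b [^] (p + p) = \<one>" using assms by (simp add: pow_eq_id mult_2)
  thus *: "b [^] p \<otimes> b [^] p = \<one>" using assms(1) by (simp add: nat_pow_mult)
  show "inv b [^] p = b [^] p" using assms(1) * by (metis inv_equality nat_pow_closed nat_pow_inv)
qed

lemma dvd_count:
  assumes "config B R" "set_mset Z \<subseteq> B" "\<sigma> Z = \<one>"
  shows "p dvd count Z b"
proof (cases "b \<in> B")
  case True
  hence b: "b \<in> carrier G" "ord b = 2 * p" using configD[OF assms(1)] by auto
  have "b [^] (2 * count Z b) = \<one>"
    by (rule indepD[OF configD(1)[OF assms(1)] assms(2) _ True]) (simp add: assms(3))
  hence "2 * p dvd 2 * count Z b" using b by (simp add: pow_eq_id)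
  thus ?thesis by simp
next
  case False
  hence "count Z b = 0" using assms(2) by (meson not_in_iff subsetD)
  thus ?thesis by simp
qed

text \<open>Multiplicities in a zero-sum sequence over \<open>B\<close> are divisible by
  \<open>p\<close>, so below \<open>2 * p\<close> they are 0 or \<open>p\<close>. Only
  \<open>b\<close> and \<open>c\<close> can reach \<open>p\<close>; they contribute involutions, and
  distinct involutions do not cancel.\<close>

lemma zero_sum_free:
  assumes "config B R" "set_mset Z \<subseteq> B" "\<sigma> Z = \<one>" "b \<in> B" "c \<in> B" "b = c \<or> b [^] p \<noteq> c [^] p"
    and small: "\<And>x. x \<noteq> b \<Longrightarrow> x \<noteq> c \<Longrightarrow> count Z x < p" "\<And>x. count Z x < 2 * p"
  shows "Z = {#}"
proof -
  note D = configD[OF assms(1)]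
  have cnt: "count Z x = 0 \<or> count Z x = p" for x
  proof -
    obtain q where q: "count Z x = p * q" using dvd_count[OF assms(1-3)] by blast
    hence "q < 2" using small(2)[of x] p_pos by (simp add: mult.commute)
    thus ?thesis using q by (auto simp: less_2_cases_iff)
  qed
  have zero: "count Z x = 0" if "x \<noteq> b" "x \<noteq> c" for x using cnt[of x] small(1)[OF that] by auto
  have bc: "b \<in> carrier G" "c \<in> carrier G" "ord b = 2 * p" "ord c = 2 * p" using assms(4,5) D(3,6) by auto
  note hb = half_order[OF bc(1,3)] and hc = half_order[OF bc(2,4)]
  have r: "set_mset (replicate_mset n b) \<subseteq> carrier G" "set_mset (replicate_mset n c) \<subseteq> carrier G" for n
    using bc by auto
  show ?thesis
  proof (cases "b = c")
    case True
    have Z: "Z = replicate_mset (count Z b) b" by (rule multiset_eqI) (use zero True in auto)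
    hence "b [^] count Z b = \<one>" using assms(3) bc by (metis seq_sum_replicate)
    hence "count Z b = 0" using cnt[of b] hb(1) by auto
    thus ?thesis using Z by simp
  next
    case False
    have Z: "Z = replicate_mset (count Z b) b + replicate_mset (count Z c) c"
      by (rule multiset_eqI) (use zero False in auto)
    have eq: "b [^] count Z b \<otimes> c [^] count Z c = \<one>"
      using assms(3) bc r by (subst (asm) Z) simp
    have "b [^] p \<otimes> c [^] p \<noteq> \<one>"
      using assms(6) False hc(2) bc by (metis nat_pow_closed r_cancel)
    hence "count Z b = 0 \<and> count Z c = 0" using cnt[of b] cnt[of c] eq hb(1) hc(1) bc by auto
    thus ?thesis using Z by simp
  qed
qed

lemma inv_not_in_config:
  assumes "config B R" "b \<in> B"
  shows "inv b \<notin> B"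
proof
  assume i: "inv b \<in> B"
  note D = configD[OF assms(1)]
  have b: "b \<in> carrier G" "ord b = 2 * p" using assms(2) D by auto
  have "b \<noteq> inv b"
  proof
    assume "b = inv b"
    hence "b [^] (2::nat) = \<one>" using b by (metis l_inv nat_pow_Suc nat_pow_eone numeral_2_eq_2 One_nat_def)
    hence "2 * p dvd 2" using b by (simp add: pow_eq_id)
    hence "p dvd 1" by simp
    thus False using p_prime by simp
  qed
  hence "count {#b, inv b#} b = 1" by simp
  moreover have "p dvd count {#b, inv b#} b" by (rule dvd_count[OF assms(1)]) (use b assms(2) i in auto)
  ultimately show False using p_prime by simp
qed

text \<open>The size identity makes repeated flips terminate: flipping a coefficient above
  \<open>p / 2\<close> shortens the multiset.\<close>

lemma flip_half_config:
  assumes "config B R" "b \<in># R"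
  defines "B' \<equiv> insert (inv b) (B - {b})"
  shows "config B' (flip_half b R)" "\<sigma> (flip_half b R) = \<sigma> R \<otimes> b [^] p"
    "count (flip_half b R) (inv b) = p - count R b"
    "set_mset (flip_half b R) = insert (inv b) (set_mset R - {b})"
    "\<And>x. x \<noteq> b \<Longrightarrow> x \<in> B \<Longrightarrow> count (flip_half b R) x = count R x"
    "card (set_mset (flip_half b R)) = card (set_mset R)"
    "inv b \<notin> B"
    "size (flip_half b R) + 2 * count R b = size R + p"
proof -
  note D = configD[OF assms(1)]
  have bB: "b \<in> B" using assms(2) D(4) by auto
  have b: "b \<in> carrier G" "ord b = 2 * p" "b \<in> Supp" using bB D by auto
  show ninv: "inv b \<notin> B" by (rule inv_not_in_config[OF assms(1) bB])
  define A where "A = filter_mset (\<lambda>x. x \<noteq> b) R"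
  have R: "R = A + replicate_mset (count R b) b" unfolding A_def by (rule mset_remove_all)
  have A: "set_mset A = set_mset R - {b}" "set_mset A \<subseteq> carrier G" using D(5) by (auto simp: A_def)
  have c: "0 < count R b" "count R b < p" using assms(2) D(7) by auto
  have invA: "count A (inv b) = 0" using ninv A(1) D(4) by (metis DiffD1 not_in_iff subsetD)
  show cnt: "count (flip_half b R) (inv b) = p - count R b"
    using invA unfolding flip_half_def A_def[symmetric] by simp
  show st: "set_mset (flip_half b R) = insert (inv b) (set_mset R - {b})"
    using c A(1) unfolding flip_half_def A_def[symmetric] by auto
  show other: "count (flip_half b R) x = count R x" if "x \<noteq> b" "x \<in> B" for x
    using that ninv unfolding flip_half_def by auto
  have rc: "set_mset (replicate_mset n b) \<subseteq> carrier G" "set_mset (replicate_mset n (inv b)) \<subseteq> carrier G" for n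
    using b by auto
  have "inv b [^] (p - count R b) = b [^] p \<otimes> b [^] count R b"
  proof -
    have "inv b [^] (p - count R b) = inv b [^] (ord b - (p + count R b))" using b(2) by simp
    also have "\<dots> = b [^] (p + count R b)" by (rule inv_pow_diff) (use b c in auto)
    finally show ?thesis using b(1) by (simp add: nat_pow_mult)
  qed
  moreover have "\<sigma> (flip_half b R) = \<sigma> A \<otimes> inv b [^] (p - count R b)"
    unfolding flip_half_def A_def[symmetric] using A(2) rc b(1) by simp
  moreover have "\<sigma> R = \<sigma> A \<otimes> b [^] count R b" using A(2) rc b(1) by (subst R) simp
  ultimately show "\<sigma> (flip_half b R) = \<sigma> R \<otimes> b [^] p" using A(2) b(1) by (simp add: m_ac)
  have "card (set_mset (flip_half b R)) = Suc (card (set_mset R - {b}))"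
    unfolding st using ninv D(4) by (subst card_insert_disjoint) auto
  thus "card (set_mset (flip_half b R)) = card (set_mset R)" using assms(2) by (metis card_Suc_Diff1 finite_set_mset)
  have "size R = size A + count R b" by (subst R) simp
  moreover have "size (flip_half b R) = size A + (p - count R b)"
    unfolding flip_half_def A_def[symmetric] by simp
  ultimately show "size (flip_half b R) + 2 * count R b = size R + p" using c by simp
  show "config B' (flip_half b R)" unfolding config_def
  proof (intro conjI)
    show "indep 2 B'" unfolding B'_def by (rule indep_flip[OF D(1) bB])
    show "B' \<subseteq> Supp" unfolding B'_def using D(2) Supp_inv b(3) by auto
    show "\<forall>x\<in>B'. ord x = 2 * p" unfolding B'_def using D(6) b by auto
    show "set_mset (flip_half b R) \<subseteq> B'" unfolding st B'_def using D(4) by auto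
    show "\<forall>x. count (flip_half b R) x < p"
    proof
      fix x
      show "count (flip_half b R) x < p"
      proof (cases "x = inv b")
        case True
        thus ?thesis using cnt c by simp
      next
        case False
        hence "count (flip_half b R) x \<le> count R x" unfolding flip_half_def by simp
        thus ?thesis using D(7) le_less_trans by blast
      qed
    qed
  qed
qed

lemma atom_simple:
  assumes "set_mset Y \<subseteq> carrier G" "\<sigma> Y \<otimes> g = \<one>" "\<And>Z. Z \<subseteq># Y \<Longrightarrow> \<sigma> Z = \<one> \<Longrightarrow> Z = {#}"
  shows "atom (add_mset g Y)"
proof (rule atomI)
  show "\<sigma> (add_mset g Y) = \<one>" using assms g_carrier by (simp add: m_comm)
  fix T assume T: "T \<subseteq># add_mset g Y" "\<sigma> T = \<one>"
  have "T \<subseteq># Y + {#g#}" using T(1) by simp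
  then obtain A C where AC: "T = A + C" "A \<subseteq># Y" "C \<subseteq># {#g#}" by (rule subseteq_union_split)
  have A: "set_mset A \<subseteq> carrier G" using set_mset_mono[OF AC(2)] assms(1) by auto
  show "T = {#} \<or> T = add_mset g Y"
  proof (rule disjE[OF subseteq_singletonD[OF AC(3)]])
    assume "C = {#}"
    thus ?thesis using AC T(2) assms(3)[of A] by simp
  next
    assume C: "C = {#g#}"
    hence "\<sigma> A \<otimes> g = \<one>" using T(2) AC(1) A g_carrier by (simp add: m_comm)
    hence "\<sigma> A = \<sigma> Y" using assms(1,2) A g_carrier by (metis r_cancel seq_sum_closed)
    moreover have "set_mset (Y - A) \<subseteq> carrier G" using assms(1) by (auto dest: in_diffD)
    ultimately have "\<sigma> (Y - A) = \<one>"
      using seq_sum_diff[OF assms(1) AC(2)] A by (metis l_cancel_one' seq_sum_closed)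
    hence "Y - A = {#}" using assms(3)[of "Y - A"] by simp
    hence "A = Y" using AC(2) by (metis Diff_eq_empty_iff_mset subset_mset.order_antisym)
    thus ?thesis using AC(1) C by simp
  qed
qed (use assms g_carrier in auto)

text \<open>A zero-sum part with exactly one \<open>g\<close> has a part over \<open>B\<close> whose
  double agrees with that of \<open>R\<close>. It is then \<open>R\<close> itself, contrary to the
  assumption that \<open>R\<close> and \<open>g\<close> do not cancel.\<close>

lemma atom_doubled:
  assumes "config B R" "(\<sigma> R \<otimes> g) \<otimes> (\<sigma> R \<otimes> g) = \<one>" "\<sigma> R \<otimes> g \<noteq> \<one>"
    and free: "\<And>Z. Z \<subseteq># R + R \<Longrightarrow> \<sigma> Z = \<one> \<Longrightarrow> Z = {#}"
  shows "atom (R + R + {#g, g#})"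
proof (rule atomI)
  note D = configD[OF assms(1)]
  show "set_mset (R + R + {#g, g#}) \<subseteq> carrier G" using D(5) g_carrier by auto
  have RR: "(\<sigma> R \<otimes> \<sigma> R) \<otimes> (g \<otimes> g) = \<one>" using assms(2) D(5) g_carrier by (simp add: m_ac)
  show "\<sigma> (R + R + {#g, g#}) = \<one>" using RR D(5) g_carrier by (simp add: m_ac)
  fix T assume T: "T \<subseteq># R + R + {#g, g#}" "\<sigma> T = \<one>"
  then obtain A C where AC: "T = A + C" "A \<subseteq># R + R" "C \<subseteq># {#g, g#}" using subseteq_union_split by blast
  have A: "set_mset A \<subseteq> carrier G" "set_mset A \<subseteq> B" using set_mset_mono[OF AC(2)] D(4,5) by auto
  have "C \<subseteq># replicate_mset 2 g" using AC(3) by (simp add: numeral_2_eq_2)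
  then obtain j where j: "j \<le> 2" "C = replicate_mset j g" by (rule subseteq_replicateD)
  consider "j = 0" | "j = 1" | "j = 2" using j(1) by linarith
  thus "T = {#} \<or> T = R + R + {#g, g#}"
  proof cases
    case 1
    thus ?thesis using AC j T(2) free[of A] by simp
  next
    case 2
    have eq: "\<sigma> A \<otimes> g = \<one>" using T(2) AC(1) j 2 A g_carrier by (simp add: m_comm)
    hence "(\<sigma> A \<otimes> \<sigma> A) \<otimes> (g \<otimes> g) = \<one>" using A g_carrier by (metis m_assoc m_comm l_one seq_sum_closed m_closed)
    hence sq: "\<sigma> A [^] (2::nat) = \<sigma> R [^] (2::nat)"
      using RR A D(5) g_carrier by (simp add: numeral_2_eq_2) (metis m_closed r_cancel seq_sum_closed)
    have "A = R"
    proof (rule multiset_eqI)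
      fix b
      show "count A b = count R b"
      proof (cases "b \<in> B")
        case True
        hence b: "b \<in> carrier G" "ord (b [^] (2::nat)) = p" using D(3,6) ord_pow[of b 2] p_pos by auto
        have eqc: "(b [^] (2::nat)) [^] count A b = (b [^] (2::nat)) [^] count R b"
          by (rule indep_eq[OF D(1) A(2) D(4) sq True])
        have Rb: "count R b < p" "count A b \<le> 2 * count R b"
          using D(7) mset_subset_eq_count[OF AC(2), of b] by auto
        have "(b [^] (2::nat)) [^] (count A b mod p) = (b [^] (2::nat)) [^] count R b"
          using eqc pow_mod_ord[of "b [^] (2::nat)" "count A b"] b by simp
        hence m: "count A b mod p = count R b"
          by (rule pow_inj[rotated]) (use b Rb p_pos in auto)
        \<comment> \<open>The value \<open>count R b + p\<close> is impossible for
          \<open>count A b\<close>: it exceeds the \<open>2 * count R b\<close> copies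
          available.\<close>
        moreover have "count A b mod p = (if count A b < p then count A b else count A b - p)"
          using Rb by (simp add: mod_if)
        ultimately show ?thesis using Rb by (simp split: if_splits)
      next
        case False
        thus ?thesis using A(2) D(4) by (metis not_in_iff subsetD)
      qed
    qed
    thus ?thesis using eq assms(3) by simp
  next
    case 3
    have "\<sigma> A \<otimes> (g \<otimes> g) = \<one>" using T(2) AC(1) j 3 A g_carrier by (simp add: numeral_2_eq_2 m_ac)
    hence eq: "\<sigma> A = \<sigma> (R + R)" using RR A D(5) g_carrier by (simp) (metis m_closed r_cancel seq_sum_closed)
    have RRc: "set_mset (R + R) \<subseteq> carrier G" using D(5) by simp
    note RRc = RRc subset_trans[OF set_mset_mono[OF diff_subset_eq_self[of "R + R" A]] RRc]
    have "\<sigma> (R + R - A) = \<one>"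
      using seq_sum_diff[OF RRc(1) AC(2)] eq A RRc by (metis l_cancel_one' seq_sum_closed)
    hence "R + R - A = {#}" using free[of "R + R - A"] by simp
    hence "A = R + R" using AC(2) by (metis Diff_eq_empty_iff_mset subset_mset.order_antisym)
    thus ?thesis using AC(1) j 3 by (simp add: numeral_2_eq_2)
  qed
qed simp

text \<open>On the doubled relation the half flip becomes a full one: \<open>2 * count R b\<close>
  copies of \<open>b\<close> turn into \<open>ord b - 2 * count R b\<close> copies of
  \<open>inv b\<close>. Both being atoms, the even number \<open>2 * count R b\<close> would be 1
  modulo the even \<open>d\<close>.\<close>

lemma doubled_flip_impossible:
  assumes R: "config B R" "b \<in># R" "(\<sigma> R \<otimes> g) \<otimes> (\<sigma> R \<otimes> g) = \<one>" "\<sigma> R \<otimes> g \<noteq> \<one>" "\<sigma> R \<otimes> b [^] p \<otimes> g \<noteq> \<one>"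
    and free: "\<And>Z. Z \<subseteq># R + R \<Longrightarrow> \<sigma> Z = \<one> \<Longrightarrow> Z = {#}"
    and free': "\<And>Z. Z \<subseteq># flip_half b R + flip_half b R \<Longrightarrow> \<sigma> Z = \<one> \<Longrightarrow> Z = {#}"
  shows False
proof -
  note D = configD[OF R(1)]
  note f = flip_half_config[OF R(1,2)]
  have b: "b \<in> carrier G" "ord b = 2 * p" "b \<in> Supp" using R(2) D by auto
  note h = half_order[OF b(1,2)]
  let ?A = "filter_mset (\<lambda>x. x \<noteq> b) (R + R) + {#g, g#}"
  have 1: "atom (R + R + {#g, g#})" by (rule atom_doubled[OF R(1,3,4) free])
  have 2: "atom (flip_half b R + flip_half b R + {#g, g#})"
  proof (rule atom_doubled[OF f(1) _ _ free'])
    have "(\<sigma> R \<otimes> b [^] p \<otimes> g) \<otimes> (\<sigma> R \<otimes> b [^] p \<otimes> g) = (\<sigma> R \<otimes> g) \<otimes> (\<sigma> R \<otimes> g) \<otimes> (b [^] p \<otimes> b [^] p)"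
      using D(5) b(1) g_carrier by (simp add: m_ac)
    thus "(\<sigma> (flip_half b R) \<otimes> g) \<otimes> (\<sigma> (flip_half b R) \<otimes> g) = \<one>" using f(2) R(3) h(2) by simp
    show "\<sigma> (flip_half b R) \<otimes> g \<noteq> \<one>" using f(2) R(5) by simp
  qed
  have c: "count R b < p" by (rule D(7))
  have eq: "R + R + {#g, g#} = ?A + replicate_mset (2 * count R b) b"
    by (rule multiset_eqI) auto
  have eq': "flip_half b R + flip_half b R + {#g, g#} = ?A + replicate_mset (ord b - 2 * count R b) (inv b)"
    unfolding flip_half_def by (rule multiset_eqI) (auto simp: b(2))
  have "d dvd int (2 * count R b) - 1"
  proof (rule cong_flip[of ?A _ b])
    show "atom (?A + replicate_mset (2 * count R b) b)" using 1 by (simp only: eq)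
    show "atom (?A + replicate_mset (ord b - 2 * count R b) (inv b))" using 2 by (simp only: eq')
  qed (use c b D(2,4) g_supp in auto)
  hence "2 dvd int (2 * count R b) - 1" using d_even by (rule dvd_trans[rotated])
  thus False by simp
qed

text \<open>When \<open>R\<close> and \<open>g\<close> cancel exactly, the full flip with complement
  to \<open>2 * p\<close> preserves the sum, and the coefficient is 1 modulo the even number
  \<open>d\<close>.\<close>

lemma odd_coefficient:
  assumes "config B R" "\<sigma> R \<otimes> g = \<one>" "b \<in># R"
  shows "odd (count R b)"
proof -
  note D = configD[OF assms(1)]
  have bB: "b \<in> B" using assms(3) D(4) by auto
  have b: "b \<in> carrier G" "ord b = 2 * p" "b \<in> Supp" using bB D by auto
  have c: "count R b < p" by (rule D(7))
  note f = flip_half_config[OF assms(1,3)]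
  define A where "A = filter_mset (\<lambda>x. x \<noteq> b) R"
  have RA: "R = A + replicate_mset (count R b) b" unfolding A_def by (rule mset_remove_all)
  have A: "set_mset A \<subseteq> B - {b}" "set_mset A \<subseteq> carrier G" using D(4,5) by (auto simp: A_def)
  let ?R = "A + replicate_mset (ord b - count R b) (inv b)"
  have "atom (add_mset g R)"
  proof (rule atom_simple[OF D(5) assms(2)])
    fix Z assume Z: "Z \<subseteq># R" "\<sigma> Z = \<one>"
    show "Z = {#}"
    proof (rule zero_sum_free[OF assms(1) _ Z(2) bB bB])
      show "set_mset Z \<subseteq> B" using set_mset_mono[OF Z(1)] D(4) by auto
      have "count Z x < p" for x using D(7)[of x] mset_subset_eq_count[OF Z(1), of x] by simp
      thus "count Z x < p" "count Z x < 2 * p" for x by (simp_all add: trans_less_add1 mult_2)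
    qed simp
  qed
  hence 1: "atom ((A + {#g#}) + replicate_mset (count R b) b)" using RA
    by (metis add_mset_add_single add.assoc add.commute)
  have "atom (add_mset g ?R)"
  proof (rule atom_simple)
    show Rc: "set_mset ?R \<subseteq> carrier G" using A b by auto
    have "\<sigma> ?R = \<sigma> R"
    proof -
      have rc: "set_mset (replicate_mset n b) \<subseteq> carrier G" "set_mset (replicate_mset n (inv b)) \<subseteq> carrier G" for n
        using b by auto
      have "\<sigma> ?R = \<sigma> A \<otimes> b [^] count R b" using A rc b c inv_pow_diff[OF b(1), of "count R b"] by simp
      also have "\<dots> = \<sigma> R" using A rc b by (subst (2) RA) simp
      finally show ?thesis .
    qed
    thus "\<sigma> ?R \<otimes> g = \<one>" using assms(2) by simp
    fix Z assume Z: "Z \<subseteq># ?R" "\<sigma> Z = \<one>"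
    let ?B = "insert (inv b) (B - {b})"
    show "Z = {#}"
    \<comment> \<open>Only \<open>inv b\<close> can occur \<open>p\<close> times or more, so no
      second involution is available to cancel its contribution.\<close>
    proof (rule zero_sum_free[OF f(1) _ Z(2), of "inv b" "inv b"])
      show "set_mset Z \<subseteq> ?B" using set_mset_mono[OF Z(1)] A by (auto split: if_splits)
      show "count Z x < p" if "x \<noteq> inv b" for x
        using that mset_subset_eq_count[OF Z(1), of x] D(7)[of x] by (simp add: A_def split: if_splits)
      show "count Z x < 2 * p" for x
      proof -
        have "count ?R x < 2 * p"
        proof (cases "x = inv b")
          case True
          have "count A (inv b) = 0" using f(7) A(1) by (metis DiffD1 not_in_iff subsetD)
          moreover have "0 < count R b" using assms(3) by simp
          ultimately show ?thesis using True b(2) c p_pos by simp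
        next
          case False
          have "count A x \<le> count R x" by (simp add: A_def)
          thus ?thesis using False D(7)[of x] by simp
        qed
        thus ?thesis using mset_subset_eq_count[OF Z(1), of x] by simp
      qed
    qed auto
  qed
  hence 2: "atom ((A + {#g#}) + replicate_mset (ord b - count R b) (inv b))"
    by (metis add_mset_add_single add.assoc add.commute)
  have "d dvd int (count R b) - 1"
    by (rule cong_flip[OF 1 2 _ b(3)]) (use b c D(2) A g_supp in auto)
  hence "2 dvd int (count R b) - 1" using d_even by (rule dvd_trans[rotated])
  thus ?thesis by simp
qed

text \<open>Half flips at \<open>b\<close> and \<open>c\<close> shift the sum by the same involution
  twice, so the relation stays exact. Then \<open>count R b\<close> and \<open>p - count R b\<close>
  are both odd, although \<open>p\<close> is odd.\<close>

lemma equal_halves_impossible: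
  assumes "config B R" "\<sigma> R \<otimes> g = \<one>" "b \<in># R" "c \<in># R" "b \<noteq> c" "b [^] p = c [^] p"
  shows False
proof -
  note D = configD[OF assms(1)]
  have bc: "b \<in> B" "c \<in> B" "b \<in> carrier G" "c \<in> carrier G" "ord b = 2 * p" "ord c = 2 * p"
    using assms(3,4) D by auto
  note f = flip_half_config[OF assms(1,3)]
  have c1: "c \<in># flip_half b R" using f(4) assms(4,5) by auto
  note f2 = flip_half_config[OF f(1) c1]
  let ?R = "flip_half c (flip_half b R)"
  have "\<sigma> ?R = \<sigma> R"
    using f(2) f2(2) D(5) bc half_order(2)[OF bc(4,6)] assms(6) by (simp add: m_assoc)
  hence "\<sigma> ?R \<otimes> g = \<one>" using assms(2) by simp
  moreover have ic: "inv b \<noteq> c" using f(7) bc(2) by auto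
  hence "inv b \<in># ?R" using f2(4) f(4) by auto
  ultimately have "odd (count ?R (inv b))" using odd_coefficient[OF f2(1)] by blast
  moreover have "count ?R (inv b) = p - count R b" using f2(5)[of "inv b"] ic f(3) by auto
  moreover have "odd (count R b)" by (rule odd_coefficient[OF assms(1-3)])
  moreover have "count R b < p" by (rule D(7))
  ultimately show False using p_odd by (simp add: even_diff_nat)
qed

text \<open>
  Sign changes reduce to coefficients below \<open>p / 2\<close>. If the product \<open>\<delta>\<close> of \<open>\<sigma> R\<close> and \<open>g\<close> is neither
  \<open>\<one>\<close> nor \<open>b [^] p\<close>, then the doubled relation stays an atom when the sign of \<open>b\<close> is changed,
  although its coefficient at \<open>b\<close> is even. As this holds for every \<open>b\<close> in \<open>R\<close>, only few values
  of \<open>\<delta>\<close> remain.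
\<close>

lemma two_halves_impossible:
  assumes "config B R" "(\<sigma> R \<otimes> g) \<otimes> (\<sigma> R \<otimes> g) = \<one>" "2 \<le> card (set_mset R)"
  shows False
  using assms
proof (induction "size R" arbitrary: B R rule: less_induct)
  case less
  note D = configD[OF less.prems(1)]
  let ?\<delta> = "\<sigma> R \<otimes> g"
  have dc: "?\<delta> \<in> carrier G" using D(5) g_carrier by auto
  show False
  \<comment> \<open>Flipping a large coefficient changes the discrepancy by an involution only and
    makes \<open>R\<close> shorter, which is the induction.\<close>
  proof (cases "\<exists>b\<in>#R. p < 2 * count R b")
    case True
    then obtain b where b: "b \<in># R" "p < 2 * count R b" by blast
    note f = flip_half_config[OF less.prems(1) b(1)]
    have bc: "b \<in> carrier G" "ord b = 2 * p" using b D by auto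
    have "(\<sigma> R \<otimes> b [^] p \<otimes> g) \<otimes> (\<sigma> R \<otimes> b [^] p \<otimes> g) = (\<sigma> R \<otimes> g) \<otimes> (\<sigma> R \<otimes> g) \<otimes> (b [^] p \<otimes> b [^] p)"
      using D(5) bc(1) g_carrier by (simp add: m_ac)
    hence "(\<sigma> (flip_half b R) \<otimes> g) \<otimes> (\<sigma> (flip_half b R) \<otimes> g) = \<one>"
      using f(2) less.prems(2) half_order(2)[OF bc] by simp
    moreover have "size (flip_half b R) < size R" using f(8) b(2) by linarith
    ultimately show False using less.hyps f(1,6) less.prems(3) by metis
  next
    case False
    have small: "2 * count R x < p" for x
    proof (cases "x \<in># R")
      case True
      hence "2 * count R x \<le> p" using False by auto
      moreover have "2 * count R x \<noteq> p" using p_odd by auto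
      ultimately show ?thesis by simp
    next
      case False
      thus ?thesis using p_pos by (simp add: not_in_iff)
    qed
    obtain b where b: "b \<in># R" using less.prems(3) by (metis card.empty not_numeral_le_zero set_mset_eq_empty_iff multiset_nonemptyE)
    have "set_mset R \<noteq> {b}" using less.prems(3) by auto
    then obtain c where c: "c \<in># R" "b \<noteq> c" using b by blast
    have bc: "b \<in> B" "c \<in> B" "b \<in> carrier G" "c \<in> carrier G" "ord b = 2 * p" "ord c = 2 * p"
      using b c D by auto
    note hb = half_order[OF bc(3,5)] and hc = half_order[OF bc(4,6)]
    have free: "Z = {#}" if Z: "Z \<subseteq># R + R" "\<sigma> Z = \<one>" for Z
    proof (rule zero_sum_free[OF less.prems(1) _ Z(2) bc(1) bc(1)])
      show "set_mset Z \<subseteq> B" using set_mset_mono[OF Z(1)] D(4) by auto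
      have "count Z x < p" for x using small[of x] mset_subset_eq_count[OF Z(1), of x] by simp
      thus "count Z x < p" "count Z x < 2 * p" for x by (simp_all add: trans_less_add1 mult_2)
    qed simp
    have free_flip: "Z = {#}" if x: "x \<in># R" and Z: "Z \<subseteq># flip_half x R + flip_half x R" "\<sigma> Z = \<one>" for x Z
    proof -
      note f = flip_half_config[OF less.prems(1) x]
      note D' = configD[OF f(1)]
      show ?thesis
      proof (rule zero_sum_free[OF f(1) _ Z(2), of "inv x" "inv x"])
        show "set_mset Z \<subseteq> insert (inv x) (B - {x})" using set_mset_mono[OF Z(1)] D'(4) by auto
        show "count Z y < p" if "y \<noteq> inv x" for y
        proof -
          have "count (flip_half x R) y \<le> count R y" using that unfolding flip_half_def by simp
          thus ?thesis using small[of y] mset_subset_eq_count[OF Z(1), of y] by simp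
        qed
        show "count Z y < 2 * p" for y
          using D'(7)[of y] mset_subset_eq_count[OF Z(1), of y] by simp
      qed auto
    qed
    have step: "?\<delta> = \<one> \<or> ?\<delta> = x [^] p" if x: "x \<in># R" for x
    proof (rule ccontr)
      assume n: "\<not> (?\<delta> = \<one> \<or> ?\<delta> = x [^] p)"
      have xc: "x \<in> carrier G" "ord x = 2 * p" using x D by auto
      have "\<sigma> R \<otimes> x [^] p \<otimes> g \<noteq> \<one>"
      proof
        assume "\<sigma> R \<otimes> x [^] p \<otimes> g = \<one>"
        hence "?\<delta> \<otimes> x [^] p = x [^] p \<otimes> x [^] p"
          using D(5) xc g_carrier half_order(2)[OF xc] by (simp add: m_ac)
        thus False using n dc xc by simp
      qed
      thus False using doubled_flip_impossible[OF less.prems(1) x less.prems(2) _ _ free free_flip[OF x]] n by blast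
    qed
    note f = flip_half_config[OF less.prems(1) b]
    note D' = configD[OF f(1)]
    have c1: "c \<in># flip_half b R" using f(4) c by auto
    note f2 = flip_half_config[OF f(1) c1]
    note D'' = configD[OF f2(1)]
    have \<delta>1: "\<sigma> (flip_half b R) \<otimes> g = ?\<delta> \<otimes> b [^] p"
      using f(2) D(5) bc g_carrier by (simp add: m_ac)
    have ih: "inv b [^] p = b [^] p" by (rule hb(3))
    have ib: "inv b \<noteq> c" using f(7) bc(2) by auto
    show False
    \<comment> \<open>If the involutions agree, at most one flip makes the relation exact, where
      parity applies. If they differ, the relation is exact, and the flip at \<open>b\<close> moves
      the discrepancy to \<open>b [^] p\<close>, which is neither trivial nor
      \<open>c [^] p\<close>; the doubled relation is then flipped at \<open>c\<close>.\<close>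
    proof (cases "b [^] p = c [^] p")
      case True
      show False
      proof (cases "?\<delta> = \<one>")
        case \<delta>: True
        show False by (rule equal_halves_impossible[OF less.prems(1) \<delta> b c True])
      next
        case False
        hence "?\<delta> = b [^] p" using step[OF b] by blast
        hence "\<sigma> (flip_half b R) \<otimes> g = \<one>" using \<delta>1 hb(2) by simp
        thus False
          using equal_halves_impossible[OF f(1) _ _ c1, of "inv b"] f(4) ib ih True by auto
      qed
    next
      case False
      hence \<delta>: "?\<delta> = \<one>" using step[OF b] step[OF c(1)] by auto
      show False
      proof (rule doubled_flip_impossible[OF f(1) c1 _ _ _ free_flip[OF b]])
        show "(\<sigma> (flip_half b R) \<otimes> g) \<otimes> (\<sigma> (flip_half b R) \<otimes> g) = \<one>" using \<delta>1 \<delta> hb bc by simp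
        show "\<sigma> (flip_half b R) \<otimes> g \<noteq> \<one>" using \<delta>1 \<delta> hb bc by simp
        have "\<sigma> (flip_half b R) \<otimes> c [^] p \<otimes> g = (\<sigma> (flip_half b R) \<otimes> g) \<otimes> c [^] p"
          using D'(5) bc g_carrier by (simp add: m_ac)
        also have "\<dots> = b [^] p \<otimes> c [^] p" using \<delta>1 \<delta> bc by simp
        also have "\<dots> \<noteq> \<one>" using False hc(2) bc by (metis nat_pow_closed r_cancel)
        finally show "\<sigma> (flip_half b R) \<otimes> c [^] p \<otimes> g \<noteq> \<one>" .
        fix Z assume Z: "Z \<subseteq># flip_half c (flip_half b R) + flip_half c (flip_half b R)" "\<sigma> Z = \<one>"
        have icB: "inv c \<noteq> inv b" using c(2) bc by (metis inv_inv)
        show "Z = {#}"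
        \<comment> \<open>Two elements have been flipped, so both may reach multiplicity
          \<open>p\<close> after doubling; their involutions differ.\<close>
        proof (rule zero_sum_free[OF f2(1) _ Z(2), of "inv b" "inv c"])
          show "set_mset Z \<subseteq> insert (inv c) (insert (inv b) (B - {b}) - {c})"
            using set_mset_mono[OF Z(1)] D''(4) by auto
          show "inv b \<in> insert (inv c) (insert (inv b) (B - {b}) - {c})" using ib by auto
          show "inv b = inv c \<or> inv b [^] p \<noteq> inv c [^] p" using hb(3) hc(3) False by simp
          show "count Z y < p" if "y \<noteq> inv b" "y \<noteq> inv c" for y
          proof -
            have "count (flip_half c (flip_half b R)) y \<le> count R y" using that unfolding flip_half_def by simp
            thus ?thesis using small[of y] mset_subset_eq_count[OF Z(1), of y] by simp
          qed
          show "count Z y < 2 * p" for y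
            using D''(7)[of y] mset_subset_eq_count[OF Z(1), of y] by simp
        qed auto
      qed
    qed
  qed
qed

end

context long_atom
begin

text \<open>An even \<open>d\<close> makes all orders in the support even, so they are 2 or
  \<open>2 * p\<close>. Over a maximal set of elements of order \<open>2 * p\<close> that is
  independent modulo involutions, the analysis above leaves just one coefficient for the square of
  each \<open>x\<close>.\<close>

lemma even_case:
  fixes p :: nat
  assumes p: "Factorial_Ring.prime p" "p \<noteq> 2"
    and exp: "\<And>g. g \<in> carrier G \<Longrightarrow> g [^] (2 * p) = \<one>"
    and e0: "e0 \<in># U" "ord e0 = 2 * p"
  shows "\<not> 2 dvd d"
proof
  assume d2: "2 dvd d"
  have podd: "odd p" using p by (metis primes_dvd_imp_eq two_is_prime_nat)
  have nd: "\<not> d dvd 1" using d2 by (metis dvd_trans odd_one)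
  have sq: "ord (x [^] (2::nat)) = p" if "x \<in> carrier G" "ord x = 2 * p" for x
    using ord_pow[of x 2] that by auto
  obtain B where B: "B \<subseteq> set_mset U" "indep 2 B \<and> (\<forall>e\<in>B. ord e = 2 * p)"
    and B_max: "\<And>x. x \<in># U \<Longrightarrow> indep 2 (insert x B) \<and> (\<forall>e\<in>insert x B. ord e = 2 * p) \<Longrightarrow> x \<in> B"
    using maximal_subset_exists[of "set_mset U" "\<lambda>B. indep 2 B \<and> (\<forall>e\<in>B. ord e = 2 * p)"] indep_empty by auto
  have Bi: "indep 2 B" using B(2) by simp
  note Bc = indep_carrier[OF Bi]
  have span: "\<exists>y\<in>spn B. x [^] (2::nat) = y [^] (2::nat)" if x: "x \<in># U" "ord x = 2 * p" for x
  proof (rule ccontr)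
    assume n: "\<not> ?thesis"
    have xc: "x \<in> carrier G" using x U_carrier by auto
    have "indep 2 (insert x B)"
    proof (rule indep_insert[OF Bi xc])
      fix j :: nat and y assume j: "0 < j" "j < ord (x [^] (2::nat))" "y \<in> spn B"
      show "(x [^] (2::nat)) [^] j \<noteq> y [^] (2::nat)"
      proof
        assume eq: "(x [^] (2::nat)) [^] j = y [^] (2::nat)"
        \<comment> \<open>\<open>j\<close> is invertible modulo the order \<open>p\<close> of the
          square of \<open>x\<close>, so the square itself is a square from the span.\<close>
        have "coprime j p" using j sq[OF xc x(2)] p(1)
          by (metis coprime_commute nat_dvd_not_less prime_imp_coprime)
        then obtain i where i: "[j * i = 1] (mod p)" using cong_solve_coprime_nat by auto
        have "p \<noteq> 1" using p(1) by auto
        hence "(j * i) mod p = 1" using i by (simp add: cong_def mod_less prime_gt_1_nat p(1))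
        hence "(x [^] (2::nat)) [^] (j * i) = x [^] (2::nat)"
          using pow_mod_ord[of "x [^] (2::nat)" "j * i"] sq[OF xc x(2)] xc by simp
        moreover have "(x [^] (2::nat)) [^] (j * i) = (y [^] i) [^] (2::nat)"
          using eq xc j(3) spn_closed[OF Bc] by (simp add: nat_pow_pow[symmetric] subset_iff) (metis mult.commute nat_pow_pow)
        ultimately show False using n spn_pow[OF Bc j(3)] by metis
      qed
    qed
    hence "x \<in> B" using B_max[OF x(1)] x(2) B(2) by auto
    thus False using n spn_incl[OF _ Bc] by blast
  qed
  have "B \<noteq> {}"
  proof
    assume "B = {}"
    hence "e0 [^] (2::nat) = \<one>" using span[OF e0] by (auto simp: spn_empty)
    thus False using e0 U_carrier prime_ge_2_nat[OF p(1)] by (auto simp: pow_eq_id dest!: dvd_imp_le)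
  qed
  then obtain e where e: "e \<in> B" by blast
  show False
  proof (rule cover_impossible[OF Bi e])
    show "e \<in># U" using e B(1) by auto
    show "3 \<le> ord e" using e B(2) prime_ge_2_nat[OF p(1)] by simp
    fix x assume x: "x \<in># U"
    have xc: "x \<in> carrier G" "x \<in> Supp" "x \<noteq> \<one>" using x U_carrier U_supp Supp_one by auto
    hence "ord x dvd 2 * p" using exp by (simp add: pow_eq_id)
    then obtain a b where ab: "ord x = a * b" "a dvd 2" "b dvd p" using division_decomp by blast
    hence or: "(a = 1 \<or> a = 2) \<and> (b = 1 \<or> b = p)" using p two_is_prime_nat by (auto simp: prime_nat_iff)
    have "2 dvd int (ord x) - 2" using cong_ord[OF xc(2)] d2 by (rule dvd_trans[rotated])
    hence "even (ord x)" by simp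
    hence "a = 2" using or ab(1) podd by auto
    show "(\<exists>a\<in>B. x \<in> spn {a}) \<or> x [^] (2::nat) = \<one>"
    proof (cases "b = 1")
      case True
      thus ?thesis using ab(1) \<open>a = 2\<close> xc by (simp add: pow_eq_id)
    next
      case False
      hence ox: "ord x = 2 * p" using or ab(1) \<open>a = 2\<close> by simp
      obtain y where y: "y \<in> spn B" "x [^] (2::nat) = y [^] (2::nat)" using span[OF x ox] by blast
      obtain R where R: "set_mset R \<subseteq> B" "\<sigma> R [^] (2::nat) = y [^] (2::nat)" "reduced 2 R"
        using spn_reduced[OF Bc y(1)] by blast
      have Rc: "set_mset R \<subseteq> carrier G" using R(1) Bc by auto
      \<comment> \<open>With \<open>inv x\<close> as \<open>g\<close>, the product of
        \<open>\<sigma> R\<close> and \<open>g\<close> is the involution, possibly trivial, by which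
        \<open>R\<close> misses \<open>x\<close>.\<close>
      interpret even_length_congruence G Supp d p "inv x"
        by unfold_locales (use p podd d2 xc Supp_inv in auto)
      have cfg: "config B R" unfolding config_def
      proof (intro conjI allI)
        fix b
        show "count R b < p"
        proof (cases "b \<in># R")
          case True
          hence "b \<in> carrier G" "ord b = 2 * p" using R(1) Bc B(2) by auto
          thus ?thesis using R(3) True sq unfolding reduced_def by metis
        qed (use p_pos in \<open>simp add: not_in_iff\<close>)
      qed (use Bi B U_supp R(1) in auto)
      have "\<sigma> R \<otimes> \<sigma> R = x \<otimes> x" using R(2) y(2) Rc xc by (simp add: numeral_2_eq_2)
      hence "(\<sigma> R \<otimes> inv x) \<otimes> (\<sigma> R \<otimes> inv x) = (x \<otimes> x) \<otimes> (inv x \<otimes> inv x)"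
        using Rc xc by (metis inv_closed m_assoc m_comm m_closed seq_sum_closed)
      also have "\<dots> = \<one>" using xc by (metis inv_mult_group m_closed r_inv inv_closed)
      finally have "card (set_mset R) < 2" using two_halves_impossible[OF cfg] by (meson not_less)
      moreover have "R \<noteq> {#}"
      proof
        assume "R = {#}"
        hence "x [^] (2::nat) = \<one>" using R(2) y(2) by simp
        thus False using ox xc prime_ge_2_nat[OF p(1)] by (auto simp: pow_eq_id dest!: dvd_imp_le)
      qed
      hence "card (set_mset R) \<noteq> 0" by simp
      ultimately have "card (set_mset R) = 1" by linarith
      then obtain b where b: "set_mset R = {b}" by (rule card_1_singletonE)
      have bc: "b \<in> B" "b \<in> carrier G" "b \<in> Supp" "{b} \<subseteq> carrier G" using b R(1) Bc B(1) U_supp by auto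
      have "\<sigma> R [^] (2::nat) \<in> spn {b}" using b by (intro spn_pow[OF bc(4)] spnI) auto
      hence x2: "x [^] (2::nat) \<in> spn {b}" using R(2) y(2) by simp
      \<comment> \<open>Otherwise the index over \<open>b\<close> would be 2 with non-trivial
        square, and 2 would be 1 modulo \<open>d\<close>.\<close>
      have "x \<in> spn {b}"
      proof (rule ccontr)
        assume nx: "x \<notin> spn {b}"
        have min: "x [^] j \<notin> spn {b}" if "0 < j" "j < 2" for j :: nat
        proof -
          have "j = 1" using that by simp
          thus ?thesis using nx xc by simp
        qed
        have x21: "x [^] (2::nat) \<noteq> \<one>" using ox prime_ge_2_nat[OF p(1)] xc by (auto simp: pow_eq_id dest: dvd_imp_le)
        have "d dvd 1 \<or> (x [^] (2::nat) = \<one> \<and> d dvd int 2 - 2) \<or>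
          (x [^] (2::nat) \<noteq> \<one> \<and> d dvd int 2 - 1 \<and> ((\<exists>e\<in>{b}. x [^] (2::nat) \<in> spn {e}) \<or> x [^] (2 * 2 :: nat) = \<one>))"
          by (rule index_cases[OF indep_single[OF bc(2)] _ xc(2) _ x2 min]) (use bc in auto)
        thus False using nd x21 by simp
      qed
      thus ?thesis using bc(1) by blast
    qed
  qed
qed

end

section \<open>Transfer and elasticity\<close>

context finite_comm_group
begin

lemma transfer_split:
  assumes "transfer_hom H (zero_sum_monoid G) \<theta>" "u \<in> carrier H" "zs b" "zs c" "\<theta> u = b + c"
  obtains v w where "v \<in> carrier H" "w \<in> carrier H" "u = v \<otimes>\<^bsub>H\<^esub> w" "\<theta> v = b" "\<theta> w = c"
proof -
  have "\<forall>u\<in>carrier H. \<forall>b\<in>carrier (zero_sum_monoid G). \<forall>c\<in>carrier (zero_sum_monoid G).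
      \<theta> u = b \<otimes>\<^bsub>zero_sum_monoid G\<^esub> c \<longrightarrow>
      (\<exists>v\<in>carrier H. \<exists>w\<in>carrier H. u = v \<otimes>\<^bsub>H\<^esub> w \<and> \<theta> v = b \<and> \<theta> w = c)"
    using assms(1) unfolding transfer_hom_def by (elim conjE)
  moreover have "b \<in> carrier (zero_sum_monoid G)" "c \<in> carrier (zero_sum_monoid G)"
    using assms(3,4) by (simp_all add: zs_iff)
  moreover have "\<theta> u = b \<otimes>\<^bsub>zero_sum_monoid G\<^esub> c" using assms(5) by (simp add: zero_sum_monoid_def)
  ultimately show ?thesis using assms(2) that by blast
qed

text \<open>Zero-sum divisors of \<open>\<theta> u\<close> lift to divisors of \<open>u\<close>, and
  only units are sent to the empty sequence, so proper decompositions correspond.\<close>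

lemma transfer_irreducible:
  assumes "comm_monoid_cancel H" "transfer_hom H (zero_sum_monoid G) \<theta>" "u \<in> carrier H"
  shows "Divisibility.irreducible H u \<longleftrightarrow> atom (\<theta> u)"
proof
  interpret H: comm_monoid_cancel H by fact
  have hom: "\<And>a b. a \<in> carrier H \<Longrightarrow> b \<in> carrier H \<Longrightarrow> \<theta> (a \<otimes>\<^bsub>H\<^esub> b) = \<theta> a + \<theta> b"
    and img: "\<And>a. a \<in> carrier H \<Longrightarrow> zs (\<theta> a)"
    using assms(2) by (auto simp: transfer_hom_def hom_def zero_sum_monoid_def)
  have unit: "\<theta> a = {#} \<longleftrightarrow> a \<in> Units H" if "a \<in> carrier H" for a
    using assms(2) that by (auto simp: transfer_hom_def zero_sum_monoid_def)
  {
    assume irr: "Divisibility.irreducible H u"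
    hence ne: "\<theta> u \<noteq> {#}" using unit assms(3) by (auto simp: Divisibility.irreducible_def)
    show "atom (\<theta> u)" unfolding minimal_zero_sum_def
    proof (intro conjI allI impI)
      show "\<theta> u \<in> carrier (zero_sum_monoid G)" using img[OF assms(3)] zs_iff by blast
      show "\<theta> u \<noteq> {#}" by (rule ne)
      fix T assume T: "T \<subset># \<theta> u \<and> T \<noteq> {#}"
      show "T \<notin> carrier (zero_sum_monoid G)"
      proof
        assume Tz: "T \<in> carrier (zero_sum_monoid G)"
        have sub: "T \<subseteq># \<theta> u" using T by (simp add: subset_mset.less_imp_le)
        have c: "set_mset (\<theta> u - T) \<subseteq> carrier G" using img[OF assms(3)] by (auto dest: in_diffD)
        have eq: "\<sigma> (\<theta> u) = \<sigma> T \<otimes> \<sigma> (\<theta> u - T)"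
          by (rule seq_sum_diff[OF _ sub]) (use img[OF assms(3)] in simp)
        have ones: "\<sigma> (\<theta> u) = \<one>" "\<sigma> T = \<one>" using img[OF assms(3)] Tz zs_iff by blast+
        have "\<sigma> (\<theta> u - T) = \<one>" using eq[unfolded ones] c by (metis l_one seq_sum_closed)
        hence Rz: "zs (\<theta> u - T)" using c by simp
        have "\<theta> u = T + (\<theta> u - T)" using sub by simp
        then obtain v w where vw: "v \<in> carrier H" "w \<in> carrier H" "u = v \<otimes>\<^bsub>H\<^esub> w" "\<theta> v = T"
          using transfer_split[OF assms(2,3) _ Rz, of T] Tz zs_iff by blast
        have "\<not> u divides\<^bsub>H\<^esub> v"
        proof
          assume "u divides\<^bsub>H\<^esub> v"
          then obtain c where c: "c \<in> carrier H" "v = u \<otimes>\<^bsub>H\<^esub> c" unfolding factor_def by blast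
          hence "T = \<theta> u + \<theta> c" using vw(4) hom assms(3) by metis
          hence "\<theta> u \<subseteq># T" by simp
          thus False using T by (metis subset_mset.leD)
        qed
        moreover have "v divides\<^bsub>H\<^esub> u" using vw by (auto simp: factor_def)
        ultimately have "v \<in> Units H" using irr vw(1) by (auto simp: Divisibility.irreducible_def properfactor_def)
        hence "T = {#}" using unit vw by blast
        thus False using T by simp
      qed
    qed
  }
  {
    assume at: "atom (\<theta> u)"
    show "Divisibility.irreducible H u" unfolding Divisibility.irreducible_def
    proof (intro conjI ballI impI)
      show "u \<notin> Units H" using atomD(3)[OF at] unit assms(3) by blast
      fix b assume b: "b \<in> carrier H" "properfactor H b u"
      then obtain c where c: "c \<in> carrier H" "u = b \<otimes>\<^bsub>H\<^esub> c" unfolding properfactor_def factor_def by blast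
      have eq: "\<theta> u = \<theta> b + \<theta> c" using hom b c by simp
      hence "\<theta> b = {#} \<or> \<theta> b = \<theta> u" using img[OF b(1)] by (intro atomD(4)[OF at]) auto
      thus "b \<in> Units H"
      proof
        assume "\<theta> b = \<theta> u"
        hence "c \<in> Units H" using eq unit c(1) by simp
        then obtain c' where c': "c' \<in> carrier H" "c \<otimes>\<^bsub>H\<^esub> c' = \<one>\<^bsub>H\<^esub>" by (meson H.Units_inv_closed H.Units_r_inv)
        hence "b = u \<otimes>\<^bsub>H\<^esub> c'" using b(1) c by (simp add: H.m_assoc)
        hence "u divides\<^bsub>H\<^esub> b" using c'(1) by (auto simp: factor_def)
        thus ?thesis using b(2) by (simp add: properfactor_def)
      qed (use unit b(1) in blast)
    qed
  }
qed

lemma transfer_length_set: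
  assumes "comm_monoid_cancel H" "transfer_hom H (zero_sum_monoid G) \<theta>" "a \<in> carrier H"
  shows "length_set H a = lengths (\<theta> a)"
proof -
  interpret H: comm_monoid_cancel H by fact
  note irr = transfer_irreducible[OF assms(1,2)]
  have hom: "\<And>a b. a \<in> carrier H \<Longrightarrow> b \<in> carrier H \<Longrightarrow> \<theta> (a \<otimes>\<^bsub>H\<^esub> b) = \<theta> a + \<theta> b"
    and one: "\<theta> \<one>\<^bsub>H\<^esub> = {#}"
    using assms(2) by (auto simp: transfer_hom_def hom_def zero_sum_monoid_def)
  have unit: "\<theta> a = {#} \<longleftrightarrow> a \<in> Units H"
    using assms(2,3) by (auto simp: transfer_hom_def zero_sum_monoid_def)
  show ?thesis
  proof (cases "a \<in> Units H")
    case True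
    thus ?thesis using unit lengths_empty by (simp add: length_set_def)
  next
    case False
    have sum: "\<theta> (foldr (\<otimes>\<^bsub>H\<^esub>) us \<one>\<^bsub>H\<^esub>) = \<Sum>\<^sub># (mset (map \<theta> us))" if "set us \<subseteq> carrier H" for us
      using that by (induction us) (auto simp: hom one)
    \<comment> \<open>The induction starts with one factor, not with none: the last atom is lifted
      to the remaining element itself, so no unit is left over and the product is exact.\<close>
    have realize: "\<exists>us. set us \<subseteq> carrier H \<and> factors H us b \<and> length us = length xs"
      if "xs \<noteq> []" "b \<in> carrier H" "\<forall>x\<in>set xs. atom x" "\<theta> b = \<Sum>\<^sub># (mset xs)" for xs b
      using that
    proof (induction xs arbitrary: b rule: list_nonempty_induct)
      case (single x)
      hence "Divisibility.irreducible H b" using irr by simp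
      thus ?case using single.prems by (intro exI[of _ "[b]"]) (auto simp: factors_def)
    next
      case (cons x xs)
      have x: "atom x" using cons.prems(2) by simp
      have r: "zs (\<Sum>\<^sub># (mset xs))" using cons.prems(2) by (intro sum_mset_zs) (auto dest: atomD(1,2))
      have "\<theta> b = x + \<Sum>\<^sub># (mset xs)" using cons.prems(3) by simp
      then obtain v w where vw: "v \<in> carrier H" "w \<in> carrier H" "b = v \<otimes>\<^bsub>H\<^esub> w" "\<theta> v = x" "\<theta> w = \<Sum>\<^sub># (mset xs)"
        using transfer_split[OF assms(2) cons.prems(1) _ r, of x] atomD(1,2)[OF x] by blast
      obtain us where us: "set us \<subseteq> carrier H" "factors H us w" "length us = length xs"
        using cons.IH[OF vw(2) _ vw(5)] cons.prems(2) by auto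
      have "Divisibility.irreducible H v" using irr[OF vw(1)] vw(4) x by simp
      hence "factors H (v # us) b" using us(2) vw(3) by (auto simp: factors_def)
      thus ?case using us vw(1) by (intro exI[of _ "v # us"]) auto
    qed
    show ?thesis
    proof (rule Set.set_eqI)
      fix k
      show "k \<in> length_set H a \<longleftrightarrow> k \<in> lengths (\<theta> a)"
      proof
        assume "k \<in> length_set H a"
        then obtain us where us: "set us \<subseteq> carrier H" "factors H us a" "length us = k"
          using False by (auto simp: length_set_def)
        show "k \<in> lengths (\<theta> a)"
        proof (rule lengthsI[of "mset (map \<theta> us)"])
          fix V assume "V \<in># mset (map \<theta> us)"
          thus "atom V" using us(1,2) irr by (auto simp: factors_def)
        qed (use us sum in \<open>auto simp: factors_def\<close>)
      next
        assume k: "k \<in> lengths (\<theta> a)"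
        then obtain F where F: "size F = k" "\<forall>V\<in>#F. atom V" "\<Sum>\<^sub># F = \<theta> a" unfolding lengths_def by auto
        obtain xs where xs: "F = mset xs" using ex_mset by metis
        have "F \<noteq> {#}" using F(3) unit False by auto
        hence "xs \<noteq> []" using xs by auto
        from realize[OF this assms(3)] show "k \<in> length_set H a"
          using F xs \<open>xs \<noteq> []\<close> False by (auto simp: length_set_def)
      qed
    qed
  qed
qed

lemma transfer_length_system:
  assumes "transfer_krull_monoid H G"
  shows "length_system H = lengths ` {S. zs S}"
proof -
  obtain \<theta> where \<theta>: "comm_monoid_cancel H" "transfer_hom H (zero_sum_monoid G) \<theta>"
    using assms by (auto simp: transfer_krull_monoid_def)
  have "length_system H = (\<lambda>a. lengths (\<theta> a)) ` carrier H"
    unfolding length_system_def using transfer_length_set[OF \<theta>] by (intro image_cong) auto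
  also have "\<dots> = lengths ` carrier (zero_sum_monoid G)"
    using \<theta>(2) by (simp add: transfer_hom_def image_image[symmetric])
  also have "carrier (zero_sum_monoid G) = {S. zs S}" using zs_iff by blast
  finally show ?thesis .
qed

text \<open>An atom of length at most 2 consists of one element and possibly its inverse, so it
  generates a cyclic group; an atom of maximal length generates \<open>G\<close>.\<close>

lemma davenport_ge_3:
  assumes "\<not> cyclic_group G"
  shows "3 \<le> davenport G"
proof (rule ccontr)
  assume small: "\<not> 3 \<le> davenport G"
  obtain U where U: "atom U" "size U = davenport G" by (rule davenport_attained)
  obtain x V where xV: "U = add_mset x V" using atomD(3)[OF U(1)] by (metis multiset_cases)
  have xc: "x \<in> carrier G" "{x} \<subseteq> carrier G" using atomD(1)[OF U(1)] xV by auto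
  have "size V \<le> 1" using small U(2) xV by simp
  hence "V = {#} \<or> (\<exists>y. V = {#y#})" by (metis One_nat_def le_Suc_eq le_zero_eq size_1_singleton_mset size_eq_0_iff_empty)
  hence "set_mset U \<subseteq> spn {x}"
  proof
    assume "V = {#}"
    thus ?thesis using xV xc by (auto intro: spn_incl)
  next
    assume "\<exists>y. V = {#y#}"
    then obtain y where y: "V = {#y#}" by blast
    have yc: "y \<in> carrier G" using atomD(1)[OF U(1)] xV y by auto
    have "x \<otimes> y = \<one>" using atomD(2)[OF U(1)] xV y xc yc by simp
    hence "y = inv x" using xc yc by (metis inv_equality m_comm)
    thus ?thesis using xV y xc by (auto intro: spn_incl spn_inv)
  qed
  hence "carrier G \<subseteq> spn {x}" using long_atom_generates[OF U] spn_minimal[OF _ xc(2)] by blast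
  thus False using cyclic_if_spn[OF xc(1)] spn_closed[OF xc(2)] assms by blast
qed

section \<open>Elasticity and the elements attaining it\<close>

lemma sum_mset_ge_eq:
  fixes f :: "'b \<Rightarrow> nat"
  assumes "\<And>U. U \<in># F \<Longrightarrow> c \<le> f U"
  shows "c * size F \<le> (\<Sum>U\<in>#F. f U)"
    and "(\<Sum>U\<in>#F. f U) = c * size F \<Longrightarrow> U \<in># F \<Longrightarrow> f U = c"
proof -
  show ge: "c * size F \<le> (\<Sum>U\<in>#F. f U)"
    using assms by (induction F) (auto intro: add_mono)
  assume eq: "(\<Sum>U\<in>#F. f U) = c * size F" and "U \<in># F"
  then obtain F' where F': "F = add_mset U F'" by (metis mset_add)
  have "c * size F' \<le> (\<Sum>U\<in>#F'. f U)"
    using assms F' by (induction F' arbitrary: F) (auto intro!: add_mono)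
  thus "f U = c" using eq F' assms[of U] by simp
qed

lemma sum_mset_le_eq:
  fixes f :: "'b \<Rightarrow> nat"
  assumes "\<And>U. U \<in># F \<Longrightarrow> f U \<le> c"
  shows "(\<Sum>U\<in>#F. f U) \<le> c * size F"
    and "(\<Sum>U\<in>#F. f U) = c * size F \<Longrightarrow> U \<in># F \<Longrightarrow> f U = c"
proof -
  show ge: "(\<Sum>U\<in>#F. f U) \<le> c * size F"
    using assms by (induction F) (auto intro: add_mono)
  assume eq: "(\<Sum>U\<in>#F. f U) = c * size F" and "U \<in># F"
  then obtain F' where F': "F = add_mset U F'" by (metis mset_add)
  have "(\<Sum>U\<in>#F'. f U) \<le> c * size F'"
    using assms F' by (induction F' arbitrary: F) (auto intro!: add_mono)
  thus "f U = c" using eq F' assms[of U] by simp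
qed

lemma sum_mset_size_count:
  "(\<Sum>U\<in>#F. size U + n * count U x) = size (\<Sum>\<^sub># F) + n * count (\<Sum>\<^sub># F) x"
  by (induction F) (auto simp: algebra_simps)

text \<open>The atom consisting of \<open>\<one>\<close> is the only one of length 1; counting
  \<open>\<one>\<close> once more removes this exception.\<close>

lemma atom_size_lower: "atom U \<Longrightarrow> 2 \<le> size U + 1 * count U \<one>"
proof -
  assume at: "atom U"
  show ?thesis
  proof (cases "size U = 1")
    case True
    then obtain x where x: "U = {#x#}" by (metis size_1_singleton_mset)
    hence "x = \<one>" using atomD(1,2)[OF at] by simp
    thus ?thesis using x by simp
  next
    case False
    moreover have "size U \<noteq> 0" using atomD(3)[OF at] by simp
    ultimately show ?thesis by linarith
  qed
qed

text \<open>An atom containing \<open>\<one>\<close> has length 1, and the extra weight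
  \<open>davenport G - 1\<close> lifts it exactly to the bound.\<close>

lemma atom_size_upper: "atom U \<Longrightarrow> size U + (davenport G - 1) * count U \<one> \<le> davenport G"
proof (cases "\<one> \<in># U")
  case True
  assume at: "atom U"
  thus ?thesis using atom_contains_one[OF at True] atom_le_davenport[OF at] by simp
next
  case False
  assume "atom U"
  thus ?thesis using False atom_le_davenport by (simp add: not_in_iff)
qed

text \<open>Both weighted bounds are summed over a factorization; since the weight
  \<open>davenport G - 1\<close> of \<open>\<one>\<close> is at least 1, the two estimates of
  \<open>size S\<close> fit together.\<close>

lemma lengths_ratio:
  assumes D: "3 \<le> davenport G" and k: "k \<in> lengths S" and l: "l \<in> lengths S"
  shows "2 * k \<le> davenport G * l"
proof -
  obtain F where F: "size F = k" "\<forall>U\<in>#F. atom U" "\<Sum>\<^sub># F = S" using k unfolding lengths_def by auto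
  obtain F' where F': "size F' = l" "\<forall>U\<in>#F'. atom U" "\<Sum>\<^sub># F' = S" using l unfolding lengths_def by auto
  have "2 * k \<le> size S + 1 * count S \<one>"
    using sum_mset_ge_eq(1)[of F 2 "\<lambda>U. size U + 1 * count U \<one>"] atom_size_lower F
    unfolding sum_mset_size_count by auto
  moreover have "size S + (davenport G - 1) * count S \<one> \<le> davenport G * l"
    using sum_mset_le_eq(1)[of F' "\<lambda>U. size U + (davenport G - 1) * count U \<one>" "davenport G"] atom_size_upper F'
    unfolding sum_mset_size_count by auto
  moreover have "1 * count S \<one> \<le> (davenport G - 1) * count S \<one>" using D by (intro mult_right_mono) auto
  ultimately show ?thesis by linarith
qed

text \<open>The weight \<open>davenport G - 1\<close> exceeds 1, so an occurrence of
  \<open>\<one>\<close> would make the comparison strict. Without it, equality of the sums forces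
  equality for every atom.\<close>

lemma lengths_ratio_eq:
  assumes D: "3 \<le> davenport G" and k: "k \<in> lengths S" and l: "l \<in> lengths S"
    and eq: "2 * k = davenport G * l"
  obtains F F' where "\<And>U. U \<in># F \<Longrightarrow> atom U \<and> size U = 2" "\<Sum>\<^sub># F = S"
    "\<And>U. U \<in># F' \<Longrightarrow> atom U \<and> size U = davenport G" "\<Sum>\<^sub># F' = S" "size F' = l"
proof -
  obtain F where F: "size F = k" "\<forall>U\<in>#F. atom U" "\<Sum>\<^sub># F = S" using k unfolding lengths_def by auto
  obtain F' where F': "size F' = l" "\<forall>U\<in>#F'. atom U" "\<Sum>\<^sub># F' = S" using l unfolding lengths_def by auto
  have 1: "2 * k \<le> size S + 1 * count S \<one>"
    using sum_mset_ge_eq(1)[of F 2 "\<lambda>U. size U + 1 * count U \<one>"] atom_size_lower F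
    unfolding sum_mset_size_count by auto
  have 2: "size S + (davenport G - 1) * count S \<one> \<le> davenport G * l"
    using sum_mset_le_eq(1)[of F' "\<lambda>U. size U + (davenport G - 1) * count U \<one>" "davenport G"] atom_size_upper F'
    unfolding sum_mset_size_count by auto
  have zero: "count S \<one> = 0"
  proof (rule ccontr)
    assume "count S \<one> \<noteq> 0"
    hence "1 * count S \<one> < (davenport G - 1) * count S \<one>" using D by (intro mult_strict_right_mono) auto
    thus False using 1 2 eq by linarith
  qed
  have sub: "count U \<one> = 0" if "U \<in># F \<or> U \<in># F'" for U
  proof -
    have "U \<subseteq># S" using that F(3) F'(3) by (metis mset_subset_eq_add_left sum_mset.remove)
    thus ?thesis using zero mset_subset_eq_count[of U S \<one>] by simp
  qed
  show ?thesis
  proof (rule that[of F F'])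
    fix U assume U: "U \<in># F"
    have "(\<Sum>U\<in>#F. size U + 1 * count U \<one>) = 2 * size F"
      unfolding sum_mset_size_count using 1 2 zero eq F by simp
    hence "size U + 1 * count U \<one> = 2"
      using sum_mset_ge_eq(2)[of F 2 "\<lambda>U. size U + 1 * count U \<one>", OF _ _ U] atom_size_lower F(2) by blast
    thus "atom U \<and> size U = 2" using F(2) U sub by simp
  next
    fix U assume U: "U \<in># F'"
    have "(\<Sum>U\<in>#F'. size U + (davenport G - 1) * count U \<one>) = davenport G * size F'"
      unfolding sum_mset_size_count using 1 2 zero eq F' by simp
    hence "size U + (davenport G - 1) * count U \<one> = davenport G"
      using sum_mset_le_eq(2)[of F' "\<lambda>U. size U + (davenport G - 1) * count U \<one>" "davenport G", OF _ _ U]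
        atom_size_upper F'(2) by blast
    thus "atom U \<and> size U = davenport G" using F'(2) U sub by simp
  qed (use F F' in auto)
qed

lemma lengths_pos: "S \<noteq> {#} \<Longrightarrow> 0 \<notin> lengths S"
  unfolding lengths_def by auto

lemma lengths_finite:
  assumes "3 \<le> davenport G"
  shows "finite (lengths S)"
proof (cases "lengths S = {}")
  case False
  then obtain l where l: "l \<in> lengths S" by blast
  have "lengths S \<subseteq> {..davenport G * l}"
  proof
    fix k assume "k \<in> lengths S"
    from lengths_ratio[OF assms this l] show "k \<in> {..davenport G * l}" by simp
  qed
  thus ?thesis by (rule finite_subset) simp
qed simp

lemma set_elasticity_lengths:
  assumes D: "3 \<le> davenport G" and "zs S" "S \<noteq> {#}"
  obtains k l where "k \<in> lengths S" "l \<in> lengths S" "0 < l" "\<And>i. i \<in> lengths S \<Longrightarrow> l \<le> i \<and> i \<le> k"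
    "set_elasticity (lengths S) = ereal (real k / real l)"
proof -
  note f = lengths_finite[OF D, of S]
  have ne: "lengths S \<noteq> {}" using lengths_exist assms(2) by blast
  note M = Max_in[OF f ne] and m = Min_in[OF f ne]
  have pos: "0 < Min (lengths S)" using m lengths_pos[OF assms(3)] by (metis neq0_conv)
  have "lengths S \<noteq> {0}" using lengths_pos[OF assms(3)] by auto
  thus ?thesis using that[OF M m pos] f by (simp add: set_elasticity_def)
qed

lemma set_elasticity_max:
  assumes D: "3 \<le> davenport G" and "k \<in> lengths S" "l \<in> lengths S" "0 < l" "2 * k = davenport G * l"
  shows "set_elasticity (lengths S) = ereal (real (davenport G) / 2)"
proof -
  have S: "zs S" "S \<noteq> {#}" using lengths_zs[OF assms(2)] assms(3,4) lengths_empty by auto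
  obtain k' l' where kl: "k' \<in> lengths S" "l' \<in> lengths S" "0 < l'" "\<And>i. i \<in> lengths S \<Longrightarrow> l' \<le> i \<and> i \<le> k'"
    "set_elasticity (lengths S) = ereal (real k' / real l')"
    using set_elasticity_lengths[OF D S] by blast
  have "2 * k' \<le> davenport G * l" by (rule lengths_ratio[OF D kl(1) assms(3)])
  hence "k' = k" using assms(5) kl(4)[OF assms(2)] by simp
  have "davenport G * l \<le> davenport G * l'" using lengths_ratio[OF D assms(2) kl(2)] assms(5) by simp
  hence "l' = l" using D kl(4)[OF assms(3)] by simp
  have "2 * real k = real (davenport G) * real l" using assms(5) by (metis of_nat_mult of_nat_numeral)
  thus ?thesis using kl(5) \<open>k' = k\<close> \<open>l' = l\<close> assms(4) by (simp add: field_simps)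
qed

definition symmetrize :: "'g multiset \<Rightarrow> 'g multiset" where
  "symmetrize U = U + image_mset (m_inv G) U"

text \<open>For an atom of maximal length these two lengths have the extremal ratio, which shows
  that the elasticity is attained.\<close>

lemma symmetrize_lengths:
  assumes "atom U" "2 \<le> size U"
  shows "2 * n \<in> lengths (repeat_mset n (symmetrize U))" "size U * n \<in> lengths (repeat_mset n (symmetrize U))"
proof -
  have no1: "\<one> \<notin># U" using atom_contains_one[OF assms(1)] assms(2) by auto
  have "2 \<in> lengths (symmetrize U)"
    by (rule lengthsI[of "{#U, image_mset (m_inv G) U#}"]) (use assms(1) atom_inv_image in \<open>auto simp: symmetrize_def\<close>)
  thus "2 * n \<in> lengths (repeat_mset n (symmetrize U))" using lengths_repeat by (metis mult.commute)
  have "size U \<in> lengths (symmetrize U)"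
    by (rule lengthsI[of "image_mset (\<lambda>x. {#x, inv x#}) U"])
      (use atomD(1)[OF assms(1)] no1 in \<open>auto simp: symmetrize_def sum_mset_pairs intro!: atom_pair\<close>)
  thus "size U * n \<in> lengths (repeat_mset n (symmetrize U))" using lengths_repeat by (metis mult.commute)
qed

lemma symmetrize_contains:
  assumes "set_mset C \<subseteq> set_mset (symmetrize U)" "size C \<le> n"
  shows "C \<subseteq># repeat_mset n (symmetrize U)"
proof (rule mset_subset_eqI)
  fix x
  show "count C x \<le> count (repeat_mset n (symmetrize U)) x"
  proof (cases "x \<in># C")
    case True
    hence "1 \<le> count (symmetrize U) x" using assms(1) by (metis count_greater_eq_one_iff subsetD)
    hence "n * 1 \<le> n * count (symmetrize U) x" by (rule mult_le_mono2)
    moreover have "count C x \<le> n" using assms(2) count_le_size le_trans by metis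
    ultimately have "count C x \<le> n * count (symmetrize U) x" by linarith
    thus ?thesis by simp
  qed (simp add: not_in_iff)
qed

lemma elasticity_transfer_krull:
  assumes "transfer_krull_monoid H G" "\<not> cyclic_group G"
  shows "elasticity H = ereal (real (davenport G) / 2)"
  unfolding elasticity_def transfer_length_system[OF assms(1)]
proof (rule antisym)
  note D = davenport_ge_3[OF assms(2)]
  show "(SUP L\<in>lengths ` {S. zs S}. set_elasticity L) \<le> ereal (real (davenport G) / 2)"
  proof (rule SUP_least)
    fix L assume "L \<in> lengths ` {S. zs S}"
    then obtain S where S: "L = lengths S" "zs S" by blast
    show "set_elasticity L \<le> ereal (real (davenport G) / 2)"
    proof (cases "S = {#}")
      case True
      thus ?thesis using S D lengths_empty by (simp add: set_elasticity_def one_ereal_def)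
    next
      case False
      obtain k l where kl: "k \<in> lengths S" "l \<in> lengths S" "0 < l"
        "set_elasticity (lengths S) = ereal (real k / real l)"
        using set_elasticity_lengths[OF D S(2) False] by metis
      have "2 * real k \<le> real (davenport G) * real l"
        using lengths_ratio[OF D kl(1,2)] by (metis of_nat_le_iff of_nat_mult of_nat_numeral)
      thus ?thesis using kl(3,4) S(1) by (simp add: field_simps)
    qed
  qed
  obtain U where U: "atom U" "size U = davenport G" by (rule davenport_attained)
  have len: "2 * 1 \<in> lengths (repeat_mset 1 (symmetrize U))" "davenport G * 1 \<in> lengths (repeat_mset 1 (symmetrize U))"
    using symmetrize_lengths[OF U(1), of 1] U(2) D by auto
  hence "set_elasticity (lengths (repeat_mset 1 (symmetrize U))) = ereal (real (davenport G) / 2)"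
    by (intro set_elasticity_max[OF D len(2,1)]) auto
  moreover have "lengths (repeat_mset 1 (symmetrize U)) \<in> lengths ` {S. zs S}" using lengths_zs[OF len(1)] by blast
  from SUP_upper[OF this, of set_elasticity]
  have "set_elasticity (lengths (repeat_mset 1 (symmetrize U))) \<le> (SUP L\<in>lengths ` {S. zs S}. set_elasticity L)" .
  ultimately show "ereal (real (davenport G) / 2) \<le> (SUP L\<in>lengths ` {S. zs S}. set_elasticity L)"
    by simp
qed

lemma symmetric_if_pairs:
  assumes "\<And>U. U \<in># F \<Longrightarrow> atom U \<and> size U = 2" "x \<in> carrier G"
  shows "count (\<Sum>\<^sub># F) (inv x) = count (\<Sum>\<^sub># F) x"
  using assms(1)
proof (induction F)
  case (add U F)
  have U: "atom U" "size U = 2" using add.prems by auto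
  then obtain a b where ab: "U = {#a, b#}" by (metis numeral_2_eq_2 size_Suc_Diff1 size_eq_Suc_imp_eq_union size_1_singleton_mset One_nat_def add_left_imp_eq plus_1_eq_Suc size_add_mset)
  have c: "a \<in> carrier G" "b \<in> carrier G" using atomD(1)[OF U(1)] ab by auto
  have "a \<otimes> b = \<one>" using atomD(2)[OF U(1)] ab c by simp
  hence b: "b = inv a" using c by (metis inv_equality m_comm)
  have "a = inv x \<longleftrightarrow> inv a = x" "inv a = inv x \<longleftrightarrow> a = x" using c assms(2) by (metis inv_inv)+
  hence "count U (inv x) = count U x" unfolding ab b using c by auto
  thus ?case using add by simp
qed simp

lemma count_inv_image:
  assumes "set_mset S \<subseteq> carrier G" "x \<in> carrier G"
  shows "count (image_mset (m_inv G) S) x = count S (inv x)"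
  using assms(1)
proof (induction S)
  case (add y S)
  have "inv y = x \<longleftrightarrow> y = inv x" using add.prems assms(2) by auto
  thus ?case using add by simp
qed simp

text \<open>The factor 2 pays for involutions, which the symmetrization contains twice as often as
  \<open>U\<close>. For all other \<open>x\<close>, length at least 3 prevents \<open>x\<close> and
  \<open>inv x\<close> from both occurring in \<open>U\<close>.\<close>

lemma symmetrize_contained:
  assumes "atom U" "3 \<le> size U" "repeat_mset (2 * n) U \<subseteq># S" "set_mset S \<subseteq> carrier G"
    and sy: "\<And>x. x \<in> carrier G \<Longrightarrow> count S (inv x) = count S x"
  shows "repeat_mset n (symmetrize U) \<subseteq># S"
proof (rule mset_subset_eqI)
  fix x
  show "count (repeat_mset n (symmetrize U)) x \<le> count S x"
  proof (cases "x \<in> carrier G")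
    case True
    note ci = count_inv_image[OF atomD(1)[OF assms(1)] True]
    have le: "2 * n * count U y \<le> count S y" for y
      using mset_subset_eq_count[OF assms(3), of y] by simp
    have "count U x = 0 \<or> count U (inv x) = 0 \<or> x = inv x"
    proof (rule ccontr)
      assume "\<not> ?thesis"
      hence "x \<in># U" "inv x \<in># U" "x \<noteq> inv x" by auto
      hence "U = {#x, inv x#}" by (rule atom_pair_eq[OF assms(1)])
      hence "size U = size {#x, inv x#}" by simp
      thus False using assms(2) by simp
    qed
    thus ?thesis using le[of x] le[of "inv x"] sy[OF True] ci by (auto simp: symmetrize_def algebra_simps)
  next
    case False
    have "x \<notin># symmetrize U" using False atomD(1)[OF assms(1)] by (auto simp: symmetrize_def)
    thus ?thesis by (simp add: not_in_iff)
  qed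
qed

section \<open>From congruences to consecutive lengths\<close>

lemma long_atomI:
  assumes "atom U" "size U = davenport G" "\<not> cyclic_group G"
    and cong: "\<And>C k l. set_mset C \<subseteq> set_mset (symmetrize U) \<Longrightarrow> k \<in> lengths C \<Longrightarrow> l \<in> lengths C \<Longrightarrow> d dvd int k - int l"
  shows "long_atom G (set_mset (symmetrize U)) d U"
proof unfold_locales
  note Uc = atomD(1)[OF assms(1)]
  show "set_mset (symmetrize U) \<subseteq> carrier G" using Uc by (auto simp: symmetrize_def)
  have "\<one> \<notin># U"
    using atom_contains_one[OF assms(1)] assms(2) davenport_ge_3[OF assms(3)] by auto
  thus "\<one> \<notin> set_mset (symmetrize U)" using Uc by (auto simp: symmetrize_def) (metis inv_eq_1_iff subsetD)
  fix x assume "x \<in># symmetrize U"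
  thus "inv x \<in># symmetrize U" using Uc by (auto simp: symmetrize_def)
qed (use assms in \<open>auto simp: symmetrize_def\<close>)

text \<open>The differences of lengths over the symmetrized support form a subgroup of the integers.
  Its generator is itself such a difference and, dividing all others, must be 1.\<close>

lemma consecutive_lengths_exist:
  assumes U: "atom U" "size U = davenport G" and nc: "\<not> cyclic_group G"
    and unit: "\<And>d. long_atom G (set_mset (symmetrize U)) d U \<Longrightarrow> d dvd 1"
  shows "\<exists>C n. set_mset C \<subseteq> set_mset (symmetrize U) \<and> n \<in> lengths C \<and> Suc n \<in> lengths C"
proof -
  let ?D = "{int k - int l | k l. \<exists>C. set_mset C \<subseteq> set_mset (symmetrize U) \<and> k \<in> lengths C \<and> l \<in> lengths C}"
  note D = davenport_ge_3[OF nc]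
  have "set_mset (symmetrize U) \<subseteq> set_mset (symmetrize U) \<and> davenport G \<in> lengths (symmetrize U) \<and> 2 \<in> lengths (symmetrize U)"
    using symmetrize_lengths[OF U(1), of 1] U(2) D by simp
  hence mem: "int (davenport G) - int 2 \<in> ?D" by blast
  have ne: "int (davenport G) - int 2 \<noteq> 0" using D by simp
  have diff: "a - b \<in> ?D" if ab: "a \<in> ?D" "b \<in> ?D" for a b
  proof -
    obtain k l C where a: "a = int k - int l" "set_mset C \<subseteq> set_mset (symmetrize U)" "k \<in> lengths C" "l \<in> lengths C"
      using ab(1) by blast
    obtain k' l' C' where b: "b = int k' - int l'" "set_mset C' \<subseteq> set_mset (symmetrize U)" "k' \<in> lengths C'" "l' \<in> lengths C'"
      using ab(2) by blast
    \<comment> \<open>Differences over \<open>C\<close> and \<open>C'\<close> are subtracted by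
      concatenating the sequences and factoring them crosswise.\<close>
    have "a - b = int (k + l') - int (l + k')" using a b by simp
    moreover have "set_mset (C + C') \<subseteq> set_mset (symmetrize U)" "k + l' \<in> lengths (C + C')" "l + k' \<in> lengths (C + C')"
      using a b lengths_add by auto
    ultimately show ?thesis by blast
  qed
  obtain d where d: "d \<in> ?D" "d > 0" "\<And>z. z \<in> ?D \<Longrightarrow> d dvd z"
  proof (rule int_set_least_divides[OF mem ne])
    fix a b assume "a \<in> ?D" "b \<in> ?D"
    thus "a - b \<in> ?D" by (rule diff)
  next
    fix d assume "d \<in> ?D" "0 < d" "\<And>z. z \<in> ?D \<Longrightarrow> d dvd z"
    thus thesis by (rule that)
  qed
  have "long_atom G (set_mset (symmetrize U)) d U"
    by (rule long_atomI[OF U nc]) (use d(3) in blast)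
  hence "d = 1" using unit d(2) by (metis abs_of_pos zdvd1_eq)
  then obtain k l C where "1 = int k - int l" "set_mset C \<subseteq> set_mset (symmetrize U)" "k \<in> lengths C" "l \<in> lengths C"
    using d(1) by blast
  moreover from this have "k = Suc l" by simp
  ultimately show ?thesis by blast
qed

lemma zs_complement_length:
  assumes "zs S" "C \<subseteq># S" "zs C"
  obtains t where "\<And>n. n \<in> lengths C \<Longrightarrow> n + t \<in> lengths S"
proof -
  have c: "set_mset (S - C) \<subseteq> carrier G" using assms(1) by (auto dest: in_diffD)
  have "\<sigma> (S - C) = \<one>" using seq_sum_diff[OF _ assms(2)] assms(1,3) c by simp
  then obtain t where "t \<in> lengths (S - C)" using lengths_exist c by blast
  hence "n + t \<in> lengths S" if "n \<in> lengths C" for n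
    using lengths_add[OF that] assms(2) by (metis subset_mset.add_diff_inverse)
  thus ?thesis using that by blast
qed

text \<open>\<open>k\<close> copies of a sequence with lengths \<open>n\<close> and
  \<open>Suc n\<close> have an interval of \<open>k + 1\<close> lengths. Embedding them in a power
  of the symmetrized \<open>U\<close> keeps the interval and has maximal elasticity.\<close>

lemma one_in_Delta_rho:
  assumes H: "transfer_krull_monoid H G" and nc: "\<not> cyclic_group G"
    and unit: "\<And>U d. atom U \<Longrightarrow> size U = davenport G \<Longrightarrow> long_atom G (set_mset (symmetrize U)) d U \<Longrightarrow> d dvd 1"
  shows "1 \<in> Delta_rho H"
proof -
  note D = davenport_ge_3[OF nc]
  obtain U where U: "atom U" "size U = davenport G" by (rule davenport_attained)
  obtain C n where C: "set_mset C \<subseteq> set_mset (symmetrize U)" "n \<in> lengths C" "Suc n \<in> lengths C"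
    using consecutive_lengths_exist[OF U nc] unit[OF U] by blast
  show ?thesis unfolding Delta_rho_def
  proof (intro CollectI conjI allI impI)
    fix k :: nat assume "0 < k"
    \<comment> \<open>Large enough for \<open>k\<close> copies of \<open>C\<close> to fit; the added
      1 makes \<open>2 * m\<close> a positive length.\<close>
    define m where "m = k * size C + 1"
    define S where "S = repeat_mset m (symmetrize U)"
    have len: "2 * m \<in> lengths S" "davenport G * m \<in> lengths S"
      using symmetrize_lengths[OF U(1), of m] U(2) D by (auto simp: S_def)
    have el: "set_elasticity (lengths S) = elasticity H"
      unfolding elasticity_transfer_krull[OF H nc]
      by (rule set_elasticity_max[OF D len(2,1)]) (auto simp: m_def)
    have kC: "set_mset (repeat_mset k C) \<subseteq> set_mset (symmetrize U)"
      using C(1) by (auto simp: repeat_mset.rep_eq simp flip: count_greater_zero_iff)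
    have "size (repeat_mset k C) = k * size C" by (induction k) auto
    hence sub: "repeat_mset k C \<subseteq># S" unfolding S_def by (intro symmetrize_contains[OF kC]) (simp add: m_def)
    have zkC: "zs (repeat_mset k C)" using lengths_zs[OF lengths_repeat[OF C(2)]] .
    obtain t where t: "\<And>n. n \<in> lengths (repeat_mset k C) \<Longrightarrow> n + t \<in> lengths S"
      using zs_complement_length[OF lengths_zs[OF len(1)] sub zkC] by blast
    have int: "k * n + i + t \<in> lengths S" if i: "i \<le> k" for i
    proof (rule t)
      obtain j where j: "k = i + j" using le_Suc_ex[OF i] by blast
      have "i * Suc n + j * n \<in> lengths (repeat_mset i C + repeat_mset j C)"
        by (intro lengths_add lengths_repeat C)
      moreover have "repeat_mset i C + repeat_mset j C = repeat_mset k C"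
        unfolding j by (simp only: repeat_mset_distrib)
      moreover have "i * Suc n + j * n = k * n + i" unfolding j by (simp add: algebra_simps)
      ultimately show "k * n + i \<in> lengths (repeat_mset k C)" by (simp only:)
    qed
    define y where "y = int (k * n + t)"
    \<comment> \<open>For difference 1 there are no gaps to respect, so all lengths outside the
      interval go into these two sets.\<close>
    let ?L' = "{x. y + x \<in> int ` lengths S \<and> x < 0}"
    let ?L'' = "{x. y + x \<in> int ` lengths S \<and> int (k * 1) < x}"
    have fin_shift: "finite {x. y + x \<in> int ` lengths S}"
    proof (rule finite_subset)
      show "{x. y + x \<in> int ` lengths S} \<subseteq> (\<lambda>z. z - y) ` int ` lengths S"
      proof
        fix x assume "x \<in> {x. y + x \<in> int ` lengths S}"
        hence "y + x \<in> int ` lengths S" by simp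
        hence "(y + x) - y \<in> (\<lambda>z. z - y) ` int ` lengths S" by (rule imageI)
        thus "x \<in> (\<lambda>z. z - y) ` int ` lengths S" by simp
      qed
      show "finite ((\<lambda>z. z - y) ` int ` lengths S)" using lengths_finite[OF D] by simp
    qed
    have "int ` lengths S = (\<lambda>x. y + x) ` (?L' \<union> {int (i * 1) | i. i \<le> k} \<union> ?L'')"
    proof (intro subset_antisym subsetI)
      fix z assume z: "z \<in> int ` lengths S"
      have "z - y \<in> ?L' \<union> {int (i * 1) | i. i \<le> k} \<union> ?L''"
      proof (cases "z - y < 0 \<or> int k < z - y")
        case True
        thus ?thesis using z by auto
      next
        case False
        hence "z - y = int (nat (z - y) * 1)" "nat (z - y) \<le> k" by auto
        thus ?thesis by blast
      qed
      thus "z \<in> (\<lambda>x. y + x) ` (?L' \<union> {int (i * 1) | i. i \<le> k} \<union> ?L'')" by (intro image_eqI[of _ _ "z - y"]) auto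
    next
      fix z assume "z \<in> (\<lambda>x. y + x) ` (?L' \<union> {int (i * 1) | i. i \<le> k} \<union> ?L'')"
      then obtain x where x: "z = y + x" "x \<in> ?L' \<union> {int (i * 1) | i. i \<le> k} \<union> ?L''" by blast
      show "z \<in> int ` lengths S"
      proof (cases "x \<in> {int (i * 1) | i. i \<le> k}")
        case True
        then obtain i where i: "x = int i" "i \<le> k" by auto
        have "z = int (k * n + i + t)" using x(1) i by (simp add: y_def)
        thus ?thesis using int[OF i(2)] by blast
      qed (use x in auto)
    qed
    moreover have "int ` lengths S \<subseteq> {y + int 1 * z | z. z \<in> UNIV}"
    proof
      fix z assume "z \<in> int ` lengths S"
      have "z = y + int 1 * (z - y)" by simp
      thus "z \<in> {y + int 1 * z | z. z \<in> UNIV}" by blast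
    qed
    moreover have "finite ?L'" "finite ?L''" using fin_shift by (auto elim: rev_finite_subset)
    moreover have "lengths S \<in> length_system H"
      using transfer_length_system[OF H] lengths_zs[OF len(1)] by blast
    ultimately show "\<exists>L\<in>length_system H. set_elasticity L = elasticity H \<and>
      (\<exists>(y::int) (l::nat) (L'::int set) (L''::int set).
              k \<le> l \<and> finite L' \<and> finite L'' \<and>
              (\<forall>x\<in>L'. x < 0) \<and> (\<forall>x\<in>L''. int (l * 1) < x) \<and>
              int ` L = (\<lambda>x. y + x) ` (L' \<union> {int (i * 1) | i. i \<le> l} \<union> L'') \<and>
              int ` L \<subseteq> {y + int 1 * z | z. z \<in> UNIV})"
      using el by (intro bexI[of _ "lengths S"] conjI exI[of _ y] exI[of _ k] exI[of _ ?L'] exI[of _ ?L'']) auto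
  qed simp
qed

text \<open>A long progression forces a long factorization into atoms of maximal length, so some
  \<open>U\<close> is repeated often. The element then contains the sequence with consecutive
  lengths belonging to \<open>U\<close>, while all its lengths agree modulo
  \<open>d\<close>.\<close>

lemma Delta_rho_le_one:
  assumes H: "transfer_krull_monoid H G" and nc: "\<not> cyclic_group G"
    and unit: "\<And>U d. atom U \<Longrightarrow> size U = davenport G \<Longrightarrow> long_atom G (set_mset (symmetrize U)) d U \<Longrightarrow> d dvd 1"
    and d: "d \<in> Delta_rho H"
  shows "d = 1"
proof -
  note D = davenport_ge_3[OF nc]
  let ?A = "{U. atom U \<and> size U = davenport G}"
  have finA: "finite ?A" by (rule finite_subset[OF _ finite_atoms]) auto
  have "\<forall>U\<in>?A. \<exists>C. \<exists>n. set_mset C \<subseteq> set_mset (symmetrize U) \<and> n \<in> lengths C \<and> Suc n \<in> lengths C"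
    using consecutive_lengths_exist[OF _ _ nc] unit by blast
  then obtain C where C: "\<And>U. U \<in> ?A \<Longrightarrow> \<exists>n. set_mset (C U) \<subseteq> set_mset (symmetrize U) \<and> n \<in> lengths (C U) \<and> Suc n \<in> lengths (C U)"
    by metis
  \<comment> \<open>\<open>c\<close> bounds the size of every \<open>C U\<close>, and
    \<open>2 * c\<close> copies of \<open>U\<close> yield \<open>c\<close> copies of its
    symmetrization. \<open>N\<close> is the pigeonhole threshold over the finitely many
    \<open>U\<close>, and \<open>k\<close> is chosen so that the minimal length exceeds
    \<open>N\<close>.\<close>
  define c where "c = (\<Sum>U\<in>?A. size (C U))"
  define N where "N = card ?A * (2 * c)"
  define k where "k = davenport G * (N + 1)"
  have "0 < k" using D by (simp add: k_def)
  from d have d0: "0 < d" unfolding Delta_rho_def by blast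
  have "\<exists>L\<in>length_system H. set_elasticity L = elasticity H \<and>
      (\<exists>(y::int) (l::nat) (L'::int set) (L''::int set).
              k \<le> l \<and> finite L' \<and> finite L'' \<and>
              (\<forall>x\<in>L'. x < 0) \<and> (\<forall>x\<in>L''. int (l * d) < x) \<and>
              int ` L = (\<lambda>x. y + x) ` (L' \<union> {int (i * d) | i. i \<le> l} \<union> L'') \<and>
              int ` L \<subseteq> {y + int d * z | z. z \<in> UNIV})"
    using d \<open>0 < k\<close> unfolding Delta_rho_def mem_Collect_eq by (elim conjE allE[of _ k] impE)
  then obtain L y l L' L'' where L: "L \<in> length_system H" "set_elasticity L = elasticity H"
    "k \<le> l" "int ` L = (\<lambda>x. y + x) ` (L' \<union> {int (i * d) | i. i \<le> l} \<union> L'')"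
    "int ` L \<subseteq> {y + int d * z | z. z \<in> UNIV}"
    by (elim bexE exE conjE)
  obtain S where S: "L = lengths S" "zs S" using L(1) unfolding transfer_length_system[OF H] by blast
  have "int (i * d) \<in> {int (i * d) | i. i \<le> l}" if "i \<le> l" for i using that by blast
  hence mem: "y + int (i * d) \<in> int ` L" if "i \<le> l" for i
    unfolding L(4) using that by (intro imageI UnI1 UnI2)
  obtain a where a: "y + int (0 * d) = int a" using mem[of 0] by (auto elim: imageE)
  obtain b where b: "y + int (l * d) = int b" "b \<in> L" using mem[of l] by (auto elim: imageE)
  have "k \<le> b"
  proof -
    have "l * 1 \<le> l * d" using d0 by (intro mult_le_mono2) simp
    moreover have "int b = int (a + l * d)" using a b(1) by simp
    ultimately show ?thesis using L(3) by linarith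
  qed
  have bS: "b \<in> lengths S" using b(2) S(1) by simp
  have Sne: "S \<noteq> {#}"
  proof
    assume "S = {#}"
    hence "b \<in> {0}" using bS lengths_empty by metis
    thus False using \<open>k \<le> b\<close> \<open>0 < k\<close> by simp
  qed
  obtain mx mn where m: "mx \<in> lengths S" "mn \<in> lengths S" "0 < mn" "\<And>i. i \<in> lengths S \<Longrightarrow> mn \<le> i \<and> i \<le> mx"
    "set_elasticity (lengths S) = ereal (real mx / real mn)"
    using set_elasticity_lengths[OF D S(2) Sne] by blast
  have "real mx / real mn = real (davenport G) / 2"
    using m(5) L(2) S(1) elasticity_transfer_krull[OF H nc] by simp
  hence "real (2 * mx) = real (davenport G * mn)" using m(3) by (simp add: field_simps)
  hence eq: "2 * mx = davenport G * mn" by (metis of_nat_eq_iff)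
  obtain F F' where F: "\<And>U. U \<in># F \<Longrightarrow> atom U \<and> size U = 2" "\<Sum>\<^sub># F = S"
    and F': "\<And>U. U \<in># F' \<Longrightarrow> atom U \<and> size U = davenport G" "\<Sum>\<^sub># F' = S" "size F' = mn"
    using lengths_ratio_eq[OF D m(1,2) eq] by blast
  have "N < mn"
  proof -
    have "k \<le> mx" using \<open>k \<le> b\<close> m(4)[OF bS] by simp
    hence "davenport G * (N + 1) \<le> davenport G * mn" using eq by (simp add: k_def)
    hence "N + 1 \<le> mn" unfolding mult_le_cancel1 using D by linarith
    thus ?thesis by simp
  qed
  obtain U where U: "U \<in># F'" "2 * c \<le> count F' U"
  proof (rule ccontr)
    assume "\<not> thesis"
    hence "\<And>U. U \<in># F' \<Longrightarrow> count F' U \<le> 2 * c" using that by (meson nat_le_linear)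
    hence "size F' \<le> card (set_mset F') * (2 * c)"
      unfolding size_multiset_overloaded_eq using sum_bounded_above[of "set_mset F'" "count F'" "2 * c"] by simp
    also have "\<dots> \<le> N" unfolding N_def using F'(1) finA by (intro mult_le_mono1 card_mono) auto
    finally show False using \<open>N < mn\<close> F'(3) by simp
  qed
  have UA: "atom U" "size U = davenport G" "U \<in> ?A" using F'(1)[OF U(1)] by auto
  have dup: "repeat_mset (2 * c) U \<subseteq># S"
  proof -
    have "replicate_mset (2 * c) U \<subseteq># F'" using U(2) by (simp add: count_le_replicate_mset_subset_eq)
    then obtain R where "F' = replicate_mset (2 * c) U + R" by (metis subset_mset.le_iff_add)
    moreover have "\<Sum>\<^sub># (replicate_mset j U) = repeat_mset j U" for j by (induction j) auto
    ultimately have "S = repeat_mset (2 * c) U + \<Sum>\<^sub># R" using F'(2) by simp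
    thus ?thesis by simp
  qed
  have sub: "repeat_mset c (symmetrize U) \<subseteq># S"
  proof (rule symmetrize_contained[OF UA(1) _ dup])
    show "count S (inv x) = count S x" if "x \<in> carrier G" for x
      using symmetric_if_pairs[OF F(1) that] F(2) by auto
  qed (use UA(2) D S(2) in auto)
  obtain n where n: "set_mset (C U) \<subseteq> set_mset (symmetrize U)" "n \<in> lengths (C U)" "Suc n \<in> lengths (C U)"
    using C[OF UA(3)] by blast
  have "size (C U) \<le> c" unfolding c_def using UA(3) finA by (intro member_le_sum) auto
  hence "C U \<subseteq># S" using symmetrize_contains[OF n(1)] sub by (meson subset_mset.order_trans)
  then obtain t where t: "\<And>n. n \<in> lengths (C U) \<Longrightarrow> n + t \<in> lengths S"
    using zs_complement_length[OF S(2) _ lengths_zs[OF n(2)]] by blast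
  have "int (n + t) \<in> int ` L" "int (Suc n + t) \<in> int ` L" using t n(2,3) S(1) by blast+
  then obtain z z' where "int (n + t) = y + int d * z" "int (Suc n + t) = y + int d * z'" using L(5) by blast
  hence "1 = int d * (z' - z)" by (simp add: algebra_simps)
  hence "int d dvd 1" by (metis dvd_triv_left)
  thus "d = 1" by simp
qed

lemma Delta_rho_eq_one:
  assumes "transfer_krull_monoid H G" "\<not> cyclic_group G"
    and "\<And>U d. atom U \<Longrightarrow> size U = davenport G \<Longrightarrow> long_atom G (set_mset (symmetrize U)) d U \<Longrightarrow> d dvd 1"
  shows "Delta_rho H = {1}"
  using one_in_Delta_rho[OF assms(1,2)] Delta_rho_le_one[OF assms(1,2)] assms(3) by blast

end

section \<open>Products of cyclic groups and the remaining cases\<close>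

lemma cyclic_power_mult: "x \<otimes>\<^bsub>cyclic_power m r\<^esub> y = (\<lambda>i\<in>{..<r}. (x i + y i) mod int m)"
  by (simp add: cyclic_power_def)

lemma cyclic_power_pow:
  "f \<in> carrier (cyclic_power m r) \<Longrightarrow>
    f [^]\<^bsub>cyclic_power m r\<^esub> (n::nat) = (\<lambda>i\<in>{..<r}. (int n * f i) mod int m)"
proof (induction n)
  case 0
  show ?case by (simp add: cyclic_power_def)
next
  case (Suc n)
  have "f [^]\<^bsub>cyclic_power m r\<^esub> (Suc n) = (\<lambda>i\<in>{..<r}. ((int n * f i) mod int m + f i) mod int m)"
    unfolding nat_pow_Suc Suc.IH[OF Suc.prems] cyclic_power_mult by (simp add: fun_eq_iff restrict_def)
  also have "\<dots> = (\<lambda>i\<in>{..<r}. (int (Suc n) * f i) mod int m)"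
    by (simp add: fun_eq_iff restrict_def algebra_simps mod_simps)
  finally show ?case .
qed

lemma group_cyclic_power: "group (cyclic_power m r)"
  by (simp add: cyclic_power_def)

lemma DirProd_pow: "(x, y) [^]\<^bsub>A \<times>\<times> B\<^esub> (n::nat) = (x [^]\<^bsub>A\<^esub> n, y [^]\<^bsub>B\<^esub> n)"
  by (induction n) (auto simp: DirProd_def)

lemma cyclic_power_carrier:
  "0 < m \<Longrightarrow> f \<in> carrier (cyclic_power m r) \<longleftrightarrow> f \<in> extensional {..<r} \<and> (\<forall>i<r. 0 \<le> f i \<and> f i < int m)"
  by (auto simp: cyclic_power_def carrier_integer_mod_group PiE_iff)

lemma cyclic_power_one: "\<one>\<^bsub>cyclic_power m r\<^esub> = (\<lambda>i\<in>{..<r}. 0)"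
  by (simp add: cyclic_power_def)

lemma cyclic_power_pow_eq_one:
  assumes "f \<in> carrier (cyclic_power m r)"
  shows "f [^]\<^bsub>cyclic_power m r\<^esub> (n::nat) = \<one>\<^bsub>cyclic_power m r\<^esub> \<longleftrightarrow> (\<forall>i<r. int m dvd int n * f i)"
  unfolding cyclic_power_pow[OF assms] cyclic_power_one
  by (auto simp: fun_eq_iff restrict_def dvd_eq_mod_eq_0)

lemma cyclic_power_root:
  assumes "f \<in> carrier (cyclic_power m r)" "0 < m" "0 < p" "\<And>i. i < r \<Longrightarrow> int p dvd f i"
  shows "\<exists>h\<in>carrier (cyclic_power m r). f = h [^]\<^bsub>cyclic_power m r\<^esub> p"
proof
  let ?h = "\<lambda>i\<in>{..<r}. f i div int p"
  have f: "f \<in> extensional {..<r}" "\<And>i. i < r \<Longrightarrow> 0 \<le> f i \<and> f i < int m"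
    using assms(1) cyclic_power_carrier[OF assms(2)] by auto
  have "f i div int p \<le> f i" if "i < r" for i
    using f(2)[OF that] assms(3) zdiv_mono2[of "f i" 1 "int p"] by simp
  hence "f i div int p < int m" if "i < r" for i using f(2)[OF that] that by (meson le_less_trans)
  thus h: "?h \<in> carrier (cyclic_power m r)"
    using f(2) assms(3) by (auto simp: cyclic_power_carrier[OF assms(2)] pos_imp_zdiv_nonneg_iff)
  show "f = ?h [^]\<^bsub>cyclic_power m r\<^esub> p"
    unfolding cyclic_power_pow[OF h] using f assms(4) by (auto simp: fun_eq_iff restrict_def extensional_def)
qed

text \<open>For recognizing a direct sum of two powers of the group of order 2 as an elementary
  2-group.\<close>

lemma cyclic_power_sum:
  "cyclic_power m r1 \<times>\<times> cyclic_power m r2 \<cong> cyclic_power m (r1 + r2)"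
proof -
  let ?A = "cyclic_power m r1" and ?B = "cyclic_power m r2" and ?C = "cyclic_power m (r1 + r2)"
  let ?f = "\<lambda>(x, y). \<lambda>i\<in>{..<r1 + r2}. if i < r1 then x i else y (i - r1)"
  have mem: "?f (x, y) \<in> carrier ?C" if "x \<in> carrier ?A" "y \<in> carrier ?B" for x y
    using that by (auto simp: cyclic_power_def PiE_iff)
  have "?f \<in> hom (?A \<times>\<times> ?B) ?C"
  proof (rule homI)
    fix u assume "u \<in> carrier (?A \<times>\<times> ?B)"
    thus "?f u \<in> carrier ?C" using mem by (auto simp: DirProd_def)
  next
    fix u v assume "u \<in> carrier (?A \<times>\<times> ?B)" "v \<in> carrier (?A \<times>\<times> ?B)"
    thus "?f (u \<otimes>\<^bsub>?A \<times>\<times> ?B\<^esub> v) = ?f u \<otimes>\<^bsub>?C\<^esub> ?f v"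
      by (auto simp: DirProd_def cyclic_power_def fun_eq_iff restrict_def)
  qed
  moreover have "bij_betw ?f (carrier (?A \<times>\<times> ?B)) (carrier ?C)"
  proof (rule bij_betwI[where g = "\<lambda>z. (\<lambda>i\<in>{..<r1}. z i, \<lambda>i\<in>{..<r2}. z (i + r1))"])
    show "?f \<in> carrier (?A \<times>\<times> ?B) \<rightarrow> carrier ?C" using mem by (auto simp: DirProd_def)
    show "(\<lambda>z. (\<lambda>i\<in>{..<r1}. z i, \<lambda>i\<in>{..<r2}. z (i + r1))) \<in> carrier ?C \<rightarrow> carrier (?A \<times>\<times> ?B)"
      by (auto simp: DirProd_def cyclic_power_def PiE_iff)
  next
    fix u assume u: "u \<in> carrier (?A \<times>\<times> ?B)"
    obtain x y where xy: "u = (x, y)" by (cases u)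
    have "x \<in> extensional {..<r1}" "y \<in> extensional {..<r2}"
      using u xy by (auto simp: DirProd_def cyclic_power_def PiE_iff)
    thus "((\<lambda>i\<in>{..<r1}. ?f u i), (\<lambda>i\<in>{..<r2}. ?f u (i + r1))) = u"
      unfolding xy by (auto simp: fun_eq_iff restrict_def extensional_def)
  next
    fix z assume "z \<in> carrier ?C"
    hence "z \<in> extensional {..<r1 + r2}" by (auto simp: cyclic_power_def PiE_iff)
    thus "?f (\<lambda>i\<in>{..<r1}. z i, \<lambda>i\<in>{..<r2}. z (i + r1)) = z"
      by (auto simp: fun_eq_iff restrict_def extensional_def)
  qed
  ultimately show ?thesis unfolding is_iso_def iso_def by blast
qed

context finite_comm_group
begin

lemma group_exponent_props:
  "0 < group_exponent G" "g \<in> carrier G \<Longrightarrow> g [^] group_exponent G = \<one>"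
  "(\<And>g. g \<in> carrier G \<Longrightarrow> g [^] (n::nat) = \<one>) \<Longrightarrow> group_exponent G dvd n"
proof -
  let ?P = "\<lambda>n::nat. 0 < n \<and> (\<forall>g\<in>carrier G. g [^] n = \<one>)"
  have "?P (order G)" using pow_order_eq_1 order_gt_0_iff_finite fin by simp
  hence P: "?P (group_exponent G)" unfolding group_exponent_def by (rule LeastI)
  thus pos: "0 < group_exponent G" and one: "g \<in> carrier G \<Longrightarrow> g [^] group_exponent G = \<one>" for g by auto
  assume n: "\<And>g. g \<in> carrier G \<Longrightarrow> g [^] n = \<one>"
  have "g [^] (n mod group_exponent G) = \<one>" if g: "g \<in> carrier G" for g
  proof -
    have "g [^] n = (g [^] group_exponent G) [^] (n div group_exponent G) \<otimes> g [^] (n mod group_exponent G)"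
      using g by (simp add: nat_pow_pow nat_pow_mult)
    thus ?thesis using n[OF g] one[OF g] g by simp
  qed
  moreover have "\<not> ?P (n mod group_exponent G)"
    by (rule not_less_Least[of _ ?P, folded group_exponent_def]) (use pos in simp)
  ultimately have "n mod group_exponent G = 0" by auto
  thus "group_exponent G dvd n" by auto
qed

text \<open>Elements of order \<open>p\<close> in different cyclic groups would form an independent
  set of cardinality 2.\<close>

lemma p_rank_one:
  assumes p: "Factorial_Ring.prime p" and r: "p_rank p G = 1"
    and x: "x \<in> carrier G" "ord x = p" and y: "y \<in> carrier G" "ord y = p"
  shows "y \<in> spn {x}"
proof (rule ccontr)
  assume n: "y \<notin> spn {x}"
  have xc: "{x} \<subseteq> carrier G" using x by simp
  have ne: "x \<noteq> y" using n xc by (auto intro: spn_incl)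
  \<comment> \<open>Independence is stated with integer exponents; these are brought down to natural
    numbers below \<open>p\<close>.\<close>
  have red: "\<exists>j<p. z [^] k = z [^] (j::nat)" if "z \<in> carrier G" "ord z = p" for z and k :: int
  proof (intro exI[of _ "nat (k mod int p)"] conjI)
    have p0: "0 < int p" using p prime_gt_0_nat by simp
    show "nat (k mod int p) < p" using p0 by (simp add: nat_less_iff)
    have "z [^] k = z [^] (k mod int p)"
      using that by (simp add: int_pow_eq dvd_diff_commute minus_mod_eq_mult_div)
    thus "z [^] k = z [^] nat (k mod int p)" using p0 by (simp add: int_pow_def2)
  qed
  have "independent_in G {x, y}" unfolding independent_in_def
  proof (intro conjI allI impI)
    show "\<one> \<notin> {x, y}" using x y p by (auto dest: prime_gt_1_nat)
    fix m :: "'g \<Rightarrow> int"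
    assume "(\<Otimes>e\<in>{x, y}. e [^] m e) = \<one>"
    hence eq: "x [^] m x \<otimes> y [^] m y = \<one>" using x y ne by (simp add: finprod_insert)
    obtain i where i: "x [^] m x = x [^] (i::nat)" using red[OF x] by blast
    obtain j where j: "j < p" "y [^] m y = y [^] (j::nat)" using red[OF y] by blast
    have "y [^] j = inv (x [^] i)" using eq i j x y by (metis comm_inv_char nat_pow_closed)
    also have "\<dots> \<in> spn {x}" using x xc by (intro spn_inv spn_pow spn_incl) auto
    finally have "y [^] j \<in> spn {x}" .
    moreover have "y [^] j \<notin> spn {x}" if "0 < j"
      by (rule prime_power_min_index[OF p y(1) xc, of 1]) (use y n that j(1) spn_one in auto)
    ultimately have "j = 0" by blast
    hence "y [^] m y = \<one>" using j by simp
    moreover from this have "x [^] m x = \<one>" using eq x y by simp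
    ultimately show "\<forall>e\<in>{x, y}. e [^] m e = \<one>" by simp
  qed (use x y in auto)
  hence "card {x, y} \<in> {card E | E. independent_in G E \<and> (\<forall>e\<in>E. \<exists>k. ord e = p ^ k)}"
    using x y by (intro CollectI exI[of _ "{x, y}"]) (auto intro: exI[of _ 1])
  moreover have "finite {card E | E. independent_in G E \<and> (\<forall>e\<in>E. \<exists>k. ord e = p ^ k)}"
  proof (rule finite_subset)
    show "{card E | E. independent_in G E \<and> (\<forall>e\<in>E. \<exists>k. ord e = p ^ k)} \<subseteq> card ` Pow (carrier G)"
      by (auto simp: independent_in_def)
  qed (use fin in simp)
  ultimately have "card {x, y} \<le> p_rank p G" unfolding p_rank_def by (rule Max_ge[rotated])
  thus False using r ne by simp
qed

text \<open>The assumptions of the prime power case, verified in coordinates: in a cyclic group of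
  order \<open>p ^ s\<close>, what \<open>p ^ (s - 1)\<close> kills is a multiple of
  \<open>p\<close>.\<close>

lemma two_cyclic_powers:
  assumes iso: "G \<cong> cyclic_power (p ^ s1) r1 \<times>\<times> cyclic_power (p ^ s2) r2"
    and p: "Factorial_Ring.prime p" and s: "0 < r2" "0 < s1" "s1 \<le> s2"
  shows "\<And>g. g \<in> carrier G \<Longrightarrow> g [^] (p ^ s2) = \<one>"
    and "\<exists>g\<in>carrier G. g [^] (p ^ (s2 - 1)) \<noteq> \<one>"
    and "\<And>g. g \<in> carrier G \<Longrightarrow> g [^] (p ^ (s2 - 1)) = \<one> \<Longrightarrow>
      \<exists>b\<in>carrier G. \<exists>c\<in>carrier G. g = b \<otimes> c [^] p \<and> b [^] (p ^ s1) = \<one>"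
    and "\<And>g. g \<in> carrier G \<Longrightarrow> g [^] (p ^ (s1 - 1)) = \<one> \<Longrightarrow> \<exists>c\<in>carrier G. g = c [^] p"
proof -
  let ?A = "cyclic_power (p ^ s1) r1" and ?B = "cyclic_power (p ^ s2) r2"
  interpret K: group "?A \<times>\<times> ?B" by (intro DirProd_group group_cyclic_power)
  interpret A: group ?A by (rule group_cyclic_power)
  interpret B: group ?B by (rule group_cyclic_power)
  obtain \<phi> where \<phi>: "\<phi> \<in> iso G (?A \<times>\<times> ?B)" using iso by (auto simp: is_iso_def)
  interpret \<phi>: group_hom G "?A \<times>\<times> ?B" \<phi>
    using \<phi> by unfold_locales (auto simp: iso_def)
  have bij: "bij_betw \<phi> (carrier G) (carrier (?A \<times>\<times> ?B))" using \<phi> by (simp add: iso_def)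
  have surj: "\<exists>g\<in>carrier G. \<phi> g = (x, y)" if "x \<in> carrier ?A" "y \<in> carrier ?B" for x y
    using that bij by (auto simp: bij_betw_def DirProd_def image_iff) (metis (no_types, lifting) SigmaI imageE)
  have inj: "g = h" if "g \<in> carrier G" "h \<in> carrier G" "\<phi> g = \<phi> h" for g h
    using that bij by (auto simp: bij_betw_def dest: inj_onD)
  have comp: "\<exists>x\<in>carrier ?A. \<exists>y\<in>carrier ?B. \<phi> g = (x, y)" if "g \<in> carrier G" for g
    using \<phi>.hom_closed[OF that] by (auto simp: DirProd_def)
  have p0: "0 < p" using p by (simp add: prime_gt_0_nat)
  have pp: "0 < p ^ s1" "0 < p ^ s2" using p0 by auto
  have one: "g [^] n = \<one> \<longleftrightarrow> x [^]\<^bsub>?A\<^esub> n = \<one>\<^bsub>?A\<^esub> \<and> y [^]\<^bsub>?B\<^esub> n = \<one>\<^bsub>?B\<^esub>"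
    if "g \<in> carrier G" "\<phi> g = (x, y)" for g x y and n :: nat
  proof -
    have "g [^] n = \<one> \<longleftrightarrow> \<phi> (g [^] n) = \<phi> \<one>" using that(1) inj by auto
    also have "\<dots> \<longleftrightarrow> (x, y) [^]\<^bsub>?A \<times>\<times> ?B\<^esub> n = \<one>\<^bsub>?A \<times>\<times> ?B\<^esub>"
      using that \<phi>.hom_nat_pow \<phi>.hom_one by simp
    finally show ?thesis unfolding DirProd_pow by (simp add: DirProd_def)
  qed
  have s1s2: "int (p ^ s1) dvd int (p ^ s2)" using s(3) by (simp add: le_imp_power_dvd)
  have cancel: "int p dvd z" if "int (p ^ s) dvd int (p ^ (s - 1)) * z" "0 < s" for s z
  proof -
    have "int (p ^ s) = int (p ^ (s - 1)) * int p" using that(2) by (simp add: power_eq_if)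
    thus ?thesis using that(1) p0 by simp
  qed
  show "g [^] (p ^ s2) = \<one>" if g: "g \<in> carrier G" for g
  proof -
    obtain x y where xy: "x \<in> carrier ?A" "y \<in> carrier ?B" "\<phi> g = (x, y)" using comp[OF g] by blast
    show ?thesis unfolding one[OF g xy(3)] cyclic_power_pow_eq_one[OF xy(1)] cyclic_power_pow_eq_one[OF xy(2)]
      using s1s2 by (auto intro: dvd_mult2)
  qed
  show "\<exists>g\<in>carrier G. g [^] (p ^ (s2 - 1)) \<noteq> \<one>"
  proof -
    let ?y = "\<lambda>i\<in>{..<r2}. 1 :: int"
    have "1 < p ^ s2" using p s by (metis less_le_trans one_less_power prime_gt_1_nat)
    hence "1 < int (p ^ s2)" by (metis of_nat_1 of_nat_less_iff)
    hence y: "?y \<in> carrier ?B" unfolding cyclic_power_carrier[OF pp(2)] by auto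
    obtain g where g: "g \<in> carrier G" "\<phi> g = (\<one>\<^bsub>?A\<^esub>, ?y)" using surj[OF A.one_closed y] by blast
    have "\<not> int (p ^ s2) dvd int (p ^ (s2 - 1)) * ?y 0"
    proof
      assume "int (p ^ s2) dvd int (p ^ (s2 - 1)) * ?y 0"
      hence "int p dvd ?y 0" using cancel s by (metis less_le_trans)
      thus False using s(1) p by simp
    qed
    hence "g [^] (p ^ (s2 - 1)) \<noteq> \<one>"
      unfolding one[OF g] cyclic_power_pow_eq_one[OF y] using s(1) by blast
    thus ?thesis using g(1) by blast
  qed
  show "\<exists>b\<in>carrier G. \<exists>c\<in>carrier G. g = b \<otimes> c [^] p \<and> b [^] (p ^ s1) = \<one>"
    if g: "g \<in> carrier G" "g [^] (p ^ (s2 - 1)) = \<one>" for g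
  proof -
    obtain x y where xy: "x \<in> carrier ?A" "y \<in> carrier ?B" "\<phi> g = (x, y)" using comp[OF g(1)] by blast
    have "int p dvd y i" if "i < r2" for i
      using g(2) that cancel s unfolding one[OF g(1) xy(3)] cyclic_power_pow_eq_one[OF xy(2)]
      by (metis less_le_trans)
    then obtain h where h: "h \<in> carrier ?B" "y = h [^]\<^bsub>?B\<^esub> p"
      using cyclic_power_root[OF xy(2) pp(2) p0] by blast
    \<comment> \<open>\<open>b\<close> carries the component killed by \<open>p ^ s1\<close>, and
      \<open>c\<close> a root of the other component.\<close>
    obtain b where b: "b \<in> carrier G" "\<phi> b = (x, \<one>\<^bsub>?B\<^esub>)" using surj[OF xy(1) B.one_closed] by blast
    obtain c where c: "c \<in> carrier G" "\<phi> c = (\<one>\<^bsub>?A\<^esub>, h)" using surj[OF A.one_closed h(1)] by blast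
    have "\<phi> (b \<otimes> c [^] p) = (x, \<one>\<^bsub>?B\<^esub>) \<otimes>\<^bsub>?A \<times>\<times> ?B\<^esub> (\<one>\<^bsub>?A\<^esub>, h) [^]\<^bsub>?A \<times>\<times> ?B\<^esub> p"
      using b c by (simp add: \<phi>.hom_nat_pow)
    also have "\<dots> = \<phi> g" using xy h unfolding DirProd_pow by (simp add: DirProd_def)
    finally have "g = b \<otimes> c [^] p" using inj[OF g(1)] b c by simp
    moreover have "b [^] (p ^ s1) = \<one>"
      unfolding one[OF b] cyclic_power_pow_eq_one[OF xy(1)] by simp
    ultimately show ?thesis using b c by blast
  qed
  show "\<exists>c\<in>carrier G. g = c [^] p" if g: "g \<in> carrier G" "g [^] (p ^ (s1 - 1)) = \<one>" for g
  proof -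
    obtain x y where xy: "x \<in> carrier ?A" "y \<in> carrier ?B" "\<phi> g = (x, y)" using comp[OF g(1)] by blast
    have x1: "int p dvd x i" if "i < r1" for i
      using g(2) that cancel s unfolding one[OF g(1) xy(3)] cyclic_power_pow_eq_one[OF xy(1)] by metis
    have "int p dvd y i" if i: "i < r2" for i
    proof -
      have "int (p ^ s2) dvd int (p ^ (s1 - 1)) * y i"
        using g(2) i unfolding one[OF g(1) xy(3)] cyclic_power_pow_eq_one[OF xy(2)] by blast
      moreover have "int (p ^ (s1 - 1)) dvd int (p ^ (s2 - 1))" using s by (simp add: le_imp_power_dvd diff_le_mono)
      ultimately have "int (p ^ s2) dvd int (p ^ (s2 - 1)) * y i" by (meson dvd_refl dvd_trans mult_dvd_mono)
      thus ?thesis using cancel s by (metis less_le_trans)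
    qed
    then obtain h where h: "h \<in> carrier ?B" "y = h [^]\<^bsub>?B\<^esub> p"
      using cyclic_power_root[OF xy(2) pp(2) p0] by blast
    obtain h' where h': "h' \<in> carrier ?A" "x = h' [^]\<^bsub>?A\<^esub> p"
      using cyclic_power_root[OF xy(1) pp(1) p0 x1] by blast
    obtain c where c: "c \<in> carrier G" "\<phi> c = (h', h)" using surj[OF h'(1) h(1)] by blast
    have "\<phi> (c [^] p) = \<phi> g" using c xy h h' by (simp add: \<phi>.hom_nat_pow DirProd_pow)
    hence "g = c [^] p" using inj[OF g(1)] c by simp
    thus ?thesis using c by blast
  qed
qed

end

section \<open>The individual hypotheses on the group\<close>

context long_atom
begin

lemma coprime_exponent_case:
  assumes "x \<in># U" "ord x = group_exponent G"
    and "gcd (int (group_exponent G) - 2) (int (davenport G) - 2) = 1"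
  shows "d dvd 1"
proof -
  have "d dvd int (group_exponent G) - 2" using cong_ord[of x] U_supp assms(1,2) by auto
  hence "d dvd gcd (int (group_exponent G) - 2) (int (davenport G) - 2)" using U_cong by (rule gcd_greatest)
  thus ?thesis using assms(3) by simp
qed

text \<open>Since \<open>U\<close> generates \<open>G\<close>, an element of order equal to the
  exponent occurs in \<open>U\<close>; then \<open>d\<close> divides both arguments of the
  gcd.\<close>

lemma p_group_case:
  assumes p: "Factorial_Ring.prime p" "finite_p_group p G"
    and "gcd (int (group_exponent G) - 2) (int (davenport G) - 2) = 1"
  shows "d dvd 1"
proof -
  obtain n where "order G = p ^ n" using p(2) by (auto simp: finite_p_group_def)
  hence "group_exponent G dvd p ^ n" using group_exponent_props(3) pow_order_eq_1 by metis
  then obtain s where s: "group_exponent G = p ^ s" using divides_primepow_nat[OF p(1)] by blast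
  have "\<exists>x. x \<in># U \<and> ord x = group_exponent G"
  proof (rule ccontr)
    assume no: "\<nexists>x. x \<in># U \<and> ord x = group_exponent G"
    have "x [^] (p ^ (s - 1)) = \<one>" if x: "x \<in># U" for x
    proof (rule ccontr)
      assume ne: "x [^] (p ^ (s - 1)) \<noteq> \<one>"
      have xc: "x \<in> carrier G" using x U_carrier by auto
      have "ord x = p ^ s" using ord_prime_power[OF p(1) xc _ ne] group_exponent_props(2)[OF xc] s by simp
      thus False using no x s by auto
    qed
    hence d: "p ^ s dvd p ^ (s - 1)" using group_exponent_props(3) long_atom_pow_one s by metis
    \<comment> \<open>With truncated subtraction the two powers coincide for \<open>s = 0\<close>,
      so this case survives the divisibility and is refuted separately: \<open>U\<close> would
      contain \<open>\<one>\<close>.\<close>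
    have s0: "s = 0"
    proof (rule ccontr)
      assume "s \<noteq> 0"
      hence "p ^ (s - 1) < p ^ s" using prime_gt_1_nat[OF p(1)] by (intro power_strict_increasing) auto
      thus False using d p(1) by (meson dvd_imp_le leD prime_gt_0_nat zero_less_power)
    qed
    obtain x where x: "x \<in># U" using atomD(3)[OF U_atom] by blast
    have xc: "x \<in> carrier G" using x U_carrier by auto
    have "x = \<one>" using group_exponent_props(2)[OF xc] s s0 xc by simp
    thus False using x Supp_one U_supp by auto
  qed
  then obtain x where "x \<in># U" "ord x = group_exponent G" by blast
  thus ?thesis by (rule coprime_exponent_case[OF _ _ assms(3)])
qed

lemma two_prime_exponent:
  assumes pq: "Factorial_Ring.prime p" "Factorial_Ring.prime q" "p \<noteq> q" "group_exponent G = p * q"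
  obtains x where "x \<in># U" "ord x = p * q"
proof -
  have gt: "1 < p" "1 < q" by (rule prime_gt_1_nat[OF pq(1)], rule prime_gt_1_nat[OF pq(2)])
  have "\<exists>g\<in>carrier G. g [^] p \<noteq> \<one>"
  proof (rule ccontr)
    assume "\<not> ?thesis"
    hence "p * q dvd p" using group_exponent_props(3)[of p] pq(4) by auto
    hence "p * q \<le> p * 1" using gt by (auto dest: dvd_imp_le)
    thus False using gt by simp
  qed
  moreover have "\<exists>g\<in>carrier G. g [^] q \<noteq> \<one>"
  proof (rule ccontr)
    assume "\<not> ?thesis"
    hence "p * q dvd q" using group_exponent_props(3)[of q] pq(4) by auto
    hence "p * q \<le> 1 * q" using gt by (auto dest: dvd_imp_le)
    thus False using gt by simp
  qed
  ultimately show ?thesis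
    using full_order_exists[OF pq(1-3)] group_exponent_props(2) pq(4) that by metis
qed

text \<open>Here \<open>2 * p - 2\<close> is the power \<open>2 ^ Suc k\<close>, so it is enough to
  exclude an even \<open>d\<close>.\<close>

lemma power_of_two_case:
  assumes p: "Factorial_Ring.prime p" "p \<noteq> 2" "group_exponent G = p * 2" "p - 1 = 2 ^ k"
  shows "d dvd 1"
proof -
  obtain x where x: "x \<in># U" "ord x = p * 2"
    by (rule two_prime_exponent[OF p(1) two_is_prime_nat p(2,3)])
  have "\<not> 2 dvd d"
    by (rule even_case[OF p(1,2) _ x(1)]) (use x(2) group_exponent_props(2) p(3) in \<open>auto simp: mult.commute\<close>)
  hence cop: "coprime d (2 ^ Suc k)" by (simp add: coprime_power_right_iff)
  have "int (p * 2) - 2 = 2 * int (p - 1)" using prime_gt_1_nat[OF p(1)] by (simp add: of_nat_diff)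
  also have "\<dots> = 2 ^ Suc k" unfolding p(4) by simp
  finally have "d dvd 2 ^ Suc k" using cong_ord[of x] U_supp x by auto
  thus ?thesis using cop by (meson coprime_common_divisor dvd_refl)
qed

lemma two_prime_case:
  assumes pq: "Factorial_Ring.prime p" "Factorial_Ring.prime q" "p \<noteq> q" "group_exponent G = p * q"
    and cases: "gcd (int (p * q) - 2) (int (davenport G) - 2) = 1
             \<or> gcd (int (p * q) - 2) (int p + int q - 3) = 1
             \<or> (q = 2 \<and> (\<exists>k. p - 1 = 2 ^ k))
             \<or> (q = 2 \<and> p_rank p G = 1)"
  shows "d dvd 1"
proof -
  obtain x where x: "x \<in># U" "ord x = p * q" by (rule two_prime_exponent[OF pq])
  have exp: "g [^] (p * q) = \<one>" if "g \<in> carrier G" for g using group_exponent_props(2)[OF that] pq(4) by simp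
  show ?thesis using cases
  proof (elim disjE conjE exE)
    assume "gcd (int (p * q) - 2) (int (davenport G) - 2) = 1"
    thus ?thesis using coprime_exponent_case x pq(4) by simp
  next
    assume gcd: "gcd (int (p * q) - 2) (int p + int q - 3) = 1"
    show ?thesis by (rule coprime_two_prime_case[OF pq(1-3) _ x gcd]) (rule exp)
  next
    fix k assume "q = 2" "p - 1 = 2 ^ k"
    thus ?thesis using power_of_two_case[OF pq(1)] pq(3,4) by simp
  next
    assume q: "q = 2" and r: "p_rank p G = 1"
    show ?thesis
      by (rule rank_one_case[OF pq(1) _ _ x(1)])
        (use pq(3) q exp x(2) p_rank_one[OF pq(1) r] in \<open>auto simp: mult.commute\<close>)
  qed
qed

text \<open>The bound \<open>3 \<le> p ^ s2\<close> fails just for \<open>p = 2\<close> and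
  \<open>s2 = 1\<close>, which is the excluded elementary 2-group.\<close>

lemma two_cyclic_powers_case:
  assumes p: "Factorial_Ring.prime p" and r: "0 < r1" "0 < r2" "0 < s1" "0 < s2" "s1 dvd s2"
    and iso: "G \<cong> cyclic_power (p ^ s1) r1 \<times>\<times> cyclic_power (p ^ s2) r2"
    and ne: "\<not> elementary_2_group G"
  shows "d dvd 1"
proof -
  have le: "s1 \<le> s2" using r by (simp add: dvd_imp_le)
  note K = two_cyclic_powers[OF iso p r(2,3) le]
  have p2: "2 \<le> p" using p by (rule prime_ge_2_nat)
  have "3 \<le> p ^ s2"
  proof (rule ccontr)
    assume small: "\<not> 3 \<le> p ^ s2"
    have "p ^ 1 \<le> p ^ s2" using r(4) p2 by (intro power_increasing) auto
    hence "p = 2" using small p2 by simp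
    moreover have "s2 = 1"
    proof (rule ccontr)
      assume "s2 \<noteq> 1"
      hence "p ^ 2 \<le> p ^ s2" using r(4) p2 by (intro power_increasing) auto
      thus False using small \<open>p = 2\<close> by simp
    qed
    moreover from this have "s1 = 1" using le r(3) by simp
    ultimately have "G \<cong> cyclic_power 2 r1 \<times>\<times> cyclic_power 2 r2" using iso by simp
    hence "G \<cong> cyclic_power 2 (r1 + r2)" using cyclic_power_sum iso_trans by blast
    thus False using ne by (auto simp: elementary_2_group_def)
  qed
  moreover obtain g0 where "g0 \<in> carrier G" "g0 [^] (p ^ (s2 - 1)) \<noteq> \<one>" using K(2) by blast
  ultimately show ?thesis using prime_power_case[OF p r(3,5,4) _ K(1) _ _ K(3,4)] by blast
qed

text \<open>The prime power case with lower exponent 1: for \<open>s\<close> at most 2, what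
  \<open>p ^ (s - 1)\<close> kills is killed by \<open>p\<close>, so \<open>g\<close> itself serves
  as \<open>b\<close> with trivial \<open>c\<close>.\<close>

lemma small_prime_power_case:
  assumes p: "Factorial_Ring.prime p" and e: "group_exponent G = p ^ s" "s \<in> {1, 2}" "3 \<le> p ^ s"
  shows "d dvd 1"
proof -
  have s0: "0 < s" using e(2) by auto
  have "\<exists>g\<in>carrier G. g [^] (p ^ (s - 1)) \<noteq> \<one>"
  proof (rule ccontr)
    assume "\<not> ?thesis"
    hence "p ^ s dvd p ^ (s - 1)" using group_exponent_props(3)[of "p ^ (s - 1)"] e(1) by auto
    moreover have "p ^ (s - 1) < p ^ s" using prime_gt_1_nat[OF p] s0 by (intro power_strict_increasing) auto
    ultimately show False using p by (meson dvd_imp_le leD prime_gt_0_nat zero_less_power)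
  qed
  then obtain g0 where g0: "g0 \<in> carrier G" "g0 [^] (p ^ (s - 1)) \<noteq> \<one>" by blast
  have one: "\<one> = \<one> [^] p" by simp
  show ?thesis
  proof (rule prime_power_case[OF p _ _ s0 e(3) _ g0, of 1])
    fix g assume g: "g \<in> carrier G"
    show "g [^] (p ^ s) = \<one>" using group_exponent_props(2)[OF g] e(1) by simp
    assume h: "g [^] (p ^ (s - 1)) = \<one>"
    have "g [^] (p ^ 1) = \<one>"
    proof (cases "s = 1")
      case True
      hence "g = \<one>" using h g by simp
      thus ?thesis by simp
    qed (use h e(2) in auto)
    thus "\<exists>b\<in>carrier G. \<exists>c\<in>carrier G. g = b \<otimes> c [^] p \<and> b [^] (p ^ 1) = \<one>"
      using g by (intro bexI[of _ g] bexI[of _ \<one>]) auto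
  next
    fix g assume "g \<in> carrier G" "g [^] (p ^ (1 - 1)) = \<one>"
    thus "\<exists>c\<in>carrier G. g = c [^] p" by (intro bexI[of _ \<one>]) auto
  qed auto
qed

text \<open>6 and 10 are twice the primes 3 and 5, each one more than a power of two; the other
  values are primes or squares of primes.\<close>

lemma small_exponent_case:
  assumes "group_exponent G \<in> {3, 4, 5, 6, 7, 9, 10, 11}"
  shows "d dvd 1"
proof -
  have primes: "Factorial_Ring.prime (2::nat)" "Factorial_Ring.prime (3::nat)" "Factorial_Ring.prime (5::nat)"
    "Factorial_Ring.prime (7::nat)" "Factorial_Ring.prime (11::nat)"
    by (simp_all add: prime_nat_numeral_eq)
  consider "group_exponent G = 3 ^ 1" | "group_exponent G = 2 ^ 2" | "group_exponent G = 5 ^ 1"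
    | "group_exponent G = 7 ^ 1" | "group_exponent G = 3 ^ 2" | "group_exponent G = 11 ^ 1"
    | "group_exponent G = 3 * 2" | "group_exponent G = 5 * 2"
    using assms by auto
  thus ?thesis
  proof cases
    case 7
    show ?thesis by (rule power_of_two_case[OF primes(2) _ 7, of 1]) auto
  next
    case 8
    show ?thesis by (rule power_of_two_case[OF primes(3) _ 8, of 2]) auto
  next
    case 1
    show ?thesis by (rule small_prime_power_case[OF primes(2) 1]) auto
  next
    case 2
    show ?thesis by (rule small_prime_power_case[OF primes(1) 2]) auto
  next
    case 3
    show ?thesis by (rule small_prime_power_case[OF primes(3) 3]) auto
  next
    case 4
    show ?thesis by (rule small_prime_power_case[OF primes(4) 4]) auto
  next
    case 5
    show ?thesis by (rule small_prime_power_case[OF primes(2) 5]) auto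
  next
    case 6
    show ?thesis by (rule small_prime_power_case[OF primes(5) 6]) auto
  qed
qed

end

theorem theorem2p2:
  fixes G :: "('g, 'm) monoid_scheme" and H :: "('h, 'n) monoid_scheme"
  assumes "comm_group G" and "finite (carrier G)" and "\<not> cyclic_group G"
    and "transfer_krull_monoid H G"
    and "((\<exists>p. Factorial_Ring.prime p \<and> finite_p_group p G) \<and>
            gcd (int (group_exponent G) - 2) (int (davenport G) - 2) = 1)
       \<or> ((\<exists>p r1 r2 s1 s2 :: nat. Factorial_Ring.prime p \<and>
              0 < r1 \<and> 0 < r2 \<and> 0 < s1 \<and> 0 < s2 \<and> s1 dvd s2 \<and>
              G \<cong> cyclic_power (p ^ s1) r1 \<times>\<times> cyclic_power (p ^ s2) r2) \<and>
            \<not> elementary_2_group G)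
       \<or> (\<exists>p q :: nat. Factorial_Ring.prime p \<and> Factorial_Ring.prime q \<and> p \<noteq> q \<and>
            group_exponent G = p * q \<and>
            (gcd (int (p * q) - 2) (int (davenport G) - 2) = 1
             \<or> gcd (int (p * q) - 2) (int p + int q - 3) = 1
             \<or> (q = 2 \<and> (\<exists>k. p - 1 = 2 ^ k))
             \<or> (q = 2 \<and> p_rank p G = 1)))
       \<or> group_exponent G \<in> {3, 4, 5, 6, 7, 9, 10, 11}"
  shows "Delta_rho H = {1}"
proof -
  interpret finite_comm_group G
    by (rule finite_comm_group.intro[OF assms(1)]) (unfold_locales, rule assms(2))
  show ?thesis
  proof (rule Delta_rho_eq_one[OF assms(4,3)])
    fix U d assume "long_atom G (set_mset (symmetrize U)) d U"
    then interpret long_atom G "set_mset (symmetrize U)" d U .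
    show "d dvd 1" using assms(5)
    proof (elim disjE conjE exE)
      fix p assume "Factorial_Ring.prime p" "finite_p_group p G"
        "gcd (int (group_exponent G) - 2) (int (davenport G) - 2) = 1"
      thus ?thesis by (rule p_group_case)
    next
      fix p r1 r2 s1 s2 :: nat
      assume "Factorial_Ring.prime p" "0 < r1" "0 < r2" "0 < s1" "0 < s2" "s1 dvd s2"
        "G \<cong> cyclic_power (p ^ s1) r1 \<times>\<times> cyclic_power (p ^ s2) r2" "\<not> elementary_2_group G"
      thus ?thesis by (rule two_cyclic_powers_case)
    next
      assume "group_exponent G \<in> {3, 4, 5, 6, 7, 9, 10, 11}"
      thus ?thesis by (rule small_exponent_case)
    qed (rule two_prime_case, assumption+, blast)+
  qed
qed

end
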